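(* Let $G$ be a bipartite graph with vertex classes $A$ and $B$. Suppose $\nu(G) = 2k$ for some integer $k$ and $\operatorname{conn}(L(G)) = k - 2$. If $G$ has no good set in $A$ nor in $B$, then the following hold: (i) $G$ has a perfect matching. (ii) For every minimal equineighbored subset $X \subseteq A$ or $X \subseteq B$ we have $|X| = 2$. In particular, $G[X \cup N(X)]$ is a $C_4$ (possibly with parallel edges).
   Context: Graphs may have parallel edges (the edge set is a multiset). $\nu(G)$ is the maximum size of a matching in $G$. $N(X)$ is the set of vertices adjacent to at least one vertex of $X$; $G[U]$ is the subgraph induced by $U$; $C_4$ is the cycle on $4$ vertices. Decent and good sets: let $G$ be bipartite with vertex classes $A$ and $B$. A subset $X \subseteq B$ is decent if (1) $|N(X)| \leq |X|$; (2) $\nu(G) = |N(X)| + |B \setminus X|$; (3) for every $x \in X$ and $y \in N(x)$ the edge $xy$ participates in a maximum matching of $G$. A subset $X \subseteq B$ is good if it is decent and if for all $y \in N(X)$ we have $\operatorname{conn}(L(G - \{yz \in E(G) : z \in B \setminus X\})) > \operatorname{conn}(L(G))$, where $G-F$ denotes deletion of the edges in $F$. For subsets of $A$ the notions are defined with the roles of $A$ and $B$ exchanged. A subset $X$ of a vertex class of $G$ is equineighbored if $X$ is nonempty and $|N(X)| = |X|$; minimal means minimal under inclusion among equineighbored subsets of that class. Line graph: $L(G)$ is the simple graph whose vertex set is $E(G)$ (parallel edges being distinct vertices), with two distinct edges $e, f$ adjacent iff $e \cap f \neq \emptyset$. Connectedness: for an integer $k\ge -1$, a space $X$ is $k$-connected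 if for every integer $j$ with $-1\le j\le k$ every continuous map $S^j \to X$ extends to a continuous map $B^{j+1} \to X$ (with $S^{-1}=\emptyset$, so $(-1)$-connected means nonempty). $\operatorname{conn}(X)$ is the largest $k$ such that $X$ is $k$-connected; it is $-2$ if $X$ is empty and $+\infty$ if $X$ is $k$-connected for all $k$. For a graph $H$, $\operatorname{conn}(H)$ means $\operatorname{conn}$ of (the geometric realization of) the independence complex of $H$, i.e. the abstract simplicial complex on $V(H)$ whose simplices are the independent sets of $H$. *)

theory Defs
  imports "HOL-Analysis.Analysis"
begin

section \<open>Connectedness of topological spaces\<close>

text \<open>The sphere \<open>S\<^sup>n\<close> is the library's \<^const>\<open>nsphere\<close> \<open>n\<close>, a subspace of
  \<open>Euclidean_space (Suc n)\<close>; \<open>nball n\<close> is the closed unit ball \<open>B\<^sup>n\<close> in \<open>Euclidean_space n\<close>.\<close>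

definition nball :: "nat \<Rightarrow> (nat \<Rightarrow> real) topology" where
  "nball n = subtopology (Euclidean_space n) {x. (\<Sum>i<n. (x i)\<^sup>2) \<le> 1}"

text \<open>The case \<open>j = -1\<close> of the extension property, with \<open>S\<^sup>-\<^sup>1 = {}\<close>, says that the
  space is nonempty. For \<open>k = -2\<close> the predicate holds for every space.\<close>

definition k_connected :: "int \<Rightarrow> 'a topology \<Rightarrow> bool" where
  "k_connected k X \<longleftrightarrow>
     (-1 \<le> k \<longrightarrow> topspace X \<noteq> {}) \<and>
     (\<forall>j::nat. int j \<le> k \<longrightarrow>
        (\<forall>f. continuous_map (nsphere j) X f \<longrightarrow>
           (\<exists>g. continuous_map (nball (Suc j)) X g \<and>
                (\<forall>x\<in>topspace (nsphere j). g x = f x))))"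

text \<open>Since \<open>k_connected k X\<close> is antitone in \<open>k\<close>, the supremum below is the largest \<open>k\<close>
  (at least \<open>-2\<close>) for which it holds, and \<open>\<infinity>\<close> if it holds for all \<open>k\<close>.\<close>

definition conn :: "'a topology \<Rightarrow> ereal" where
  "conn X = Sup {ereal (real_of_int k) | k. -2 \<le> k \<and> k_connected k X}"


section \<open>Simple graphs and independence complexes\<close>

record 'a sgraph =
  sverts :: "'a set"
  sadj :: "'a \<Rightarrow> 'a \<Rightarrow> bool"

definition independence_complex :: "'a sgraph \<Rightarrow> 'a set set" where
  "independence_complex H =
     {S. S \<subseteq> sverts H \<and> finite S \<and> (\<forall>u\<in>S. \<forall>v\<in>S. u \<noteq> v \<longrightarrow> \<not> sadj H u v)}"

text \<open>Points are given by barycentric coordinates. The topology is that of pointwise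
  convergence of the coordinates, which for a finite complex (the only case used here) is the
  usual topology of the realization. The empty simplex, whose coordinates sum to \<open>0\<close>,
  contributes no point.\<close>

definition geometric_realization :: "'a set set \<Rightarrow> ('a \<Rightarrow> real) topology" where
  "geometric_realization K =
     subtopology (powertop_real UNIV)
       {t. (\<forall>v. 0 \<le> t v) \<and> {v. t v \<noteq> 0} \<in> K \<and> (\<Sum>v | t v \<noteq> 0. t v) = 1}"

definition graph_conn :: "'a sgraph \<Rightarrow> ereal" where
  "graph_conn H = conn (geometric_realization (independence_complex H))"


section \<open>Multigraphs\<close>

text \<open>Edges are abstract objects with a set of endpoints, so that parallel edges are distinct
  edges \<open>e \<noteq> f\<close> with \<open>ends e = ends f\<close>.\<close>

record ('v, 'e) multigraph =
  verts :: "'v set"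
  edges :: "'e set"
  ends :: "'e \<Rightarrow> 'v set"

definition bipartite :: "('v, 'e) multigraph \<Rightarrow> 'v set \<Rightarrow> 'v set \<Rightarrow> bool" where
  "bipartite G A B \<longleftrightarrow>
     finite (verts G) \<and> finite (edges G) \<and> verts G = A \<union> B \<and> A \<inter> B = {} \<and>
     (\<forall>e\<in>edges G. \<exists>a\<in>A. \<exists>b\<in>B. ends G e = {a, b})"

definition neighbors :: "('v, 'e) multigraph \<Rightarrow> 'v set \<Rightarrow> 'v set" where
  "neighbors G X = {y \<in> verts G. \<exists>x\<in>X. \<exists>e\<in>edges G. ends G e = {x, y}}"

definition induced_subgraph :: "('v, 'e) multigraph \<Rightarrow> 'v set \<Rightarrow> ('v, 'e) multigraph" where
  "induced_subgraph G U = G\<lparr>verts := verts G \<inter> U, edges := {e \<in> edges G. ends G e \<subseteq> U}\<rparr>"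

definition delete_edges :: "('v, 'e) multigraph \<Rightarrow> 'e set \<Rightarrow> ('v, 'e) multigraph" where
  "delete_edges G F = G\<lparr>edges := edges G - F\<rparr>"

definition line_graph :: "('v, 'e) multigraph \<Rightarrow> 'e sgraph" where
  "line_graph G =
     \<lparr>sverts = edges G,
      sadj = (\<lambda>e f. e \<in> edges G \<and> f \<in> edges G \<and> e \<noteq> f \<and> ends G e \<inter> ends G f \<noteq> {})\<rparr>"

definition is_C4_with_parallel_edges :: "('v, 'e) multigraph \<Rightarrow> bool" where
  "is_C4_with_parallel_edges H \<longleftrightarrow>
     (\<exists>a b c d. distinct [a, b, c, d] \<and> verts H = {a, b, c, d} \<and>
        ends H ` edges H = {{a, b}, {b, c}, {c, d}, {d, a}})"


section \<open>Matchings\<close>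

definition matching :: "('v, 'e) multigraph \<Rightarrow> 'e set \<Rightarrow> bool" where
  "matching G M \<longleftrightarrow>
     M \<subseteq> edges G \<and> (\<forall>e\<in>M. \<forall>f\<in>M. e \<noteq> f \<longrightarrow> ends G e \<inter> ends G f = {})"

definition matching_number :: "('v, 'e) multigraph \<Rightarrow> nat" where
  "matching_number G = Max (card ` {M. matching G M})"

definition maximum_matching :: "('v, 'e) multigraph \<Rightarrow> 'e set \<Rightarrow> bool" where
  "maximum_matching G M \<longleftrightarrow> matching G M \<and> card M = matching_number G"

definition perfect_matching :: "('v, 'e) multigraph \<Rightarrow> 'e set \<Rightarrow> bool" where
  "perfect_matching G M \<longleftrightarrow> matching G M \<and> (\<Union>e\<in>M. ends G e) = verts G"


section \<open>Decent, good and equineighbored sets\<close>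

text \<open>Below, \<open>C\<close> is the vertex class containing \<open>X\<close>; it is instantiated with either of
  the two classes of a bipartite graph. Read literally, \<open>good G C {}\<close> holds (vacuously in its
  last clauses) as soon as \<open>matching_number G = card C\<close>, in
  particular whenever \<open>G\<close> has a perfect matching; only nonempty good sets are of interest.\<close>

definition decent :: "('v, 'e) multigraph \<Rightarrow> 'v set \<Rightarrow> 'v set \<Rightarrow> bool" where
  "decent G C X \<longleftrightarrow>
     X \<subseteq> C \<and>
     card (neighbors G X) \<le> card X \<and>
     matching_number G = card (neighbors G X) + card (C - X) \<and>
     (\<forall>x\<in>X. \<forall>y\<in>neighbors G {x}. \<forall>e\<in>edges G. ends G e = {x, y} \<longrightarrow>
        (\<exists>M. maximum_matching G M \<and> e \<in> M))"

definition good :: "('v, 'e) multigraph \<Rightarrow> 'v set \<Rightarrow> 'v set \<Rightarrow> bool" where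
  "good G C X \<longleftrightarrow>
     decent G C X \<and>
     (\<forall>y\<in>neighbors G X.
        graph_conn (line_graph (delete_edges G {e \<in> edges G. \<exists>z\<in>C - X. ends G e = {y, z}}))
          > graph_conn (line_graph G))"

definition equineighbored :: "('v, 'e) multigraph \<Rightarrow> 'v set \<Rightarrow> bool" where
  "equineighbored G X \<longleftrightarrow> X \<noteq> {} \<and> card (neighbors G X) = card X"

definition minimal_equineighbored :: "('v, 'e) multigraph \<Rightarrow> 'v set \<Rightarrow> 'v set \<Rightarrow> bool" where
  "minimal_equineighbored G C X \<longleftrightarrow>
     X \<subseteq> C \<and> equineighbored G X \<and> (\<forall>Y. Y \<subset> X \<longrightarrow> \<not> equineighbored G Y)"

end

theory Submission
  imports Defs
begin

text \<open>The simplices of the independence complex of \<open>L(G)\<close> are the matchings of \<open>G\<close>. The link of an edge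
\<open>f = ab\<close> in this complex is the complex of matchings of \<open>G - a - b\<close>, and removing the vertex \<open>f\<close>
leaves the complex of matchings of \<open>G - f\<close>. A simplicial complex is \<open>n\<close>-connected if it has a vertex
whose removal leaves an \<open>n\<close>-connected complex and whose link is \<open>(n-1)\<close>-connected
(\<open>fills_vertex_deletion\<close>). Hence
\<open>conn(L(G)) \<ge> min (conn(L(G - f))) (conn(L(G - a - b)) + 1)\<close>. Together with the remark that an
edge which meets no other edge makes the complex a cone, this is all the topology that is used:
one deletes edges one at a time, each time checking that the graph without the two ends of the
deleted edge is well connected, until some edge is isolated.

Deleting everything outside a matching of size \<open>s\<close> gives \<open>conn(L(G)) \<ge> s/2 - 2\<close>. The graphs of the
theorem attain this bound, so a contradiction arises whenever \<open>k - 1\<close> is reached instead of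
\<open>k - 2\<close>. A careful order of deletions reaches \<open>k - 1\<close> in two situations:

  \<^item> a vertex \<open>y\<close> has a neighbour, and each of its neighbours is missed by some matching of
    size \<open>2k\<close> (\<open>matching_connected_avoidable_neighbours\<close>);

  \<^item> \<open>2k \<le> |X| + \<nu>(G - X - N(X))\<close>, the graph between \<open>X\<close> and \<open>N(X)\<close> is elementary (it keeps
    a perfect matching after removal of any one vertex from each side), \<open>|X| \<noteq> 2\<close>, and some
    \<open>y \<in> N(X)\<close> has no neighbour outside \<open>X\<close> (\<open>matching_connected_private_vertex\<close>).

For (i), suppose that no matching covers \<open>B\<close>. By Hall's theorem in its deficiency form, a
smallest set \<open>X \<subseteq> B\<close> of maximum deficiency \<open>|X| - |N(X)| > 0\<close> is such that each \<open>x \<in> X\<close> is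
missed by some maximum matching. So \<open>X\<close> is decent, and the first situation applies to each
\<open>y \<in> N(X)\<close> after deletion of its edges to \<open>B \<setminus> X\<close>; this says that \<open>X\<close> is good. Hence both classes are
covered and \<open>G\<close> has a perfect matching.

For (ii), a minimal equineighbored set \<open>X\<close> is decent, and the graph between \<open>X\<close> and \<open>N(X)\<close> is
elementary by Hall's theorem. As \<open>X\<close> is not good, there is \<open>y \<in> N(X)\<close> such that the connectedness
does not grow when the edges from \<open>y\<close> to \<open>B \<setminus> X\<close> are deleted; in the graph that remains \<open>y\<close> has no
neighbour outside \<open>X\<close>. The second situation leaves only \<open>|X| = 2\<close>, and an elementary bipartite graph
with two vertices on each side is a \<open>C\<^sub>4\<close> up to parallel edges.\<close>

section \<open>Maps on spheres and balls as maps on cubes\<close>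

text \<open>Spheres and balls are replaced by boundaries and interiors of cubes because a cube can be cut
into small cubes of the same shape. Points live in \<^typ>\<open>nat \<Rightarrow> real\<close> with only the first \<open>m\<close>
coordinates in use, so that all dimensions share one type.\<close>

definition cube :: "nat \<Rightarrow> (nat \<Rightarrow> real) set" where
  "cube m = {x. (\<forall>i<m. \<bar>x i\<bar> \<le> 1) \<and> (\<forall>i\<ge>m. x i = 0)}"

definition cube_boundary :: "nat \<Rightarrow> (nat \<Rightarrow> real) set" where
  "cube_boundary m = {x \<in> cube m. \<exists>i<m. \<bar>x i\<bar> = 1}"

fun max_norm :: "nat \<Rightarrow> (nat \<Rightarrow> real) \<Rightarrow> real" where
  "max_norm 0 x = 0"
| "max_norm (Suc m) x = max (max_norm m x) \<bar>x m\<bar>"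

text \<open>This is the extension property that defines connectedness, for the pair of a cube and its boundary
instead of a ball and its sphere. For \<open>m = 0\<close> the boundary is empty and the property says that \<open>S\<close> is
nonempty, so \<open>-1\<close>-connectedness is not a special case.\<close>

definition fills :: "nat \<Rightarrow> 'b::topological_space set \<Rightarrow> bool" where
  "fills m S \<longleftrightarrow>
     (\<forall>g. continuous_on (cube_boundary m) g \<and> g ` cube_boundary m \<subseteq> S \<longrightarrow>
        (\<exists>h. continuous_on (cube m) h \<and> h ` cube m \<subseteq> S \<and> (\<forall>x\<in>cube_boundary m. h x = g x)))"

lemma continuous_on_coordinate: "continuous_on S (\<lambda>x. x i)"
  by (rule continuous_on_product_then_coordinatewise) auto

lemma max_norm_nonneg: "0 \<le> max_norm m x"
  by (induction m) auto

lemma max_norm_le_iff: "max_norm m x \<le> c \<longleftrightarrow> 0 \<le> c \<and> (\<forall>i<m. \<bar>x i\<bar> \<le> c)"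
  by (induction m) (auto simp: less_Suc_eq)

lemma abs_le_max_norm: "i < m \<Longrightarrow> \<bar>x i\<bar> \<le> max_norm m x"
  using max_norm_le_iff[of m x "max_norm m x"] by auto

lemma max_norm_attained: "0 < max_norm m x \<Longrightarrow> \<exists>i<m. \<bar>x i\<bar> = max_norm m x"
  by (induction m) (auto simp: max_def less_Suc_eq split: if_splits)

lemma continuous_on_max_norm: "continuous_on S (max_norm m)"
proof (induction m)
  case (Suc m)
  then show ?case
    by (auto simp: intro!: continuous_intros continuous_on_coordinate)
qed auto

lemma cube_boundary_iff: "x \<in> cube_boundary m \<longleftrightarrow> max_norm m x = 1 \<and> (\<forall>i\<ge>m. x i = 0)"
proof
  assume x: "x \<in> cube_boundary m"
  then have "max_norm m x \<le> 1" by (auto simp: cube_boundary_def cube_def max_norm_le_iff)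
  moreover have "1 \<le> max_norm m x"
    using x abs_le_max_norm[of _ m x] by (fastforce simp: cube_boundary_def)
  ultimately show "max_norm m x = 1 \<and> (\<forall>i\<ge>m. x i = 0)"
    using x by (auto simp: cube_boundary_def cube_def)
next
  assume x: "max_norm m x = 1 \<and> (\<forall>i\<ge>m. x i = 0)"
  then show "x \<in> cube_boundary m"
    using max_norm_attained[of m x] max_norm_le_iff[of m x 1]
    by (auto simp: cube_boundary_def cube_def)
qed

lemma max_norm_scale: "0 \<le> c \<Longrightarrow> max_norm m (\<lambda>i. c * x i) = c * max_norm m x"
  by (induction m) (auto simp: max_mult_distrib_left abs_mult)

lemma cube_iff: "x \<in> cube m \<longleftrightarrow> max_norm m x \<le> 1 \<and> (\<forall>i\<ge>m. x i = 0)"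
  by (auto simp: cube_def max_norm_le_iff)

lemma radial_projection_in_cube_boundary:
  assumes "x \<in> cube m" "max_norm m x \<noteq> 0"
  shows "(\<lambda>i. x i / max_norm m x) \<in> cube_boundary m"
  using assms max_norm_nonneg[of m x] max_norm_scale[of "inverse (max_norm m x)" m x]
  by (auto simp: cube_boundary_iff cube_iff divide_inverse mult.commute)

lemma cube_boundary_subset: "cube_boundary m \<subseteq> cube m"
  by (auto simp: cube_boundary_def)

text \<open>Where \<open>u\<close> vanishes the product tends to \<open>0\<close> because \<open>v\<close> is bounded, whatever \<open>v\<close> does there. This is
what is needed to see that radial constructions are continuous at the centre of the cube.\<close>

lemma continuous_on_mult_bounded:
  fixes u v :: "'b::topological_space \<Rightarrow> real"
  assumes u: "continuous_on S u" and v: "continuous_on {x \<in> S. u x \<noteq> 0} v"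
    and b: "\<And>x. x \<in> S \<Longrightarrow> u x \<noteq> 0 \<Longrightarrow> \<bar>v x\<bar> \<le> 1"
  shows "continuous_on S (\<lambda>x. u x * v x)"
  unfolding continuous_on_def
proof
  fix x assume x: "x \<in> S"
  have ux: "(u \<longlongrightarrow> u x) (at x within S)" using u x by (auto simp: continuous_on_def)
  show "((\<lambda>x. u x * v x) \<longlongrightarrow> u x * v x) (at x within S)"
  proof (cases "u x = 0")
    case True
    have "((\<lambda>y. \<bar>u y\<bar>) \<longlongrightarrow> 0) (at x within S)"
      using ux True by (simp add: tendsto_rabs_zero)
    moreover have "\<forall>\<^sub>F y in at x within S. norm (u y * v y) \<le> \<bar>u y\<bar>"
    proof -
      have "\<bar>u y * v y\<bar> \<le> \<bar>u y\<bar>" if "y \<in> S" for y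
        using b[OF that] by (cases "u y = 0") (auto simp: abs_mult mult_left_le)
      then show ?thesis by (auto simp: eventually_at_topological)
    qed
    ultimately show ?thesis using True by (auto intro: Lim_null_comparison)
  next
    case False
    have ev: "\<forall>\<^sub>F y in at x within S. u y \<noteq> 0"
      using tendsto_imp_eventually_ne[OF ux False] .
    have "at x within S = at x within {y \<in> S. u y \<noteq> 0}"
    proof -
      obtain T where "open T" "x \<in> T" "\<forall>y\<in>T. y \<noteq> x \<longrightarrow> y \<in> S \<longrightarrow> u y \<noteq> 0"
        using ev unfolding eventually_at_topological by blast
      then show ?thesis
        by (intro at_within_nhd[of x T]) auto
    qed
    moreover have "(v \<longlongrightarrow> v x) (at x within {y \<in> S. u y \<noteq> 0})"
      using v x False by (auto simp: continuous_on_def)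
    ultimately have "(v \<longlongrightarrow> v x) (at x within S)" by simp
    with ux show ?thesis by (rule tendsto_mult)
  qed
qed

text \<open>A map on the boundary is extended towards the centre of the cube by shrinking its values to the
origin. At the centre itself the formula divides by \<open>0\<close>, which is harmless since the factor in front
vanishes there.\<close>

lemma continuous_on_radial_cone:
  fixes g :: "(nat \<Rightarrow> real) \<Rightarrow> 'a \<Rightarrow> real"
  assumes g: "continuous_on (cube_boundary m) g"
    and b: "\<And>x a. x \<in> cube_boundary m \<Longrightarrow> \<bar>g x a\<bar> \<le> 1"
  shows "continuous_on (cube m) (\<lambda>x a. max_norm m x * g (\<lambda>i. x i / max_norm m x) a)"
proof (rule continuous_on_coordinatewise_then_product, rule continuous_on_mult_bounded)
  fix a
  let ?S = "{x \<in> cube m. max_norm m x \<noteq> 0}"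
  have "continuous_on ?S (\<lambda>x i. x i / max_norm m x)"
    by (auto intro!: continuous_on_coordinatewise_then_product continuous_on_divide
          continuous_on_coordinate continuous_on_max_norm)
  then have "continuous_on ?S (\<lambda>x. g (\<lambda>i. x i / max_norm m x))"
    by (rule continuous_on_compose2[OF g]) (auto simp: radial_projection_in_cube_boundary)
  then show "continuous_on ?S (\<lambda>x. g (\<lambda>i. x i / max_norm m x) a)"
    by (rule continuous_on_product_then_coordinatewise)
qed (auto intro!: continuous_on_max_norm b radial_projection_in_cube_boundary)

lemma fills_0_iff: "fills 0 S \<longleftrightarrow> S \<noteq> {}"
proof -
  have c: "cube 0 = {\<lambda>_. 0}" "cube_boundary 0 = {}"
    by (auto simp: cube_def cube_boundary_def)
  show ?thesis
  proof
    assume "fills 0 S"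
    then obtain h :: "(nat \<Rightarrow> real) \<Rightarrow> 'a" where "h ` cube 0 \<subseteq> S" unfolding fills_def c by auto
    then show "S \<noteq> {}" by (auto simp: c)
  next
    assume "S \<noteq> {}"
    then obtain s where "s \<in> S" by auto
    then show "fills 0 S" unfolding fills_def c by (intro allI impI exI[of _ "\<lambda>_. s"]) auto
  qed
qed

lemma sum_squares_bounds:
  fixes i m :: nat
  assumes "i < m" shows "(x i :: real)\<^sup>2 \<le> (\<Sum>i<m. (x i)\<^sup>2)"
  by (rule member_le_sum) (use assms in auto)

text \<open>The maps \<open>x / max 1 \<parallel>x\<parallel>\<^sub>2\<close> and \<open>x / max (1/\<surd>m) \<parallel>x\<parallel>\<^sub>\<infinity>\<close> carry the cube into the ball and the ball
into the cube. They are not inverse to each other, but they are on the two boundaries, and that is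
enough to transport an extension problem in both directions.\<close>

lemma fills_Suc_iff:
  fixes S :: "'b::topological_space set"
  shows "fills (Suc j) S \<longleftrightarrow>
    (\<forall>f. continuous_map (nsphere j) (top_of_set S) f \<longrightarrow>
       (\<exists>g. continuous_map (nball (Suc j)) (top_of_set S) g \<and> (\<forall>x\<in>topspace (nsphere j). g x = f x)))"
proof -
  define m where "m = Suc j"
  define s where "s = {x::nat \<Rightarrow> real. (\<forall>i\<ge>m. x i = 0) \<and> (\<Sum>i<m. (x i)\<^sup>2) = 1}"
  define b where "b = {x::nat \<Rightarrow> real. (\<forall>i\<ge>m. x i = 0) \<and> (\<Sum>i<m. (x i)\<^sup>2) \<le> 1}"
  have ns: "nsphere j = top_of_set s"
    unfolding nsphere s_def m_def Euclidean_space_def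
    by (simp add: euclidean_product_topology subtopology_subtopology lessThan_Suc_atMost Int_def
        Suc_le_eq conj_commute)
  have nb: "nball m = top_of_set b"
    unfolding nball_def b_def m_def Euclidean_space_def
    by (simp add: euclidean_product_topology subtopology_subtopology Int_def)
  define r where "r x = sqrt (\<Sum>i<m. (x i)\<^sup>2)" for x :: "nat \<Rightarrow> real"
  have r_cont: "continuous_on A r" for A
    unfolding r_def by (intro continuous_intros continuous_on_coordinate)
  have max_le_r: "max_norm m x \<le> r x" for x
  proof -
    have "\<bar>x i\<bar> \<le> r x" if "i < m" for i
      using real_sqrt_le_mono[OF sum_squares_bounds[of i m x, OF that]] unfolding r_def by simp
    moreover have "0 \<le> r x" by (simp add: r_def sum_nonneg)
    ultimately show ?thesis by (simp add: max_norm_le_iff)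
  qed
  have r_le: "r x \<le> sqrt m * max_norm m x" for x
  proof -
    have "(\<Sum>i<m. (x i)\<^sup>2) \<le> (\<Sum>i<m. (max_norm m x)\<^sup>2)"
      by (intro sum_mono) (metis abs_le_max_norm lessThan_iff power2_abs power_mono abs_ge_zero)
    then have "r x \<le> sqrt (m * (max_norm m x)\<^sup>2)" unfolding r_def by (simp add: real_sqrt_le_mono)
    also have "\<dots> = sqrt m * max_norm m x" by (simp add: real_sqrt_mult max_norm_nonneg)
    finally show ?thesis .
  qed
  have r_scale: "r (\<lambda>i. c * x i) = c * r x" if "0 \<le> c" for c x
    using that by (simp add: r_def power_mult_distrib real_sqrt_mult flip: sum_distrib_left)
  have m0: "0 < m" by (simp add: m_def)
  have s_iff: "x \<in> s \<longleftrightarrow> r x = 1 \<and> (\<forall>i\<ge>m. x i = 0)" for x by (auto simp: s_def r_def)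
  have b_iff: "x \<in> b \<longleftrightarrow> r x \<le> 1 \<and> (\<forall>i\<ge>m. x i = 0)" for x by (auto simp: b_def r_def)
  \<comment> \<open>On the boundary of its domain each map is the normalisation for the other norm;
    elsewhere it only has to stay inside the target.\<close>
  define to_ball where "to_ball x = (\<lambda>i. inverse (max 1 (r x)) * x i)" for x :: "nat \<Rightarrow> real"
  define to_cube where "to_cube x = (\<lambda>i. inverse (max (1 / sqrt m) (max_norm m x)) * x i)" for x
  have cb: "continuous_on A to_ball" for A
    unfolding to_ball_def
    by (auto intro!: continuous_on_coordinatewise_then_product continuous_on_mult continuous_on_inverse
        continuous_on_max continuous_on_coordinate r_cont)
  have pos: "0 < max (1 / sqrt m) (max_norm m x)" for x using m0 by (simp add: less_max_iff_disj)
  have cc: "continuous_on A to_cube" for A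
    unfolding to_cube_def
    by (intro continuous_on_coordinatewise_then_product continuous_on_mult continuous_on_inverse
        continuous_on_max continuous_on_coordinate continuous_on_max_norm)
      (use pos in \<open>auto simp: less_imp_neq[symmetric]\<close>)
  have tb: "to_ball x \<in> b" if "x \<in> cube m" for x
  proof -
    have "r (to_ball x) = inverse (max 1 (r x)) * r x"
      unfolding to_ball_def by (intro r_scale) simp
    also have "\<dots> \<le> 1" by (simp add: field_simps)
    finally show ?thesis using that by (auto simp: b_iff cube_def to_ball_def)
  qed
  have tbs: "to_ball x = (\<lambda>i. inverse (r x) * x i)" "r x > 0" if "x \<in> cube_boundary m" for x
    using that max_le_r[of x] by (auto simp: to_ball_def cube_boundary_iff max_def)
  have tbb: "to_ball x \<in> s" if "x \<in> cube_boundary m" for x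
    using tbs[OF that] that r_scale[of "inverse (r x)" x] by (auto simp: s_iff cube_boundary_iff)
  have tc: "to_cube x \<in> cube m" if "x \<in> b" for x
  proof -
    have "max_norm m (to_cube x) = inverse (max (1 / sqrt m) (max_norm m x)) * max_norm m x"
      unfolding to_cube_def using pos[of x] by (intro max_norm_scale) simp
    also have "\<dots> \<le> 1" using pos[of x] max_norm_nonneg[of m x]
      by (simp add: field_simps)
    finally show ?thesis using that by (auto simp: cube_iff b_iff to_cube_def)
  qed
  have tcs: "to_cube x = (\<lambda>i. inverse (max_norm m x) * x i)" "max_norm m x > 0" if "x \<in> s" for x
  proof -
    have "1 \<le> sqrt m * max_norm m x" using that r_le[of x] by (simp add: s_iff)
    then have "1 / sqrt m \<le> max_norm m x" using m0 by (simp add: divide_simps mult.commute)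
    moreover from this have "0 < max_norm m x" using m0 by (meson divide_pos_pos less_le_trans of_nat_0_less_iff real_sqrt_gt_zero zero_less_one)
    ultimately show "to_cube x = (\<lambda>i. inverse (max_norm m x) * x i)" "max_norm m x > 0"
      by (auto simp: to_cube_def max_def)
  qed
  have tcb: "to_cube x \<in> cube_boundary m" if "x \<in> s" for x
    using tcs[OF that] that max_norm_scale[of "inverse (max_norm m x)" m x]
    by (auto simp: s_iff cube_boundary_iff)
  have inv1: "to_cube (to_ball x) = x" if "x \<in> cube_boundary m" for x
  proof -
    have "max_norm m (to_ball x) = inverse (r x)"
      using tbs[OF that] that max_norm_scale[of "inverse (r x)" m x] by (simp add: cube_boundary_iff)
    then show ?thesis using tcs(1)[OF tbb[OF that]] tbs[OF that] by auto
  qed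
  have inv2: "to_ball (to_cube x) = x" if "x \<in> s" for x
  proof -
    have "r (to_cube x) = inverse (max_norm m x)"
      using tcs[OF that] that r_scale[of "inverse (max_norm m x)" x] by (simp add: s_iff)
    then show ?thesis using tbs(1)[OF tcb[OF that]] tcs[OF that] by auto
  qed
  show ?thesis unfolding ns m_def[symmetric] nb
  proof (intro iffI allI impI)
    fix f assume fl: "fills m S" and "continuous_map (top_of_set s) (top_of_set S) f"
    then have f: "continuous_on s f" "f ` s \<subseteq> S" by auto
    have "continuous_on (cube_boundary m) (f \<circ> to_ball)" "(f \<circ> to_ball) ` cube_boundary m \<subseteq> S"
      using f tbb by (auto simp: comp_def intro!: continuous_on_compose2[OF f(1) cb])
    then obtain h where h: "continuous_on (cube m) h" "h ` cube m \<subseteq> S"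
      "\<forall>x\<in>cube_boundary m. h x = (f \<circ> to_ball) x"
      using fl unfolding fills_def by metis
    have "continuous_on b (h \<circ> to_cube)"
      by (auto simp: comp_def intro!: continuous_on_compose2[OF h(1) cc] tc)
    then show "\<exists>g. continuous_map (top_of_set b) (top_of_set S) g \<and> (\<forall>x\<in>topspace (top_of_set s). g x = f x)"
      using h tc tcb inv2 by (intro exI[of _ "h \<circ> to_cube"]) (auto simp: image_subset_iff)
  next
    assume *: "\<forall>f. continuous_map (top_of_set s) (top_of_set S) f \<longrightarrow>
      (\<exists>g. continuous_map (top_of_set b) (top_of_set S) g \<and> (\<forall>x\<in>topspace (top_of_set s). g x = f x))"
    show "fills m S" unfolding fills_def
    proof (intro allI impI, elim conjE)
      fix f assume f: "continuous_on (cube_boundary m) f" "f ` cube_boundary m \<subseteq> S"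
      have "continuous_on s (f \<circ> to_cube)" "(f \<circ> to_cube) ` s \<subseteq> S"
        using f tcb by (auto simp: comp_def intro!: continuous_on_compose2[OF f(1) cc])
      then have "continuous_map (top_of_set s) (top_of_set S) (f \<circ> to_cube)" by (auto simp: image_subset_iff)
      then obtain g where "continuous_map (top_of_set b) (top_of_set S) g"
        "\<forall>x\<in>topspace (top_of_set s). g x = (f \<circ> to_cube) x" using * by blast
      then have g: "continuous_on b g" "g ` b \<subseteq> S" "\<forall>x\<in>s. g x = f (to_cube x)" by auto
      have "continuous_on (cube m) (g \<circ> to_ball)"
        by (auto simp: comp_def intro!: continuous_on_compose2[OF g(1) cb] tb)
      then show "\<exists>h. continuous_on (cube m) h \<and> h ` cube m \<subseteq> S \<and> (\<forall>x\<in>cube_boundary m. h x = f x)"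
        using g tb tbb inv1 by (intro exI[of _ "g \<circ> to_ball"]) (auto simp: image_subset_iff)
    qed
  qed
qed

lemma k_connected_iff_fills:
  assumes "-2 \<le> k"
  shows "k_connected k (top_of_set S) \<longleftrightarrow> (\<forall>m. int m \<le> k + 1 \<longrightarrow> fills m S)"
proof -
  have "(\<forall>m. int m \<le> k + 1 \<longrightarrow> fills m S) \<longleftrightarrow>
     (-1 \<le> k \<longrightarrow> fills 0 S) \<and> (\<forall>j. int j \<le> k \<longrightarrow> fills (Suc j) S)"
    (is "?L \<longleftrightarrow> ?R")
  proof
    assume ?R
    show ?L
    proof (intro allI impI)
      fix m assume "int m \<le> k + 1"
      with \<open>?R\<close> show "fills m S" by (cases m) auto
    qed
  qed auto
  then show ?thesis
    unfolding k_connected_def fills_0_iff fills_Suc_iff by simp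
qed

section \<open>Extending maps over a grid of cells\<close>

text \<open>The cells of the integer grid are coded by their doubled barycentres: coordinate \<open>i\<close> of a point of
\<open>cell k\<close> equals \<open>k i / 2\<close> if \<open>k i\<close> is even, and ranges over the unit interval around \<open>k i / 2\<close> if
\<open>k i\<close> is odd. So the dimension of the cell is the number of odd entries of \<open>k\<close>.\<close>

definition cell :: "(nat \<Rightarrow> nat) \<Rightarrow> (nat \<Rightarrow> real) set" where
  "cell k = {x. \<forall>i. real (k i div 2) \<le> x i \<and> x i \<le> real ((k i + 1) div 2)}"

definition cell_boundary :: "(nat \<Rightarrow> nat) \<Rightarrow> (nat \<Rightarrow> real) set" where
  "cell_boundary k =
     {x \<in> cell k. \<exists>i. odd (k i) \<and> (x i = real (k i div 2) \<or> x i = real ((k i + 1) div 2))}"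

definition face :: "(nat \<Rightarrow> nat) \<Rightarrow> (nat \<Rightarrow> nat) \<Rightarrow> bool" where
  "face k' k \<longleftrightarrow> (\<forall>i. k' i = k i \<or> odd (k i) \<and> (Suc (k' i) = k i \<or> k' i = Suc (k i)))"

definition free_coordinates :: "(nat \<Rightarrow> nat) \<Rightarrow> nat set" where
  "free_coordinates k = {i. odd (k i)}"

text \<open>The smallest cell that contains \<open>x\<close>.\<close>

definition carrier_cell :: "(nat \<Rightarrow> real) \<Rightarrow> nat \<Rightarrow> nat" where
  "carrier_cell x i = (if x i = real (nat \<lfloor>x i\<rfloor>) then 2 * nat \<lfloor>x i\<rfloor> else 2 * nat \<lfloor>x i\<rfloor> + 1)"

definition grid :: "nat \<Rightarrow> nat \<Rightarrow> (nat \<Rightarrow> nat) set" where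
  "grid m N = {k. (\<forall>i<m. k i \<le> 2 * N) \<and> (\<forall>i\<ge>m. k i = 0)}"

lemma face_subset: "face k' k \<Longrightarrow> cell k' \<subseteq> cell k"
proof
  fix x assume f: "face k' k" and x: "x \<in> cell k'"
  have "real (k i div 2) \<le> x i \<and> x i \<le> real ((k i + 1) div 2)" for i
  proof -
    have "k i div 2 \<le> k' i div 2" "(k' i + 1) div 2 \<le> (k i + 1) div 2"
      using f[unfolded face_def, rule_format, of i] by presburger+
    then have "real (k i div 2) \<le> real (k' i div 2)" "real ((k' i + 1) div 2) \<le> real ((k i + 1) div 2)"
      by (simp_all only: of_nat_le_iff)
    with x show ?thesis unfolding cell_def by (smt (verit) mem_Collect_eq)
  qed
  then show "x \<in> cell k" by (simp add: cell_def)
qed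

lemma proper_face_free:
  assumes "face k' k" "k' \<noteq> k"
  shows "free_coordinates k' \<subset> free_coordinates k"
proof -
  obtain i where i: "k' i \<noteq> k i" using assms(2) by auto
  have "odd (k i)" "even (k' i)"
    using assms(1)[unfolded face_def, rule_format, of i] i by (metis even_Suc)+
  moreover have "odd (k j)" if "odd (k' j)" for j
    using assms(1)[unfolded face_def, rule_format, of j] that by auto
  ultimately show ?thesis by (auto simp: free_coordinates_def)
qed

lemma proper_face_subset_boundary:
  assumes "face k' k" "k' \<noteq> k"
  shows "cell k' \<subseteq> cell_boundary k"
proof
  fix x assume x: "x \<in> cell k'"
  obtain i where i: "k' i \<noteq> k i" using assms(2) by auto
  have o: "odd (k i)" and k': "Suc (k' i) = k i \<or> k' i = Suc (k i)"
    using assms(1)[unfolded face_def, rule_format, of i] i by auto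
  have "k' i div 2 = (k' i + 1) div 2" "k' i div 2 = k i div 2 \<or> k' i div 2 = (k i + 1) div 2"
  proof -
    obtain a where "k i = 2 * a + 1" using o by (rule oddE)
    then have "k i = 2 * a + 1" "k' i = 2 * a \<or> k' i = 2 * a + 2" using k' by auto
    then show "k' i div 2 = (k' i + 1) div 2" "k' i div 2 = k i div 2 \<or> k' i div 2 = (k i + 1) div 2"
      by auto
  qed
  then have "x i = real (k i div 2) \<or> x i = real ((k i + 1) div 2)"
    using x unfolding cell_def by (metis (mono_tags, lifting) mem_Collect_eq order_antisym)
  then show "x \<in> cell_boundary k"
    using o x face_subset[OF assms(1)] by (auto simp: cell_boundary_def)
qed

text \<open>A cell that contains \<open>x\<close> can differ from the smallest one only in the coordinates in which \<open>x\<close> lies on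
an end of the edge of the cell.\<close>

lemma carrier_cell_cases:
  assumes "x \<in> cell k"
  shows "carrier_cell x i = k i \<or> odd (k i) \<and>
    (x i = real (k i div 2) \<and> Suc (carrier_cell x i) = k i \<or>
     x i = real ((k i + 1) div 2) \<and> carrier_cell x i = Suc (k i))"
proof -
  have b: "real (k i div 2) \<le> x i" "x i \<le> real ((k i + 1) div 2)" using assms by (auto simp: cell_def)
  show ?thesis
  proof (cases "odd (k i)")
    case False
    then have "x i = real (k i div 2)" using b by (metis even_Suc_div_two Suc_eq_plus1 order_antisym)
    then show ?thesis using False by (simp add: carrier_cell_def)
  next
    case True
    then obtain a where a: "k i = 2 * a + 1" by (metis oddE)
    have b': "real a \<le> x i" "x i \<le> real a + 1" using b a by auto
    consider "x i = real a" | "x i = real (Suc a)" | "real a < x i" "x i < real a + 1"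
      using b' by fastforce
    then show ?thesis
    proof cases
      case 3
      then have "\<lfloor>x i\<rfloor> = int a" by linarith
      then show ?thesis using 3 a by (simp add: carrier_cell_def)
    next
      case 2
      then have "nat \<lfloor>x i\<rfloor> = Suc a" by (simp add: nat_add_distrib)
      then show ?thesis using 2 a by (simp add: carrier_cell_def)
    qed (use a in \<open>simp_all add: carrier_cell_def\<close>)
  qed
qed

lemma carrier_cell_face: "x \<in> cell k \<Longrightarrow> face (carrier_cell x) k"
  unfolding face_def using carrier_cell_cases[of x k] by blast

lemma mem_carrier_cell:
  assumes "\<And>i. 0 \<le> x i"
  shows "x \<in> cell (carrier_cell x)"
proof -
  have "real (nat \<lfloor>x i\<rfloor>) \<le> x i \<and> x i \<le> real (nat \<lfloor>x i\<rfloor>) + 1" for i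
    using assms[of i] of_int_floor_le[of "x i"] real_of_int_floor_add_one_ge[of "x i"] by simp
  then have "real (carrier_cell x i div 2) \<le> x i \<and> x i \<le> real ((carrier_cell x i + 1) div 2)" for i
    by (simp add: carrier_cell_def add.commute)
  then show ?thesis by (simp add: cell_def)
qed

lemma cell_nonneg: "x \<in> cell k \<Longrightarrow> 0 \<le> x i"
  by (auto simp: cell_def intro: order_trans[rotated])

lemma carrier_cell_proper: "x \<in> cell_boundary k \<Longrightarrow> carrier_cell x \<noteq> k"
proof -
  assume x: "x \<in> cell_boundary k"
  then obtain i where i: "odd (k i)" "x i = real (k i div 2) \<or> x i = real ((k i + 1) div 2)"
    by (auto simp: cell_boundary_def)
  then have "even (carrier_cell x i)" by (auto simp: carrier_cell_def)
  then show ?thesis using i by auto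
qed

lemma closed_cell: "closed (cell k)"
proof -
  have "cell k = (\<Inter>i. {x. real (k i div 2) \<le> x i} \<inter> {x. x i \<le> real ((k i + 1) div 2)})"
    by (auto simp: cell_def)
  then show ?thesis
    by (auto intro!: closed_INT closed_Int closed_Collect_le continuous_on_const continuous_on_coordinate)
qed

lemma finite_grid: "finite (grid m N)"
proof (rule finite_subset)
  show "finite {f. \<forall>x. (x \<in> {..<m} \<longrightarrow> f x \<in> {..2 * N}) \<and> (x \<notin> {..<m} \<longrightarrow> f x = 0)}"
    by (rule finite_set_of_finite_funs) auto
qed (auto simp: grid_def)

lemma finite_free: "k \<in> grid m N \<Longrightarrow> free_coordinates k \<subseteq> {..<m}"
proof
  fix i assume k: "k \<in> grid m N" and "i \<in> free_coordinates k"
  then have "k i \<noteq> 0" unfolding free_coordinates_def by (metis even_zero mem_Collect_eq)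
  moreover have "k i = 0" if "m \<le> i" using k that by (simp add: grid_def)
  ultimately show "i \<in> {..<m}" by (meson lessThan_iff not_le_imp_less)
qed

lemma grid_face:
  assumes "k \<in> grid m N" "face k' k" shows "k' \<in> grid m N"
proof -
  have "k' i \<le> 2 * N" if "i < m" for i
  proof -
    have "k i \<le> 2 * N" using assms(1) that by (auto simp: grid_def)
    then show ?thesis using assms(2)[unfolded face_def, rule_format, of i] by presburger
  qed
  moreover have "k' i = 0" if "i \<ge> m" for i
    using assms(2)[unfolded face_def, rule_format, of i] assms(1) that by (auto simp: grid_def)
  ultimately show ?thesis by (auto simp: grid_def)
qed

text \<open>The acyclic carrier argument. Every cell \<open>k\<close> has a set \<open>\<Phi> k\<close> of allowed values, monotone along faces.
The map is built cell by cell in order of dimension: on a cell in \<open>A\<close> it is prescribed, and on any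
other cell it is already defined on the boundary, where it takes values in \<open>\<Phi> k\<close> by monotonicity, and
the last assumption fills the cell.\<close>

lemma extend_over_carriers:
  fixes \<Phi> :: "(nat \<Rightarrow> nat) \<Rightarrow> 'b::topological_space set" and g\<^sub>0 :: "(nat \<Rightarrow> real) \<Rightarrow> 'b"
  assumes "finite P"
    and "\<And>k k'. k \<in> P \<Longrightarrow> face k' k \<Longrightarrow> k' \<in> P"
    and "\<And>k. k \<in> P \<Longrightarrow> finite (free_coordinates k)"
    and "\<And>k k'. k \<in> P \<Longrightarrow> face k' k \<Longrightarrow> \<Phi> k' \<subseteq> \<Phi> k"
    and "\<And>k k'. k \<in> A \<Longrightarrow> face k' k \<Longrightarrow> k' \<in> A"
    and "\<And>k. k \<in> P \<Longrightarrow> k \<in> A \<Longrightarrow> continuous_on (cell k) g\<^sub>0 \<and> g\<^sub>0 ` cell k \<subseteq> \<Phi> k"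
    and "\<And>k g. k \<in> P \<Longrightarrow> k \<notin> A \<Longrightarrow> continuous_on (cell_boundary k) g \<Longrightarrow>
           g ` cell_boundary k \<subseteq> \<Phi> k \<Longrightarrow>
           \<exists>h. continuous_on (cell k) h \<and> h ` cell k \<subseteq> \<Phi> k \<and> (\<forall>x\<in>cell_boundary k. h x = g x)"
  shows "\<exists>G. continuous_on (\<Union>k\<in>P. cell k) G \<and> (\<forall>k\<in>P. G ` cell k \<subseteq> \<Phi> k) \<and>
           (\<forall>k\<in>P \<inter> A. \<forall>x\<in>cell k. G x = g\<^sub>0 x)"
  using assms(1-4,6-)
proof (induction "card P" arbitrary: P)
  case 0
  then show ?case by simp
next
  case (Suc n P)
  note hyps = Suc.prems
  have "P \<noteq> {}" using Suc.hyps(2) by auto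
  then have "Max ((\<lambda>k. card (free_coordinates k)) ` P) \<in> (\<lambda>k. card (free_coordinates k)) ` P"
    using hyps(1) by (intro Max_in) auto
  then obtain c where c: "c \<in> P" "card (free_coordinates c) = Max ((\<lambda>k. card (free_coordinates k)) ` P)" by auto
  \<comment> \<open>A cell of largest dimension is not a proper face of another one, so it can be added last.\<close>
  have cmax: "card (free_coordinates k) \<le> card (free_coordinates c)" if "k \<in> P" for k
    unfolding c(2) using hyps(1) that by (intro Max_ge) auto
  note c = c(1)
  have cface: "k = c" if "k \<in> P" "face c k" for k
  proof (rule ccontr)
    assume "k \<noteq> c"
    then have "card (free_coordinates c) < card (free_coordinates k)"
      using proper_face_free[OF that(2)] hyps(3)[OF that(1)] by (metis psubset_card_mono)
    then show False using cmax[OF that(1)] by simp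
  qed
  let ?P = "P - {c}"
  have "n = card ?P" using Suc.hyps(2) c by (simp add: card_Diff_singleton)
  then have "\<exists>G. continuous_on (\<Union>k\<in>?P. cell k) G \<and> (\<forall>k\<in>?P. G ` cell k \<subseteq> \<Phi> k) \<and>
           (\<forall>k\<in>?P \<inter> A. \<forall>x\<in>cell k. G x = g\<^sub>0 x)"
  proof (rule Suc.hyps(1))
    show "k' \<in> ?P" if "k \<in> ?P" "face k' k" for k k'
      using hyps(2)[of k k'] cface[of k] that by auto
  qed (use hyps in auto)
  then obtain G where G: "continuous_on (\<Union>k\<in>?P. cell k) G" "\<And>k. k \<in> ?P \<Longrightarrow> G ` cell k \<subseteq> \<Phi> k"
    "\<And>k x. k \<in> ?P \<Longrightarrow> k \<in> A \<Longrightarrow> x \<in> cell k \<Longrightarrow> G x = g\<^sub>0 x" by blast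
  let ?U = "\<Union>k\<in>?P. cell k"
  have bd: "cell_boundary c \<subseteq> ?U" and bdG: "G ` cell_boundary c \<subseteq> \<Phi> c"
    and bdA: "\<And>x. c \<in> A \<Longrightarrow> x \<in> cell_boundary c \<Longrightarrow> G x = g\<^sub>0 x"
  proof -
    have *: "carrier_cell x \<in> ?P" "x \<in> cell (carrier_cell x)" "face (carrier_cell x) c"
      if "x \<in> cell_boundary c" for x
    proof -
      have "x \<in> cell c" using that by (auto simp: cell_boundary_def)
      then show "x \<in> cell (carrier_cell x)" "face (carrier_cell x) c"
        by (auto intro: mem_carrier_cell carrier_cell_face cell_nonneg)
      then show "carrier_cell x \<in> ?P"
        using hyps(2)[OF c] carrier_cell_proper[OF that] by auto
    qed
    then show "cell_boundary c \<subseteq> ?U" by blast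
    show "G ` cell_boundary c \<subseteq> \<Phi> c" using * G(2) hyps(4)[OF c] by blast
    show "G x = g\<^sub>0 x" if "c \<in> A" "x \<in> cell_boundary c" for x
      using *[OF that(2)] G(3) assms(5)[OF that(1)] by blast
  qed
  \<comment> \<open>A cell meets the union of the others only in its boundary.\<close>
  have ov: "x \<in> cell_boundary c" if "x \<in> cell c" "x \<in> ?U" for x
  proof -
    obtain k where k: "k \<in> ?P" "x \<in> cell k" using \<open>x \<in> ?U\<close> by blast
    have "carrier_cell x \<noteq> c" using cface[of k] carrier_cell_face[OF k(2)] k(1) by auto
    then show ?thesis
      using proper_face_subset_boundary[OF carrier_cell_face[OF that(1)]] mem_carrier_cell[OF cell_nonneg[OF that(1)]] by auto
  qed
  obtain h where h: "continuous_on (cell c) h" "h ` cell c \<subseteq> \<Phi> c"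
    "\<And>x. x \<in> cell_boundary c \<Longrightarrow> h x = G x" "c \<in> A \<Longrightarrow> x \<in> cell c \<Longrightarrow> h x = g\<^sub>0 x" for x
  proof (cases "c \<in> A")
    case True
    then show ?thesis using that[of g\<^sub>0] hyps(5)[OF c True] bdA by auto
  next
    case False
    then show ?thesis
      using that hyps(6)[OF c False continuous_on_subset[OF G(1) bd] bdG] by auto
  qed
  let ?G = "\<lambda>x. if x \<in> cell c then h x else G x"
  have G_cont: "continuous_on (cell c \<union> ?U) ?G"
  proof (rule continuous_on_cases[OF _ _ h(1) G(1)])
    show "closed ?U" using hyps(1) by (auto intro!: closed_UN closed_cell)
    show "\<forall>x. x \<in> cell c \<and> x \<notin> cell c \<or> x \<in> ?U \<and> x \<in> cell c \<longrightarrow> h x = G x" using ov h(3) by auto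
  qed (rule closed_cell)
  have un: "cell c \<union> ?U = (\<Union>k\<in>P. cell k)" using c by auto
  have G_car: "?G ` cell k \<subseteq> \<Phi> k" if "k \<in> P" for k
  proof (cases "k = c")
    case False
    then have "?G x = G x" if "x \<in> cell k" for x
      using ov[of x] h(3)[of x] that \<open>k \<in> P\<close> by auto
    then show ?thesis using G(2)[of k] False that by auto
  qed (use h(2) in auto)
  have G_A: "?G x = g\<^sub>0 x" if "k \<in> P" "k \<in> A" "x \<in> cell k" for k x
  proof (cases "k = c")
    case False
    then have "?G x = G x" using ov[of x] h(3)[of x] that by auto
    then show ?thesis using G(3)[of k] False that by auto
  qed (use h(4) that in auto)
  show ?case
  proof (intro exI[of _ ?G] conjI ballI)
    show "continuous_on (\<Union>k\<in>P. cell k) ?G" using G_cont unfolding un .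
    show "?G ` cell k \<subseteq> \<Phi> k" if "k \<in> P" for k using G_car[OF that] .
    show "?G x = g\<^sub>0 x" if "k \<in> P \<inter> A" "x \<in> cell k" for k x using G_A[of k x] that by blast
  qed
qed

text \<open>A cell is an affine copy of the cube whose dimension is the number of free coordinates.\<close>

lemma fill_cell:
  fixes S :: "'b::topological_space set"
  assumes fin: "finite (free_coordinates k)" and S: "fills (card (free_coordinates k)) S"
    and g: "continuous_on (cell_boundary k) g" "g ` cell_boundary k \<subseteq> S"
  shows "\<exists>h. continuous_on (cell k) h \<and> h ` cell k \<subseteq> S \<and> (\<forall>x\<in>cell_boundary k. h x = g x)"
proof -
  let ?d = "card (free_coordinates k)"
  obtain e where e: "bij_betw e {0..<?d} (free_coordinates k)" using ex_bij_betw_nat_finite[OF fin] by blast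
  define e' where "e' = the_inv_into {0..<?d} e"
  have e'e: "e' (e j) = j" if "j < ?d" for j
    unfolding e'_def by (rule the_inv_into_f_f[OF bij_betw_imp_inj_on[OF e]]) (use that in simp)
  have ee': "e (e' i) = i" "e' i < ?d" if "i \<in> free_coordinates k" for i
  proof -
    show "e (e' i) = i" unfolding e'_def by (rule f_the_inv_into_f_bij_betw[OF e]) (use that in simp)
    have "e' i \<in> {0..<?d}"
      unfolding e'_def using bij_betwE[OF bij_betw_the_inv_into[OF e]] that by blast
    then show "e' i < ?d" by simp
  qed
  have ef: "e j \<in> free_coordinates k" if "j < ?d" for j using bij_betwE[OF e] that by simp
  define lo where "lo i = real (k i div 2)" for i
  have hi: "real ((k i + 1) div 2) = lo i + (if i \<in> free_coordinates k then 1 else 0)" for i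
    by (cases "odd (k i)") (simp_all add: lo_def free_coordinates_def)
  define out where "out x i = lo i + (if i \<in> free_coordinates k then (x (e' i) + 1) / 2 else 0)" for x i
  define inn where "inn z j = (if j < ?d then 2 * (z (e j) - lo (e j)) - 1 else 0)" for z j
  have out: "out x \<in> cell k" if "x \<in> cube ?d" for x
  proof -
    have "lo i \<le> out x i \<and> out x i \<le> lo i + (if i \<in> free_coordinates k then 1 else 0)" for i
    proof (cases "i \<in> free_coordinates k")
      case True
      then have "\<bar>x (e' i)\<bar> \<le> 1" using that ee'(2) by (auto simp: cube_def)
      then show ?thesis using True by (simp add: out_def abs_le_iff)
    qed (simp add: out_def)
    then show ?thesis unfolding cell_def hi lo_def[symmetric] by blast
  qed
  have outb: "out x \<in> cell_boundary k" if "x \<in> cube_boundary ?d" for x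
  proof -
    obtain j where j: "j < ?d" "\<bar>x j\<bar> = 1"
      using \<open>x \<in> cube_boundary ?d\<close> by (auto simp: cube_boundary_def)
    then have "x j = 1 \<or> x j = -1" by (simp add: abs_if split: if_splits)
    then have "out x (e j) = lo (e j) \<or> out x (e j) = lo (e j) + 1"
      using ef[OF j(1)] e'e[OF j(1)] by (auto simp: out_def)
    then have "odd (k (e j)) \<and> (out x (e j) = real (k (e j) div 2) \<or> out x (e j) = real ((k (e j) + 1) div 2))"
      unfolding hi lo_def[symmetric] using ef[OF j(1)] by (auto simp: free_coordinates_def)
    then show ?thesis using out[of x] that cube_boundary_subset by (auto simp: cell_boundary_def)
  qed
  have cell: "lo i \<le> z i" "z i \<le> lo i + (if i \<in> free_coordinates k then 1 else 0)" if "z \<in> cell k" for z i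
    using that unfolding cell_def hi lo_def[symmetric] by blast+
  have inn: "inn z \<in> cube ?d" if "z \<in> cell k" for z
  proof -
    have "\<bar>2 * (z (e j) - lo (e j)) - 1\<bar> \<le> 1" if "j < ?d" for j
      using cell[OF \<open>z \<in> cell k\<close>, of "e j"] ef[OF that] by (simp add: abs_le_iff)
    then show ?thesis by (simp add: cube_def inn_def)
  qed
  have innb: "inn z \<in> cube_boundary ?d" if "z \<in> cell_boundary k" for z
  proof -
    obtain i where i: "odd (k i)" "z i = lo i \<or> z i = real ((k i + 1) div 2)"
      using \<open>z \<in> cell_boundary k\<close> by (auto simp: cell_boundary_def lo_def)
    then have "z i = lo i \<or> z i = lo i + 1" "i \<in> free_coordinates k" using hi[of i] by (auto simp: free_coordinates_def)
    then have "\<bar>inn z (e' i)\<bar> = 1" "e' i < ?d" using ee' by (auto simp: inn_def)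
    then show ?thesis using that inn[of z] by (auto simp: cube_boundary_def cell_boundary_def)
  qed
  have io: "out (inn z) = z" if "z \<in> cell k" for z
  proof
    fix i
    have "z i = lo i" if "i \<notin> free_coordinates k"
      using that cell[OF \<open>z \<in> cell k\<close>, of i] by simp
    then show "out (inn z) i = z i"
      using ee'[of i] by (cases "i \<in> free_coordinates k") (simp_all add: out_def inn_def diff_divide_distrib)
  qed
  have co: "continuous_on T out" for T
  proof (rule continuous_on_coordinatewise_then_product)
    show "continuous_on T (\<lambda>x. out x i)" for i
      unfolding out_def
      by (cases "i \<in> free_coordinates k") (auto intro!: continuous_intros continuous_on_coordinate)
  qed
  have ci: "continuous_on T inn" for T
  proof (rule continuous_on_coordinatewise_then_product)
    show "continuous_on T (\<lambda>z. inn z j)" for j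
      unfolding inn_def
      by (cases "j < ?d") (auto intro!: continuous_intros continuous_on_coordinate)
  qed
  have "continuous_on (cube_boundary ?d) (\<lambda>x. g (out x))"
    by (rule continuous_on_compose2[OF g(1) co]) (use outb in auto)
  moreover have "(\<lambda>x. g (out x)) ` cube_boundary ?d \<subseteq> S" using g(2) outb by auto
  ultimately obtain h where h: "continuous_on (cube ?d) h" "h ` cube ?d \<subseteq> S"
    "\<forall>x\<in>cube_boundary ?d. h x = g (out x)"
    using S unfolding fills_def by metis
  have "continuous_on (cell k) (\<lambda>z. h (inn z))"
    by (rule continuous_on_compose2[OF h(1) ci]) (use inn in auto)
  then show ?thesis
    using h inn innb io by (intro exI[of _ "\<lambda>z. h (inn z)"]) (auto simp: cell_boundary_def image_subset_iff)
qed

definition rescale :: "nat \<Rightarrow> nat \<Rightarrow> (nat \<Rightarrow> real) \<Rightarrow> nat \<Rightarrow> real" where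
  "rescale m N x i = (if i < m then 2 * x i / real N - 1 else 0)"

text \<open>Compactness is where it matters that coordinates beyond \<open>m\<close> are fixed: the cube is a product of
compact intervals and points.\<close>

lemma compact_cube: "compact (cube m)"
proof -
  have "cube m = Pi\<^sub>E UNIV (\<lambda>i. if i < m then {-1..1} else {0::real})"
  proof -
    have "x \<in> cube m \<longleftrightarrow> (\<forall>i. x i \<in> (if i < m then {-1..1} else {0}))" for x
    proof -
      have "x \<in> cube m \<longleftrightarrow> (\<forall>i. if i < m then -1 \<le> x i \<and> x i \<le> 1 else x i = 0)"
        unfolding cube_def mem_Collect_eq abs_le_iff by (metis linorder_not_le minus_le_iff)
      also have "\<dots> \<longleftrightarrow> (\<forall>i. x i \<in> (if i < m then {-1..1} else {0}))" by simp
      finally show ?thesis .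
    qed
    then show ?thesis by (intro set_eqI) (simp only: PiE_UNIV_domain Pi_iff ball_UNIV)
  qed
  moreover have "compactin (product_topology (\<lambda>i. euclidean) UNIV) (Pi\<^sub>E UNIV (\<lambda>i. if i < m then {-1..1} else {0::real}))"
    by (simp add: compactin_PiE)
  ultimately show ?thesis by (simp add: euclidean_product_topology)
qed

lemma dist_fun_le:
  fixes x y :: "nat \<Rightarrow> real"
  assumes "\<And>i. \<bar>x i - y i\<bar> \<le> c"
  shows "dist x y \<le> 2 * c"
proof (rule field_le_epsilon)
  fix e :: real assume "0 < e"
  then obtain n where n: "(1/2) ^ n < e" using real_arch_pow_inv[of e "1/2"] by auto
  have "Max {dist (x (from_nat i)) (y (from_nat i)) |i. i \<le> n} \<le> c"
    using assms by (intro Max.boundedI) (auto simp: dist_real_def)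
  then show "dist x y \<le> 2 * c + e" using dist_fun_le_dist_first_terms[of x y n] n by linarith
qed

lemma rescale_in_cube:
  assumes "0 < N" and k: "k \<in> grid m N" and x: "x \<in> cell k"
  shows "rescale m N x \<in> cube m"
proof -
  have "\<bar>2 * x i / real N - 1\<bar> \<le> 1" if "i < m" for i
  proof -
    have "k i \<le> 2 * N" using k that by (auto simp: grid_def)
    then have "real ((k i + 1) div 2) \<le> real N" by simp
    moreover have "real (k i div 2) \<le> x i" "x i \<le> real ((k i + 1) div 2)" using x by (auto simp: cell_def)
    ultimately have "0 \<le> x i" "x i \<le> real N" by (auto intro: order_trans[rotated])
    then show ?thesis using \<open>0 < N\<close> by (simp add: abs_le_iff field_simps)
  qed
  then show ?thesis by (simp add: cube_def rescale_def)
qed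

lemma carrier_cell_in_grid:
  assumes "\<And>i. i < m \<Longrightarrow> 0 \<le> y i \<and> y i \<le> real N" and "\<And>i. m \<le> i \<Longrightarrow> y i = 0"
  shows "carrier_cell y \<in> grid m N"
proof -
  have "carrier_cell y i \<le> 2 * N" if i: "i < m" for i
  proof (cases "y i = real (nat \<lfloor>y i\<rfloor>)")
    case True
    then have "nat \<lfloor>y i\<rfloor> \<le> N" using assms(1)[OF i] by linarith
    then show ?thesis using True by (simp add: carrier_cell_def)
  next
    case False
    then have "real (nat \<lfloor>y i\<rfloor>) < y i" using assms(1)[OF i] by linarith
    then have "nat \<lfloor>y i\<rfloor> < N" using assms(1)[OF i] by linarith
    then show ?thesis using False by (simp add: carrier_cell_def)
  qed
  then show ?thesis using assms(2) by (simp add: grid_def carrier_cell_def)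
qed

text \<open>By compactness an open cover of the cube has a Lebesgue number, and the cells of a fine enough grid
are smaller than it.\<close>

lemma subordinate_grid:
  assumes ope: "\<And>U. U \<in> \<U> \<Longrightarrow> openin (top_of_set (cube m)) U" and cov: "cube m \<subseteq> \<Union>\<U>"
  obtains N where "0 < N" "\<And>k. k \<in> grid m N \<Longrightarrow> \<exists>U\<in>\<U>. rescale m N ` cell k \<subseteq> U"
proof -
  let ?C = "{T. open T \<and> cube m \<inter> T \<in> \<U>}"
  have "cube m \<subseteq> \<Union>?C"
  proof
    fix x assume "x \<in> cube m"
    then have "x \<in> \<Union>\<U>" by (rule subsetD[OF cov])
    then obtain U where U: "U \<in> \<U>" "x \<in> U" by (rule UnionE)
    have "\<exists>T. open T \<and> U = cube m \<inter> T" using ope[OF U(1)] unfolding openin_open by simp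
    then obtain T where T: "open T" "U = cube m \<inter> T" by metis
    show "x \<in> \<Union>?C" by (rule UnionI[of T]) (use T U in simp_all)
  qed
  then obtain e where e: "0 < e" "\<And>x. x \<in> cube m \<Longrightarrow> \<exists>B\<in>?C. ball x e \<subseteq> B"
    using Heine_Borel_lemma[OF compact_cube, of m ?C] by (metis (no_types, lifting) mem_Collect_eq)
  obtain n where n: "4 / e < real n" using reals_Archimedean2 by blast
  define N where "N = Suc n"
  have N: "4 / real N < e" "0 < N" using n e(1) unfolding N_def by (auto simp: field_simps)
  note inc = rescale_in_cube[OF N(2)]
  show ?thesis
  proof (rule that[OF N(2)])
    fix k assume k: "k \<in> grid m N"
    define x where "x i = real (k i div 2)" for i
    have x: "x \<in> cell k" by (simp add: x_def cell_def)
    obtain B where B: "open B" "cube m \<inter> B \<in> \<U>" "ball (rescale m N x) e \<subseteq> B"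
      using e(2)[OF inc[OF k x]] by blast
    have "rescale m N y \<in> ball (rescale m N x) e" if y: "y \<in> cell k" for y
    proof -
      have "\<bar>x i - y i\<bar> \<le> 1" for i
      proof -
        have "(k i + 1) div 2 \<le> k i div 2 + 1" by presburger
        then have "real ((k i + 1) div 2) \<le> real (k i div 2) + 1" by linarith
        then show ?thesis using y unfolding x_def cell_def by (smt (verit) mem_Collect_eq)
      qed
      then have "\<bar>2 / real N * (x i - y i)\<bar> \<le> 2 / real N" for i
        using mult_left_mono[of "\<bar>x i - y i\<bar>" 1 "2 / real N"] by (simp only: abs_mult) simp
      moreover have "rescale m N x i - rescale m N y i = (if i < m then 2 / real N * (x i - y i) else 0)" for i
        by (simp add: rescale_def right_diff_distrib)
      ultimately have "\<bar>rescale m N x i - rescale m N y i\<bar> \<le> 2 / real N" for i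
        by (cases "i < m") simp_all
      then have "dist (rescale m N x) (rescale m N y) \<le> 2 * (2 / real N)" by (rule dist_fun_le)
      then show ?thesis unfolding mem_ball using N(1) by linarith
    qed
    then have "rescale m N y \<in> cube m \<inter> B" if "y \<in> cell k" for y
      using subsetD[OF B(3)] inc[OF k that] that by simp
    then have "rescale m N ` cell k \<subseteq> cube m \<inter> B" by (rule image_subsetI)
    then show "\<exists>U\<in>\<U>. rescale m N ` cell k \<subseteq> U" using B(2) by (rule rev_bexI[rotated])
  qed
qed

section \<open>Connectedness and deletion of a vertex from a simplicial complex\<close>

text \<open>The points of the geometric realization; its topology is the one of the function space.\<close>

definition realization :: "'a set set \<Rightarrow> ('a \<Rightarrow> real) set" where
  "realization K = {t. (\<forall>a. 0 \<le> t a) \<and> {a. t a \<noteq> 0} \<in> K \<and> (\<Sum>a | t a \<noteq> 0. t a) = 1}"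

lemma geometric_realization_eq: "geometric_realization K = top_of_set (realization K)"
  by (simp add: geometric_realization_def realization_def euclidean_product_topology)

lemma sum_support:
  fixes t :: "'a \<Rightarrow> real"
  assumes "finite V" "{a. t a \<noteq> 0} \<subseteq> V"
  shows "(\<Sum>a | t a \<noteq> 0. t a) = sum t V"
  using assms by (intro sum.mono_neutral_left) auto

lemma mem_realization_iff:
  assumes "finite V" "K \<subseteq> Pow V"
  shows "t \<in> realization K \<longleftrightarrow> (\<forall>a. 0 \<le> t a) \<and> {a. t a \<noteq> 0} \<in> K \<and> sum t V = 1"
  using assms sum_support[of V t] unfolding realization_def by auto

lemma realization_mono: "K \<subseteq> K' \<Longrightarrow> realization K \<subseteq> realization K'"
  unfolding realization_def by auto

lemma realization_le_1:
  assumes "finite V" "K \<subseteq> Pow V" "t \<in> realization K"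
  shows "\<bar>t a\<bar> \<le> 1"
proof (cases "a \<in> V")
  case True
  then have "t a \<le> sum t V" using assms by (intro member_le_sum) (auto simp: realization_def)
  then show ?thesis using assms by (simp add: mem_realization_iff)
next
  case False
  then have "t a = 0" using assms by (auto simp: mem_realization_iff)
  then show ?thesis by simp
qed

text \<open>If \<open>v\<close> can be added to every simplex, the realization is star-shaped with centre the vertex \<open>v\<close>, and
a map on the boundary of a cube is filled by running along the segments towards \<open>v\<close>.\<close>

lemma fills_cone:
  assumes V: "finite V" "S \<subseteq> Pow V" and down: "\<And>\<sigma> \<tau>. \<sigma> \<in> S \<Longrightarrow> \<tau> \<subseteq> \<sigma> \<Longrightarrow> \<tau> \<in> S"
    and apex: "{v} \<in> S" "\<And>\<sigma>. \<sigma> \<in> S \<Longrightarrow> insert v \<sigma> \<in> S"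
  shows "fills m (realization S)"
  unfolding fills_def
proof (intro allI impI, elim conjE)
  fix g :: "(nat \<Rightarrow> real) \<Rightarrow> 'a \<Rightarrow> real"
  assume g: "continuous_on (cube_boundary m) g" "g ` cube_boundary m \<subseteq> realization S"
  let ?s = "max_norm m"
  define p where "p x = (\<lambda>i. x i / ?s x)" for x :: "nat \<Rightarrow> real"
  define h where "h x a = ?s x * g (p x) a + (if a = v then 1 - ?s x else 0)" for x a
  have vV: "v \<in> V" using apex V by auto
  have "continuous_on (cube m) (\<lambda>x a. ?s x * g (p x) a)"
    unfolding p_def using g realization_le_1[OF V] by (intro continuous_on_radial_cone) auto
  then have "continuous_on (cube m) (\<lambda>x. ?s x * g (p x) a)" for a
    by (rule continuous_on_product_then_coordinatewise)
  then have "continuous_on (cube m) (\<lambda>x. h x a)" for a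
    unfolding h_def
    by (rule continuous_on_add) (cases "a = v"; auto intro!: continuous_intros continuous_on_max_norm)
  then have "continuous_on (cube m) h" by (rule continuous_on_coordinatewise_then_product)
  moreover have "h x = g x" if "x \<in> cube_boundary m" for x
    using that by (auto simp: h_def p_def cube_boundary_iff)
  moreover have "h x \<in> realization S" if x: "x \<in> cube m" for x
  proof (cases "?s x = 0")
    case True
    then have "h x = (\<lambda>a. if a = v then 1 else 0)" by (auto simp: h_def)
    then show ?thesis using apex(1) V vV by (auto simp: mem_realization_iff[OF V])
  next
    case False
    then have "g (p x) \<in> realization S"
      using g(2) radial_projection_in_cube_boundary[OF x False] unfolding p_def by blast
    then have gp: "\<forall>a. 0 \<le> g (p x) a" "{a. g (p x) a \<noteq> 0} \<in> S" "sum (g (p x)) V = 1"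
      by (auto simp: mem_realization_iff[OF V])
    have s: "0 \<le> ?s x" "?s x \<le> 1" using x by (auto simp: cube_iff max_norm_nonneg)
    have "{a. h x a \<noteq> 0} \<subseteq> insert v {a. g (p x) a \<noteq> 0}" by (auto simp: h_def)
    then have "{a. h x a \<noteq> 0} \<in> S" using down apex(2)[OF gp(2)] by blast
    moreover have "sum (h x) V = 1"
      using vV V(1) gp(3) by (simp add: h_def sum.distrib flip: sum_distrib_left)
    moreover have "\<forall>a. 0 \<le> h x a" using gp(1) s by (simp add: h_def)
    ultimately show ?thesis by (simp add: mem_realization_iff[OF V])
  qed
  ultimately show "\<exists>h. continuous_on (cube m) h \<and> h ` cube m \<subseteq> realization S \<and> (\<forall>x\<in>cube_boundary m. h x = g x)"
    by (intro exI[of _ h]) auto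
qed

text \<open>Weight vectors with sum at most \<open>1\<close> represent points of a cone over the complex, the missing weight
\<open>1 - sum t V\<close> being the weight of the apex. To return from the cone to the complex, the missing weight
is subtracted from the weight of \<open>v\<close> (as far as possible), the apex is forgotten, and the rest is
normalised.\<close>

definition shifted_weight :: "'a set \<Rightarrow> 'a \<Rightarrow> ('a \<Rightarrow> real) \<Rightarrow> 'a \<Rightarrow> real" where
  "shifted_weight V v t a = (if a = v then max (t v - (1 - sum t V)) 0 else t a)"

definition push_off :: "'a set \<Rightarrow> 'a \<Rightarrow> ('a \<Rightarrow> real) \<Rightarrow> 'a \<Rightarrow> real" where
  "push_off V v t a = shifted_weight V v t a / sum (shifted_weight V v t) V"

text \<open>The empty simplex is admitted here: the origin is the apex of the cone.\<close>

definition cone_over :: "'a set \<Rightarrow> 'a set set \<Rightarrow> ('a \<Rightarrow> real) set" where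
  "cone_over V K = {t. (\<forall>a. 0 \<le> t a) \<and> {a. t a \<noteq> 0} \<in> K \<and> sum t V \<le> 1}"

text \<open>Let \<open>K\<close> be the union of \<open>L\<close> (the simplices without \<open>v\<close>) and the star of \<open>v\<close>, a cone over the link
\<open>J\<close>. Given a map from the boundary of an \<open>m\<close>-cube to \<open>K\<close>, extend it radially to a map \<open>F\<close> into the
cone over \<open>K\<close>, and compose with \<open>push_off\<close>. This is the identity on \<open>K\<close> but undefined at the points of
the cone that carry only weights on \<open>v\<close> and on the apex, with at least as much on the apex. Near these
points the map has to be chosen anew, and three regions matter:

  \<^item> \<open>push_off\<close> is defined: the value \<open>push_off (F x)\<close> is used;

  \<^item> the apex has more weight than \<open>v\<close>: where \<open>push_off\<close> is defined it loses \<open>v\<close> and lies in \<open>L\<close>, so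
    gaps are filled in \<open>L\<close>;

  \<^item> \<open>v\<close> has positive weight: where \<open>push_off\<close> is defined it lies in the star of \<open>v\<close>, so gaps are filled
    in this cone.

The three regions form an open cover. In the intersection of the last two the values lie in the link
\<open>J\<close>, and there one can fill only in dimension less than \<open>m\<close>. This is no obstacle: a cell of dimension
\<open>m\<close> in the intersection is not a face of another cell and may be filled in \<open>L\<close>.\<close>

lemma fills_vertex_deletion:
  fixes K :: "'a set set"
  assumes V: "finite V" "K \<subseteq> Pow V" and down: "\<And>\<sigma> \<tau>. \<sigma> \<in> K \<Longrightarrow> \<tau> \<subseteq> \<sigma> \<Longrightarrow> \<tau> \<in> K" and v: "v \<in> V"
    and L: "\<And>d. d \<le> m \<Longrightarrow> fills d (realization {\<sigma> \<in> K. v \<notin> \<sigma>})"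
    and J: "\<And>d. d < m \<Longrightarrow> fills d (realization {\<sigma> \<in> K. v \<notin> \<sigma> \<and> insert v \<sigma> \<in> K})"
  shows "fills m (realization K)"
proof (cases "m = 0")
  case True
  then have "realization {\<sigma> \<in> K. v \<notin> \<sigma>} \<noteq> {}" using L[of 0] by (simp add: fills_0_iff)
  then show ?thesis using True realization_mono[of "{\<sigma> \<in> K. v \<notin> \<sigma>}" K] by (auto simp: fills_0_iff)
next
  case False
  let ?L = "{\<sigma> \<in> K. v \<notin> \<sigma>}" and ?J = "{\<sigma> \<in> K. v \<notin> \<sigma> \<and> insert v \<sigma> \<in> K}" and ?S = "{\<sigma> \<in> K. insert v \<sigma> \<in> K}"
  let ?w = "shifted_weight V v" and ?r = "push_off V v"
  have wts: "?L \<subseteq> Pow V" "?J \<subseteq> Pow V" "?S \<subseteq> Pow V" using V by auto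
  have w_nonneg: "0 \<le> ?w t a" if "t \<in> cone_over V K" for t a
    using that by (auto simp: shifted_weight_def cone_over_def)
  have supp: "{a. ?r t a \<noteq> 0} \<subseteq> {a. t a \<noteq> 0}" if "t \<in> cone_over V K" for t
  proof -
    have "?w t a = 0" if "t a = 0" for a
      using that \<open>t \<in> cone_over V K\<close> by (auto simp: shifted_weight_def cone_over_def)
    then show ?thesis by (auto simp: push_off_def)
  qed
  have r_in: "?r t \<in> realization M"
    if "t \<in> cone_over V K" "0 < sum (?w t) V" "M \<subseteq> Pow V" "{a. ?r t a \<noteq> 0} \<in> M" for t M
  proof -
    have "sum (?r t) V = 1" using that(2) by (simp add: push_off_def flip: sum_divide_distrib)
    moreover have "\<forall>a. 0 \<le> ?r t a" using w_nonneg[OF that(1)] that(2) by (simp add: push_off_def)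
    ultimately show ?thesis using that(3,4) by (simp add: mem_realization_iff[OF V(1)])
  qed
  have supp_K: "{a. ?r t a \<noteq> 0} \<in> K" if "t \<in> cone_over V K" for t
    using down[OF _ supp[OF that]] that by (auto simp: cone_over_def)
  have r_K: "?r t \<in> realization K" if "t \<in> cone_over V K" "0 < sum (?w t) V" for t
    using r_in[OF that V(2) supp_K[OF that(1)]] .
  have supp_L: "{a. ?r t a \<noteq> 0} \<in> ?L" if "t \<in> cone_over V K" "t v < 1 - sum t V" for t
    using supp_K[OF that(1)] that(2) by (auto simp: push_off_def shifted_weight_def)
  have supp_S: "{a. ?r t a \<noteq> 0} \<in> ?S" if "t \<in> cone_over V K" "0 < t v" for t
  proof -
    have "insert v {a. ?r t a \<noteq> 0} \<subseteq> {a. t a \<noteq> 0}" using supp[OF that(1)] that(2) by auto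
    then have "insert v {a. ?r t a \<noteq> 0} \<in> K" using down that(1) by (auto simp: cone_over_def)
    then show ?thesis using supp_K[OF that(1)] by simp
  qed
  have r_id: "?r t = t" "sum (?w t) V = 1" if "t \<in> realization K" for t
  proof -
    have t: "sum t V = 1" "\<forall>a. 0 \<le> t a" using that by (auto simp: mem_realization_iff[OF V])
    then have "?w t = t" by (auto simp: shifted_weight_def)
    then show "?r t = t" "sum (?w t) V = 1" using t by (auto simp: push_off_def)
  qed
  have real_cone: "realization K \<subseteq> cone_over V K" using V by (auto simp: mem_realization_iff[OF V] cone_over_def)
  have cover: "0 < sum (?w t) V \<or> t v < 1 - sum t V \<or> 0 < t v" if t: "t \<in> cone_over V K" for t
  proof (rule ccontr)
    assume neg: "\<not> ?thesis"
    then have tv: "t v = 0" using t by (auto simp: cone_over_def not_less intro: antisym)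
    have "sum t V \<le> sum (?w t) V"
      using tv by (intro sum_mono) (auto simp: shifted_weight_def)
    then show False using neg tv by auto
  qed
  show ?thesis unfolding fills_def
  proof (intro allI impI, elim conjE)
    fix g :: "(nat \<Rightarrow> real) \<Rightarrow> 'a \<Rightarrow> real"
    assume g: "continuous_on (cube_boundary m) g" "g ` cube_boundary m \<subseteq> realization K"
    let ?s = "max_norm m"
    define F where "F x a = ?s x * g (\<lambda>i. x i / ?s x) a" for x :: "nat \<Rightarrow> real" and a
    have F_cont: "continuous_on (cube m) F"
      unfolding F_def using g realization_le_1[OF V] by (intro continuous_on_radial_cone) auto
    have F_bd: "F x = g x" if "x \<in> cube_boundary m" for x
      using that by (auto simp: F_def cube_boundary_iff)
    have F_cone: "F x \<in> cone_over V K" if x: "x \<in> cube m" for x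
    proof -
      have s: "0 \<le> ?s x" "?s x \<le> 1" using x by (auto simp: cube_iff max_norm_nonneg)
      show ?thesis
      proof (cases "?s x = 0")
        case True
        have "(\<lambda>i. if i = 0 then 1 else 0) \<in> cube_boundary m"
          using False by (auto simp: cube_boundary_def cube_def)
        then have "realization K \<noteq> {}" using g(2) by blast
        then have "{} \<in> K" using down by (auto simp: realization_def)
        then show ?thesis using True by (simp add: cone_over_def F_def)
      next
        case False
        then have "g (\<lambda>i. x i / ?s x) \<in> realization K"
          using g(2) radial_projection_in_cube_boundary[OF x False] by blast
        then have *: "\<forall>a. 0 \<le> g (\<lambda>i. x i / ?s x) a" "{a. g (\<lambda>i. x i / ?s x) a \<noteq> 0} \<in> K"
          "sum (g (\<lambda>i. x i / ?s x)) V = 1"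
          by (auto simp: mem_realization_iff[OF V])
        have "sum (F x) V = ?s x" using *(3) by (simp add: F_def flip: sum_distrib_left)
        moreover have "{a. F x a \<noteq> 0} = {a. g (\<lambda>i. x i / ?s x) a \<noteq> 0}" using False by (simp add: F_def)
        ultimately show ?thesis using s * by (simp add: cone_over_def F_def)
      qed
    qed
    \<comment> \<open>The three open regions: \<open>push_off\<close> is defined; the apex outweighs \<open>v\<close>; \<open>v\<close> has weight.\<close>
    define n1 where "n1 x = sum (?w (F x)) V" for x
    define n2 where "n2 x = 1 - sum (F x) V - F x v" for x
    define n3 where "n3 x = F x v" for x
    have F_coord: "continuous_on (cube m) (\<lambda>x. F x a)" for a
      using F_cont by (rule continuous_on_product_then_coordinatewise)
    have w_coord: "continuous_on (cube m) (\<lambda>x. ?w (F x) a)" for a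
      unfolding shifted_weight_def by (cases "a = v") (auto intro!: continuous_intros F_coord)
    have cn: "continuous_on (cube m) n1" "continuous_on (cube m) n2" "continuous_on (cube m) n3"
      unfolding n1_def n2_def n3_def by (intro continuous_intros F_coord w_coord)+
    define U where "U n = cube m \<inter> n -` {0<..}" for n :: "(nat \<Rightarrow> real) \<Rightarrow> real"
    have U_open: "openin (top_of_set (cube m)) (U n)" if "continuous_on (cube m) n" for n
      unfolding U_def using that by (intro continuous_openin_preimage_gen) auto
    have cov: "cube m \<subseteq> \<Union>{U n1, U n2, U n3}"
    proof
      fix x assume x: "x \<in> cube m"
      then have "0 < n1 x \<or> 0 < n2 x \<or> 0 < n3 x"
        using cover[OF F_cone[OF x]] by (auto simp: n1_def n2_def n3_def)
      then show "x \<in> \<Union>{U n1, U n2, U n3}" using x by (auto simp: U_def)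
    qed
    obtain N where N: "0 < N" "\<And>k. k \<in> grid m N \<Longrightarrow> \<exists>W\<in>{U n1, U n2, U n3}. rescale m N ` cell k \<subseteq> W"
      by (rule subordinate_grid[OF _ cov]) (use U_open cn in auto)
    let ?\<rho> = "rescale m N" and ?P = "grid m N"
    define C where "C n = {k. ?\<rho> ` cell k \<subseteq> U n}" for n
    define G0 where "G0 y = ?r (F (?\<rho> y))" for y
    define \<Phi> where "\<Phi> k =
      (if k \<in> C n1 then G0 ` cell k
       else if k \<in> C n2 \<and> k \<in> C n3 \<and> card (free_coordinates k) < m then realization ?J
       else if k \<in> C n2 then realization ?L
       else realization ?S)" for k
    have C_face: "k' \<in> C n" if "k \<in> C n" "face k' k" for k k' n
      using that face_subset[OF that(2)] by (auto simp: C_def)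
    have UD: "?\<rho> y \<in> cube m" "0 < n (?\<rho> y)" if "k \<in> C n" "y \<in> cell k" for k y n
      using that by (auto simp: C_def U_def)
    have \<rho>_cont: "continuous_on T ?\<rho>" for T
    proof (rule continuous_on_coordinatewise_then_product)
      show "continuous_on T (\<lambda>x. ?\<rho> x i)" for i
        unfolding rescale_def by (cases "i < m") (use N(1) in \<open>auto intro!: continuous_intros continuous_on_coordinate\<close>)
    qed
    have G0_cont: "continuous_on (cell k) G0" if "k \<in> C n1" for k
    proof (rule continuous_on_coordinatewise_then_product)
      fix a
      have "continuous_on {x \<in> cube m. 0 < n1 x} (\<lambda>x. ?r (F x) a)"
        unfolding push_off_def n1_def[symmetric]
        by (auto intro!: continuous_on_divide continuous_on_subset[OF w_coord] continuous_on_subset[OF cn(1)])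
      then show "continuous_on (cell k) (\<lambda>y. G0 y a)"
        unfolding G0_def by (rule continuous_on_compose2[OF _ \<rho>_cont]) (use UD[OF that] in auto)
    qed
    have G0_K: "G0 y \<in> realization K" if "k \<in> C n1" "y \<in> cell k" for k y
      unfolding G0_def using UD[OF that] by (intro r_K F_cone) (auto simp: n1_def)
    have G0_L: "G0 y \<in> realization ?L" if "k \<in> C n1" "k \<in> C n2" "y \<in> cell k" for k y
      unfolding G0_def using UD[OF that(1,3)] UD[OF that(2,3)]
      by (intro r_in supp_L F_cone wts) (auto simp: n1_def n2_def)
    have G0_S: "G0 y \<in> realization ?S" if "k \<in> C n1" "k \<in> C n3" "y \<in> cell k" for k y
      unfolding G0_def using UD[OF that(1,3)] UD[OF that(2,3)]
      by (intro r_in supp_S F_cone wts) (auto simp: n1_def n3_def)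
    have real_J: "realization ?J = realization ?L \<inter> realization ?S"
      unfolding realization_def by auto
    have C_cover: "k \<in> C n1 \<or> k \<in> C n2 \<or> k \<in> C n3" if "k \<in> ?P" for k
      using N(2)[OF that] by (auto simp: C_def)
    have dim: "finite (free_coordinates k)" "card (free_coordinates k) \<le> m" if "k \<in> ?P" for k
      using finite_free[OF that] card_mono[of "{..<m}" "free_coordinates k"] finite_subset[of "free_coordinates k" "{..<m}"] by auto
    \<comment> \<open>Proper faces have dimension less than \<open>m\<close>, so on the overlap of the last two regions
      they take values in the link, which is contained in both \<open>L\<close> and the star.\<close>
    have mono: "\<Phi> k' \<subseteq> \<Phi> k" if k: "k \<in> ?P" and f: "face k' k" for k k'
    proof (cases "k' = k \<or> k \<in> C n1")
      case True
      then show ?thesis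
        using C_face[OF _ f, of n1] face_subset[OF f] by (auto simp: \<Phi>_def)
    next
      case nk: False
      then have "card (free_coordinates k') < card (free_coordinates k)"
        using proper_face_free[OF f] dim(1)[OF k] by (auto intro: psubset_card_mono)
      then have d: "card (free_coordinates k') < m" using dim(2)[OF k] by simp
      have G0J: "G0 ` cell k' \<subseteq> realization ?J" if "k' \<in> C n1" "k' \<in> C n2" "k' \<in> C n3"
        using G0_L G0_S that real_J by blast
      have G0L: "G0 ` cell k' \<subseteq> realization ?L" if "k' \<in> C n1" "k' \<in> C n2"
        using G0_L that by blast
      have G0S: "G0 ` cell k' \<subseteq> realization ?S" if "k' \<in> C n1" "k' \<in> C n3"
        using G0_S that by blast
      have JL: "realization ?J \<subseteq> realization ?L" "realization ?J \<subseteq> realization ?S" using real_J by auto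
      consider "k \<in> C n2" "k \<in> C n3" "card (free_coordinates k) < m" | "k \<in> C n2" "\<not> (k \<in> C n3 \<and> card (free_coordinates k) < m)"
        | "k \<notin> C n2" "k \<in> C n3" using C_cover[OF k] nk by blast
      then show ?thesis
      proof cases
        case 1
        then have "\<Phi> k = realization ?J" using nk by (simp add: \<Phi>_def)
        moreover have "\<Phi> k' \<subseteq> realization ?J"
          using G0J C_face[OF 1(1) f] C_face[OF 1(2) f] d by (simp add: \<Phi>_def)
        ultimately show ?thesis by simp
      next
        case 2
        then have "\<Phi> k = realization ?L" using nk by (auto simp: \<Phi>_def)
        moreover have "\<Phi> k' \<subseteq> realization ?L"
          using G0L C_face[OF 2(1) f] JL(1) by (simp add: \<Phi>_def)
        ultimately show ?thesis by simp
      next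
        case 3
        then have "\<Phi> k = realization ?S" using nk by (simp add: \<Phi>_def)
        moreover have "\<Phi> k' \<subseteq> realization ?S"
          using G0S C_face[OF 3(2) f] d JL(2) by (simp add: \<Phi>_def)
        ultimately show ?thesis by simp
      qed
    qed
    have fill: "\<exists>h. continuous_on (cell k) h \<and> h ` cell k \<subseteq> \<Phi> k \<and> (\<forall>x\<in>cell_boundary k. h x = f x)"
      if k: "k \<in> ?P" "k \<notin> C n1" and f: "continuous_on (cell_boundary k) f" "f ` cell_boundary k \<subseteq> \<Phi> k" for k f
    proof (rule fill_cell[OF dim(1)[OF k(1)] _ f])
      have "fills d (realization ?S)" if "k \<in> C n3" for d
      proof (rule fills_cone[OF V(1) wts(3)])
        obtain y where y: "y \<in> cell k" by (auto simp: cell_def intro: that[of "\<lambda>i. real (k i div 2)"])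
        have "F (?\<rho> y) \<in> cone_over V K" "0 < F (?\<rho> y) v"
          using UD[OF \<open>k \<in> C n3\<close> y] F_cone by (auto simp: n3_def)
        then have "{v} \<in> K" using down[of "{a. F (?\<rho> y) a \<noteq> 0}" "{v}"] by (auto simp: cone_over_def)
        then show "{v} \<in> ?S" by simp
        show "\<tau> \<in> ?S" if "\<sigma> \<in> ?S" "\<tau> \<subseteq> \<sigma>" for \<sigma> \<tau>
          using down[of \<sigma> \<tau>] down[of "insert v \<sigma>" "insert v \<tau>"] that by auto
      qed auto
      then show "fills (card (free_coordinates k)) (\<Phi> k)"
        using C_cover[OF k(1)] k(2) J L dim(2)[OF k(1)] by (auto simp: \<Phi>_def)
    qed
    have "\<exists>G. continuous_on (\<Union>k\<in>?P. cell k) G \<and> (\<forall>k\<in>?P. G ` cell k \<subseteq> \<Phi> k) \<and>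
           (\<forall>k\<in>?P \<inter> C n1. \<forall>x\<in>cell k. G x = G0 x)"
    proof (rule extend_over_carriers)
      show "continuous_on (cell k) G0 \<and> G0 ` cell k \<subseteq> \<Phi> k" if "k \<in> ?P" "k \<in> C n1" for k
        using G0_cont[OF that(2)] that(2) by (simp add: \<Phi>_def)
      show "k' \<in> ?P" if "k \<in> ?P" "face k' k" for k k' using grid_face[OF that] .
      show "\<Phi> k' \<subseteq> \<Phi> k" if "k \<in> ?P" "face k' k" for k k' using mono[OF that] .
      show "k' \<in> C n1" if "k \<in> C n1" "face k' k" for k k' using C_face[OF that] .
      show "\<exists>h. continuous_on (cell k) h \<and> h ` cell k \<subseteq> \<Phi> k \<and> (\<forall>x\<in>cell_boundary k. h x = f x)"
        if "k \<in> ?P" "k \<notin> C n1" "continuous_on (cell_boundary k) f" "f ` cell_boundary k \<subseteq> \<Phi> k" for k f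
        using fill[OF that] .
      show "finite (free_coordinates k)" if "k \<in> ?P" for k using dim(1)[OF that] .
    qed (rule finite_grid)
    then obtain G where G: "continuous_on (\<Union>k\<in>?P. cell k) G" "\<And>k. k \<in> ?P \<Longrightarrow> G ` cell k \<subseteq> \<Phi> k"
      "\<And>k x. k \<in> ?P \<Longrightarrow> k \<in> C n1 \<Longrightarrow> x \<in> cell k \<Longrightarrow> G x = G0 x" by blast
    have \<Phi>_K: "\<Phi> k \<subseteq> realization K" for k
      using G0_K realization_mono[of ?J K] realization_mono[of ?L K] realization_mono[of ?S K]
      by (auto simp: \<Phi>_def)
    define up where "up x i = (if i < m then real N * (x i + 1) / 2 else 0)" for x :: "nat \<Rightarrow> real" and i
    have up_cont: "continuous_on T up" for T
    proof (rule continuous_on_coordinatewise_then_product)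
      show "continuous_on T (\<lambda>x. up x i)" for i
        unfolding up_def by (cases "i < m") (auto intro!: continuous_intros continuous_on_coordinate)
    qed
    have up: "carrier_cell (up x) \<in> ?P" "up x \<in> cell (carrier_cell (up x))" "?\<rho> (up x) = x"
      if x: "x \<in> cube m" for x
    proof -
      have b: "0 \<le> up x i \<and> up x i \<le> real N" if "i < m" for i
      proof -
        have "-1 \<le> x i" "x i \<le> 1" using x that by (auto simp: cube_def abs_le_iff)
        then have "0 \<le> x i + 1" "x i + 1 \<le> 2" by auto
        then have "0 \<le> real N * (x i + 1)" "real N * (x i + 1) \<le> real N * 2" by (auto intro: mult_left_mono)
        then show ?thesis using that by (simp add: up_def)
      qed
      have z: "up x i = 0" if "m \<le> i" for i using that by (simp add: up_def)
      show "carrier_cell (up x) \<in> ?P" using b z by (rule carrier_cell_in_grid)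
      have "0 \<le> up x i" for i using b[of i] z[of i] by (cases "i < m") auto
      then show "up x \<in> cell (carrier_cell (up x))" by (rule mem_carrier_cell)
      show "?\<rho> (up x) = x" using x N(1) by (auto simp: rescale_def up_def cube_def)
    qed
    have bd: "G (up x) = g x" if x: "x \<in> cube_boundary m" for x
    proof -
      let ?k = "carrier_cell (up x)"
      have xc: "x \<in> cube m" using x cube_boundary_subset by auto
      obtain i where i: "i < m" "\<bar>x i\<bar> = 1" using x by (auto simp: cube_boundary_def)
      then have "x i = 1 \<or> x i = -1" by (auto simp: abs_if split: if_splits)
      then have ui: "up x i = real N \<or> up x i = 0" using i(1) by (auto simp: up_def)
      \<comment> \<open>The smallest grid cell around a boundary point lies in the boundary,
        where \<open>F\<close> takes values in \<open>K\<close>, so the prescribed map is used there.\<close>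
      have "?\<rho> y \<in> cube_boundary m" if y: "y \<in> cell ?k" for y
      proof -
        have "even (?k i)" "real (?k i div 2) = up x i" using ui by (auto simp: carrier_cell_def)
        then have "y i = up x i" using y by (auto simp: cell_def intro!: antisym dest!: spec[of _ i])
        then have "\<bar>?\<rho> y i\<bar> = 1" using ui i(1) N(1) by (auto simp: rescale_def)
        then show ?thesis
          using rescale_in_cube[OF N(1) up(1)[OF xc] y] i(1) by (auto simp: cube_boundary_def)
      qed
      then have "?\<rho> y \<in> U n1" if "y \<in> cell ?k" for y
        using that g(2) r_id(2) F_bd cube_boundary_subset unfolding U_def n1_def
        by (force simp: image_subset_iff)
      then have "?k \<in> C n1" by (auto simp: C_def)
      then have "G (up x) = ?r (F x)" using G(3) up[OF xc] by (simp add: G0_def)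
      then show ?thesis using F_bd[OF x] r_id(1)[of "g x"] g(2) x by auto
    qed
    have "continuous_on (cube m) (\<lambda>x. G (up x))"
      by (rule continuous_on_compose2[OF G(1) up_cont]) (use up in blast)
    moreover have "G (up x) \<in> realization K" if "x \<in> cube m" for x
      using G(2)[OF up(1)[OF that]] up(2)[OF that] \<Phi>_K by blast
    ultimately show "\<exists>h. continuous_on (cube m) h \<and> h ` cube m \<subseteq> realization K \<and> (\<forall>x\<in>cube_boundary m. h x = g x)"
      using bd by (intro exI[of _ "\<lambda>x. G (up x)"]) auto
  qed
qed

section \<open>Systems of distinct representatives\<close>

text \<open>The proof of Halmos and Vaughan: if some proper nonempty subfamily has exactly as many elements as
members, treat it and the rest separately; otherwise any element of any member may be used up.\<close>

lemma hall:
  fixes S :: "'i \<Rightarrow> 'a set"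
  assumes "finite I" and "\<And>i. i \<in> I \<Longrightarrow> finite (S i)"
    and "\<And>J. J \<subseteq> I \<Longrightarrow> card J \<le> card (\<Union>(S ` J))"
  shows "\<exists>f. inj_on f I \<and> (\<forall>i\<in>I. f i \<in> S i)"
  using assms
proof (induction "card I" arbitrary: I S rule: less_induct)
  case less
  note fin = less.prems(1,2) and H = less.prems(3)
  show ?case
  proof (cases "I = {}")
    case False
    show ?thesis
    proof (cases "\<exists>J. J \<subset> I \<and> J \<noteq> {} \<and> card (\<Union>(S ` J)) = card J")
      case True
      then obtain J where J: "J \<subset> I" "J \<noteq> {}" "card (\<Union>(S ` J)) = card J" by blast
      have fJ: "finite J" using J(1) fin(1) by (auto intro: finite_subset)
      have "\<exists>f. inj_on f J \<and> (\<forall>i\<in>J. f i \<in> S i)"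
        by (rule less.hyps) (use psubset_card_mono[OF fin(1) J(1)] fJ J(1) fin(2) H in auto)
      then obtain f where f: "inj_on f J" "\<forall>i\<in>J. f i \<in> S i" by blast
      let ?S = "\<lambda>i. S i - \<Union>(S ` J)"
      have "card (I - J) < card I" using J fin(1) by (intro psubset_card_mono) auto
      moreover have "card K \<le> card (\<Union>(?S ` K))" if K: "K \<subseteq> I - J" for K
      proof -
        have fK: "finite K" using K fin(1) by (auto intro: finite_subset)
        have "card J + card K = card (J \<union> K)"
          using K fJ fK by (subst card_Un_disjoint) auto
        also have "\<dots> \<le> card (\<Union>(S ` (J \<union> K)))" using H[of "J \<union> K"] K J(1) by auto
        also have "\<Union>(S ` (J \<union> K)) = \<Union>(S ` J) \<union> \<Union>(?S ` K)" by auto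
        also have "card \<dots> \<le> card (\<Union>(S ` J)) + card (\<Union>(?S ` K))" by (rule card_Un_le)
        finally show ?thesis using J(3) by simp
      qed
      ultimately have "\<exists>g. inj_on g (I - J) \<and> (\<forall>i\<in>I - J. g i \<in> ?S i)"
        by (intro less.hyps) (use fin in auto)
      then obtain g where g: "inj_on g (I - J)" "\<forall>i\<in>I - J. g i \<in> ?S i" by blast
      let ?h = "\<lambda>i. if i \<in> J then f i else g i"
      have "inj_on ?h I"
      proof (rule inj_onI)
        fix i j assume ij: "i \<in> I" "j \<in> I" "?h i = ?h j"
        have ne: "f i \<noteq> g j" if "i \<in> J" "j \<in> I - J" for i j
        proof -
          have "f i \<in> \<Union>(S ` J)" using bspec[OF f(2) that(1)] that(1) by (rule UN_I[rotated])
          moreover have "g j \<notin> \<Union>(S ` J)" using bspec[OF g(2) that(2)] by simp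
          ultimately show ?thesis by metis
        qed
        consider "i \<in> J" "j \<in> J" | "i \<in> J" "j \<notin> J" | "i \<notin> J" "j \<in> J" | "i \<notin> J" "j \<notin> J" by blast
        then show "i = j"
        proof cases
          case 1
          then show ?thesis using ij(3) inj_onD[OF f(1)] by simp
        next
          case 2
          then show ?thesis using ij ne[of i j] by simp
        next
          case 3
          then show ?thesis using ij ne[of j i] by simp
        next
          case 4
          then show ?thesis using ij inj_onD[OF g(1)] by simp
        qed
      qed
      moreover have "\<forall>i\<in>I. ?h i \<in> S i" using f(2) g(2) by auto
      ultimately show ?thesis by blast
    next
      case nocrit: False
      obtain i where i: "i \<in> I" using False by blast
      have "card {i} \<le> card (\<Union>(S ` {i}))" using H[of "{i}"] i by blast
      then have "card (S i) \<noteq> 0" by simp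
      then obtain y where y: "y \<in> S i" by (metis card.empty equals0I)
      let ?S = "\<lambda>j. S j - {y}"
      have "card K \<le> card (\<Union>(?S ` K))" if K: "K \<subseteq> I - {i}" for K
      proof (cases "K = {}")
        case False
        have "K \<subset> I" "K \<subseteq> I" using K i by auto
        then have "card K < card (\<Union>(S ` K))" using H[of K] nocrit False by (metis le_neq_implies_less)
        moreover have "\<Union>(?S ` K) = \<Union>(S ` K) - {y}" by auto
        moreover have "card (\<Union>(S ` K)) - 1 \<le> card (\<Union>(S ` K) - {y})" by (simp add: card_Diff_singleton_if)
        ultimately show ?thesis by simp
      qed simp
      moreover have "card (I - {i}) < card I" using i fin(1) by (intro psubset_card_mono) auto
      ultimately have "\<exists>g. inj_on g (I - {i}) \<and> (\<forall>j\<in>I - {i}. g j \<in> ?S j)"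
        by (intro less.hyps) (use fin in auto)
      then obtain g where g: "inj_on g (I - {i})" "\<forall>j\<in>I - {i}. g j \<in> ?S j" by blast
      let ?h = "\<lambda>j. if j = i then y else g j"
      have "inj_on ?h I" using g by (auto simp: inj_on_def)
      moreover have "\<forall>j\<in>I. ?h j \<in> S j" using g(2) y by auto
      ultimately show ?thesis by blast
    qed
  qed auto
qed

text \<open>Adding \<open>d\<close> new elements to every member of the family reduces this to Hall's theorem; at most \<open>d\<close>
members are represented by new elements.\<close>

lemma hall_deficiency:
  fixes S :: "'i \<Rightarrow> 'a set"
  assumes I: "finite I" and S: "\<And>i. i \<in> I \<Longrightarrow> finite (S i)"
    and H: "\<And>J. J \<subseteq> I \<Longrightarrow> card J \<le> card (\<Union>(S ` J)) + d"
  shows "\<exists>I' f. I' \<subseteq> I \<and> card I \<le> card I' + d \<and> inj_on f I' \<and> (\<forall>i\<in>I'. f i \<in> S i)"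
proof -
  let ?S = "\<lambda>i. Inl ` S i \<union> Inr ` {..<d} :: ('a + nat) set"
  have "card J \<le> card (\<Union>(?S ` J))" if J: "J \<subseteq> I" for J
  proof (cases "J = {}")
    case False
    then have eq: "\<Union>(?S ` J) = Inl ` \<Union>(S ` J) \<union> Inr ` {..<d}" by auto
    have "finite (\<Union>(S ` J))" using J I S by (auto intro: finite_subset)
    then have "card (\<Union>(?S ` J)) = card (\<Union>(S ` J)) + d"
      unfolding eq by (subst card_Un_disjoint) (auto simp: card_image)
    then show ?thesis using H[OF J] by simp
  qed simp
  then have "\<exists>f. inj_on f I \<and> (\<forall>i\<in>I. f i \<in> ?S i)"
    by (intro hall) (use I S in auto)
  then obtain f where f: "inj_on f I" "\<forall>i\<in>I. f i \<in> ?S i" by blast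
  define I' where "I' = {i \<in> I. f i \<in> range Inl}"
  have "card (I - I') \<le> card (Inr ` {..<d} :: ('a + nat) set)"
    using f by (intro card_inj_on_le[of f]) (auto simp: I'_def intro: inj_on_subset)
  also have "\<dots> = d" by (simp add: card_image)
  finally have "card I \<le> card I' + d"
    using I by (simp add: card_Diff_subset I'_def)
  moreover have "inj_on (projl \<circ> f) I'"
  proof (rule inj_onI)
    fix i j assume ij: "i \<in> I'" "j \<in> I'" "(projl \<circ> f) i = (projl \<circ> f) j"
    then have "f i = f j" by (auto simp: I'_def)
    then show "i = j" using ij(1,2) inj_onD[OF f(1)] by (simp add: I'_def)
  qed
  moreover have "\<forall>i\<in>I'. (projl \<circ> f) i \<in> S i" using f(2) by (fastforce simp: I'_def)
  ultimately show ?thesis by (intro exI[of _ I'] exI[of _ "projl \<circ> f"]) (auto simp: I'_def)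
qed

section \<open>Complexes of matchings\<close>

context
  fixes \<alpha> :: "'e \<Rightarrow> 'a" and \<beta> :: "'e \<Rightarrow> 'b"
begin

definition is_matching :: "'e set \<Rightarrow> bool" where
  "is_matching M \<longleftrightarrow> inj_on \<alpha> M \<and> inj_on \<beta> M"

definition matching_complex :: "'e set \<Rightarrow> 'e set set" where
  "matching_complex E = {M. M \<subseteq> E \<and> is_matching M}"

text \<open>A bipartite graph is given by its set of edges together with the endpoint maps \<open>\<alpha>\<close> and \<open>\<beta>\<close> into the two
classes, so that parallel edges need no special treatment. The number \<open>h\<close> stands for
\<open>(h-2)\<close>-connectedness of the complex of matchings. This shift makes \<open>h\<close> a natural number, with no
condition for \<open>h = 0\<close>.\<close>

definition matching_connected :: "nat \<Rightarrow> 'e set \<Rightarrow> bool" where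
  "matching_connected h E \<longleftrightarrow> (\<forall>m<h. fills m (realization (matching_complex E)))"

definition avoiding :: "'e \<Rightarrow> 'e set \<Rightarrow> 'e set" where
  "avoiding f E = {e \<in> E. \<alpha> e \<noteq> \<alpha> f \<and> \<beta> e \<noteq> \<beta> f}"

lemma is_matching_subset: "is_matching M \<Longrightarrow> M' \<subseteq> M \<Longrightarrow> is_matching M'"
  unfolding is_matching_def by (auto intro: inj_on_subset)

lemma is_matching_insert:
  "is_matching M \<Longrightarrow> \<alpha> e \<notin> \<alpha> ` M \<Longrightarrow> \<beta> e \<notin> \<beta> ` M \<Longrightarrow> is_matching (insert e M)"
  unfolding is_matching_def by (auto simp: inj_on_insert)

lemma is_matching_Un:
  "is_matching M \<Longrightarrow> is_matching N \<Longrightarrow> \<alpha> ` M \<inter> \<alpha> ` N = {} \<Longrightarrow> \<beta> ` M \<inter> \<beta> ` N = {} \<Longrightarrow> is_matching (M \<union> N)"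
  unfolding is_matching_def by (auto simp: inj_on_Un)

lemma matching_connected_0: "matching_connected 0 E"
  by (simp add: matching_connected_def)

text \<open>The matchings that stay matchings when \<open>f\<close> is added are those of the graph without the two endpoints
of \<open>f\<close>.\<close>

lemma matching_connected_deletion:
  assumes E: "finite E" and f: "f \<in> E"
    and del: "matching_connected (Suc h) (E - {f})" and link: "matching_connected h (avoiding f E)"
  shows "matching_connected (Suc h) E"
  unfolding matching_connected_def
proof (intro allI impI)
  fix m assume m: "m < Suc h"
  let ?K = "matching_complex E"
  have L: "{\<sigma> \<in> ?K. f \<notin> \<sigma>} = matching_complex (E - {f})"
    by (auto simp: matching_complex_def)
  have J: "{\<sigma> \<in> ?K. f \<notin> \<sigma> \<and> insert f \<sigma> \<in> ?K} = matching_complex (avoiding f E)"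
    (is "?A = ?B")
  proof (intro equalityI subsetI)
    fix \<sigma> assume "\<sigma> \<in> ?A"
    then have \<sigma>: "\<sigma> \<subseteq> E" "f \<notin> \<sigma>" "is_matching \<sigma>" "is_matching (insert f \<sigma>)" by (auto simp: matching_complex_def)
    then have "\<alpha> f \<notin> \<alpha> ` \<sigma>" "\<beta> f \<notin> \<beta> ` \<sigma>" by (auto simp: is_matching_def inj_on_insert)
    then have "\<forall>e\<in>\<sigma>. \<alpha> e \<noteq> \<alpha> f \<and> \<beta> e \<noteq> \<beta> f" by (metis imageI)
    then show "\<sigma> \<in> ?B" using \<sigma> by (auto simp: matching_complex_def avoiding_def)
  next
    fix \<sigma> assume "\<sigma> \<in> ?B"
    then have \<sigma>: "\<sigma> \<subseteq> E" "is_matching \<sigma>" "\<forall>e\<in>\<sigma>. \<alpha> e \<noteq> \<alpha> f \<and> \<beta> e \<noteq> \<beta> f"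
      by (auto simp: matching_complex_def avoiding_def)
    then have "is_matching (insert f \<sigma>)" by (intro is_matching_insert) force+
    then show "\<sigma> \<in> ?A" using \<sigma> f by (auto simp: matching_complex_def)
  qed
  show "fills m (realization ?K)"
  proof (rule fills_vertex_deletion[of E])
    show "fills d (realization {\<sigma> \<in> ?K. f \<notin> \<sigma>})" if "d \<le> m" for d
      using del m that unfolding L matching_connected_def by auto
    show "fills d (realization {\<sigma> \<in> ?K. f \<notin> \<sigma> \<and> insert f \<sigma> \<in> ?K})" if "d < m" for d
      using link m that unfolding J matching_connected_def by auto
  qed (use E f in \<open>auto simp: matching_complex_def intro: is_matching_subset\<close>)
qed

lemma matching_connected_isolated:
  assumes E: "finite E" and e: "e \<in> E" and iso: "\<And>f. f \<in> E \<Longrightarrow> f \<noteq> e \<Longrightarrow> \<alpha> f \<noteq> \<alpha> e \<and> \<beta> f \<noteq> \<beta> e"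
  shows "matching_connected h E"
  unfolding matching_connected_def
proof (intro allI impI, rule fills_cone[OF E, of _ e])
  show "insert e \<sigma> \<in> matching_complex E" if "\<sigma> \<in> matching_complex E" for \<sigma>
  proof -
    have "\<sigma> \<subseteq> E" "is_matching \<sigma>" using that by (auto simp: matching_complex_def)
    moreover from this have "\<forall>f\<in>\<sigma> - {e}. \<alpha> f \<noteq> \<alpha> e \<and> \<beta> f \<noteq> \<beta> e" using iso by blast
    ultimately have "is_matching (insert e (\<sigma> - {e}))"
      by (intro is_matching_insert) (force intro: is_matching_subset)+
    then show ?thesis using \<open>\<sigma> \<subseteq> E\<close> e by (simp add: matching_complex_def)
  qed
qed (use e in \<open>auto simp: matching_complex_def is_matching_def intro: inj_on_subset\<close>)

text \<open>Iterated deletion. While the edges of \<open>S\<close> disappear one by one, the current graph \<open>E'\<close> is only known to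
contain \<open>E - S\<close>.\<close>

lemma matching_connected_peel:
  assumes "finite E" "S \<subseteq> E" "matching_connected (Suc h) (E - S)"
    and "\<And>f E'. f \<in> S \<Longrightarrow> E - S \<subseteq> E' \<Longrightarrow> E' \<subseteq> E \<Longrightarrow> f \<in> E' \<Longrightarrow> matching_connected h (avoiding f E')"
  shows "matching_connected (Suc h) E"
proof -
  have "finite S" using assms(1,2) by (rule finite_subset[rotated])
  then show ?thesis using assms
  proof (induction S arbitrary: E)
    case (insert f S)
    have eq: "E - {f} - S = E - insert f S" by auto
    have "matching_connected (Suc h) (E - {f})"
    proof (rule insert.IH)
      show "matching_connected (Suc h) (E - {f} - S)" unfolding eq by (rule insert.prems(3))
      show "matching_connected h (avoiding g E')"
        if "g \<in> S" "E - {f} - S \<subseteq> E'" "E' \<subseteq> E - {f}" "g \<in> E'" for g E'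
        using that unfolding eq by (intro insert.prems(4)) auto
    qed (use insert in auto)
    then show ?case
      using insert.prems by (intro matching_connected_deletion[of E f]) auto
  qed simp
qed

lemma card_fibre_le_1: "inj_on g M \<Longrightarrow> card {e \<in> M. g e = x} \<le> 1"
  by (cases "finite {e \<in> M. g e = x}") (auto simp: card_le_Suc0_iff_eq inj_on_def)

lemma avoiding_subset: "avoiding f E \<subseteq> E"
  by (auto simp: avoiding_def)

text \<open>Each of the two endpoints of \<open>f\<close> lies on at most one edge of \<open>M\<close>.\<close>

lemma card_avoiding:
  assumes "is_matching M" "finite M"
  shows "card M \<le> card (avoiding f M) + 2"
proof -
  let ?A = "{e \<in> M. \<alpha> e = \<alpha> f}" and ?B = "{e \<in> M. \<beta> e = \<beta> f}"
  have "avoiding f M \<union> (?A \<union> ?B) = M" by (auto simp: avoiding_def)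
  then have "card M \<le> card (avoiding f M) + card (?A \<union> ?B)"
    using card_Un_le[of "avoiding f M" "?A \<union> ?B"] by simp
  moreover have "card ?A \<le> 1" "card ?B \<le> 1"
    using assms(1) by (simp_all only: is_matching_def card_fibre_le_1)
  ultimately show ?thesis using card_Un_le[of ?A ?B] by linarith
qed

lemma card_remove_fibre:
  assumes "inj_on g M" "finite M"
  shows "card M \<le> card {e \<in> M. g e \<noteq> x} + 1"
proof -
  have "M = {e \<in> M. g e \<noteq> x} \<union> {e \<in> M. g e = x}" by auto
  then have "card M \<le> card {e \<in> M. g e \<noteq> x} + card {e \<in> M. g e = x}"
    by (metis card_Un_le)
  then show ?thesis using card_fibre_le_1[OF assms(1), of x] by linarith
qed

text \<open>The bound \<open>conn(L(G)) \<ge> s/2 - 2\<close> for a matching of size \<open>s\<close>. One deletes the edges outside \<open>M\<close>. The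
removal of the endpoints of a deleted edge costs at most two edges of \<open>M\<close>, that is, one degree of
connectedness. At the end only \<open>M\<close> is left, and its edges are isolated.\<close>

lemma matching_connected_of_matching:
  assumes "finite E" "M \<subseteq> E" "is_matching M" "2 * h \<le> card M + 1"
  shows "matching_connected h E"
  using assms
proof (induction h arbitrary: E M)
  case 0
  then show ?case by (simp add: matching_connected_0)
next
  case (Suc h)
  have fM: "finite M" using Suc.prems(1,2) by (rule finite_subset[rotated])
  show ?case
  proof (rule matching_connected_peel[of E "E - M"])
    have eq: "E - (E - M) = M" using Suc.prems(2) by auto
    have "M \<noteq> {}" using Suc.prems(4) by auto
    then obtain e where e: "e \<in> M" by auto
    show "matching_connected (Suc h) (E - (E - M))"
      unfolding eq
    proof (rule matching_connected_isolated[OF fM e])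
      show "\<alpha> f \<noteq> \<alpha> e \<and> \<beta> f \<noteq> \<beta> e" if "f \<in> M" "f \<noteq> e" for f
        using that e Suc.prems(3) by (auto simp: is_matching_def dest: inj_onD)
    qed
    show "matching_connected h (avoiding f E')"
      if E': "E - (E - M) \<subseteq> E'" "E' \<subseteq> E" for f E'
    proof (rule Suc.IH[of _ "avoiding f M"])
      show "finite (avoiding f E')" using E'(2) Suc.prems(1) avoiding_subset by (metis finite_subset)
      show "avoiding f M \<subseteq> avoiding f E'" using E'(1) unfolding eq by (auto simp: avoiding_def)
      show "is_matching (avoiding f M)" using Suc.prems(3) avoiding_subset by (rule is_matching_subset)
      show "2 * h \<le> card (avoiding f M) + 1"
        using card_avoiding[OF Suc.prems(3) fM, of f] Suc.prems(4) by simp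
    qed
  qed (use Suc.prems in auto)
qed

lemma matching_connected_avoiding:
  assumes "finite E" "N \<subseteq> E" "is_matching N" "2 * k \<le> card N + 1"
    and "\<And>g. g \<in> N \<Longrightarrow> \<alpha> g \<noteq> \<alpha> f \<and> \<beta> g \<noteq> \<beta> f"
  shows "matching_connected k (avoiding f E)"
proof (rule matching_connected_of_matching[of _ N])
  show "finite (avoiding f E)" by (rule finite_subset[OF avoiding_subset assms(1)])
  show "N \<subseteq> avoiding f E" using assms(2,5) by (auto simp: avoiding_def)
qed (use assms in auto)

text \<open>A vertex \<open>y\<close> all of whose neighbours are dispensable gives one more than the general bound. If some
matching has more than \<open>2k\<close> edges, the general bound suffices. Otherwise every matching of size \<open>2k\<close> that
misses a neighbour of \<open>y\<close> covers \<open>y\<close>. The aim is to isolate an edge \<open>e = yx\<close> by deletions after each of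
which a matching of size \<open>2k - 1\<close> avoids both ends of the deleted edge. An edge \<open>f = yx'\<close> is called good if
\<open>x' \<noteq> x\<close> and some matching of size \<open>2k - 1\<close> avoids \<open>y\<close>, \<open>x\<close> and \<open>x'\<close>. The order is as follows.

  \<^enum> Bad edges at \<open>y\<close> go first; a matching that misses \<open>x'\<close>, without its edge at \<open>y\<close>, serves.

  \<^enum> Then the other edges at \<open>x\<close> go; the matching \<open>M\<close> that misses \<open>x\<close> is still present, since its edge at
    \<open>y\<close> is good, and it loses at most one edge.

  \<^enum> Finally the good edges at \<open>y\<close> go, by their definition.\<close>

lemma matching_connected_avoidable_neighbours:
  assumes E: "finite E" and e: "e \<in> E" "\<alpha> e = y"
    and av: "\<And>f. f \<in> E \<Longrightarrow> \<alpha> f = y \<Longrightarrow> \<exists>M\<subseteq>E. is_matching M \<and> 2 * k \<le> card M \<and> \<beta> f \<notin> \<beta> ` M"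
  shows "matching_connected (Suc k) E"
proof (cases "\<exists>M\<subseteq>E. is_matching M \<and> 2 * k < card M")
  case True
  then obtain M where "M \<subseteq> E" "is_matching M" "2 * k < card M" by blast
  then show ?thesis by (intro matching_connected_of_matching[OF E, of M]) auto
next
  case False
  have finM: "finite M" if "M \<subseteq> E" for M using that E by (rule finite_subset)
  \<comment> \<open>Otherwise the edge \<open>f\<close> would enlarge the matching.\<close>
  have covers: "y \<in> \<alpha> ` M"
    if "f \<in> E" "\<alpha> f = y" "M \<subseteq> E" "is_matching M" "2 * k \<le> card M" "\<beta> f \<notin> \<beta> ` M" for f M
  proof (rule ccontr)
    assume "y \<notin> \<alpha> ` M"
    then have "is_matching (insert f M)" using that by (intro is_matching_insert) auto
    moreover have "f \<notin> M" using that(6) by auto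
    then have "2 * k < card (insert f M)" using that(5) finM[OF that(3)] by simp
    moreover have "insert f M \<subseteq> E" using that by simp
    ultimately show False using False by blast
  qed
  let ?x = "\<beta> e"
  obtain M where M: "M \<subseteq> E" "is_matching M" "2 * k \<le> card M" "?x \<notin> \<beta> ` M" using av[OF e] by blast
  obtain f' where f': "f' \<in> M" "\<alpha> f' = y" using covers[OF e M] by auto
  define good where "good f \<longleftrightarrow> (\<exists>M'\<subseteq>E. is_matching M' \<and> 2 * k \<le> card M' + 1 \<and>
    y \<notin> \<alpha> ` M' \<and> ?x \<notin> \<beta> ` M' \<and> \<beta> f \<notin> \<beta> ` M') \<and> \<beta> f \<noteq> ?x" for f
  have y_only: "g = f'" if "g \<in> M" "\<alpha> g = y" for g
    using that f' M(2) by (auto simp: is_matching_def dest: inj_onD)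
  have f'_good: "good f'"
    unfolding good_def
  proof (intro conjI exI[of _ "M - {f'}"])
    show "is_matching (M - {f'})" using M(2) by (rule is_matching_subset) auto
    show "2 * k \<le> card (M - {f'}) + 1" using M(3) card_Suc_Diff1[OF finM[OF M(1)] f'(1)] by linarith
    show "y \<notin> \<alpha> ` (M - {f'})" using y_only by (metis DiffD1 DiffD2 imageE singletonI)
    show "\<beta> f' \<notin> \<beta> ` (M - {f'})" using M(2) f'(1) by (auto simp: is_matching_def dest: inj_onD)
    show "\<beta> f' \<noteq> ?x" using M(4) imageI[OF f'(1), of \<beta>] by metis
  qed (use M in auto)
  define S1 where "S1 = {f \<in> E. \<alpha> f = y \<and> f \<noteq> e \<and> \<not> good f}"
  define E1 where "E1 = E - S1"
  define S2 where "S2 = {f \<in> E1. \<beta> f = ?x \<and> f \<noteq> e}"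
  define E2 where "E2 = E1 - S2"
  define S3 where "S3 = {f \<in> E2. \<alpha> f = y \<and> f \<noteq> e}"
  have fin: "finite E1" "finite E2" using E by (auto simp: E1_def E2_def)
  have conn: "matching_connected k (avoiding f E')"
    if "E' \<subseteq> E" "N \<subseteq> E'" "is_matching N" "2 * k \<le> card N + 1"
      "\<And>g. g \<in> N \<Longrightarrow> \<alpha> g \<noteq> \<alpha> f \<and> \<beta> g \<noteq> \<beta> f" for f E' N
    using that by (intro matching_connected_avoiding[of E' N]) (auto intro: finM)
  have "matching_connected (Suc k) (E2 - S3)"
  proof (rule matching_connected_isolated)
    show "e \<in> E2 - S3" using e by (auto simp: E1_def E2_def S1_def S2_def S3_def)
    show "\<alpha> f \<noteq> \<alpha> e \<and> \<beta> f \<noteq> \<beta> e" if "f \<in> E2 - S3" "f \<noteq> e" for f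
      using that e(2) by (auto simp: E2_def S2_def S3_def)
  qed (use fin in auto)
  then have "matching_connected (Suc k) E2"
  proof (rule matching_connected_peel[OF fin(2), rotated])
    fix f E' assume f: "f \<in> S3" and E': "E2 - S3 \<subseteq> E'" "E' \<subseteq> E2"
    have fy: "f \<in> E" "\<alpha> f = y" "f \<noteq> e" "f \<notin> S1" using f by (auto simp: S3_def E2_def E1_def)
    then have "good f" by (simp add: S1_def)
    then obtain N where N: "N \<subseteq> E" "is_matching N" "2 * k \<le> card N + 1"
      "y \<notin> \<alpha> ` N" "?x \<notin> \<beta> ` N" "\<beta> f \<notin> \<beta> ` N" by (auto simp: good_def)
    have N': "\<alpha> g \<noteq> y" "\<beta> g \<noteq> ?x" "\<beta> g \<noteq> \<beta> f" if "g \<in> N" for g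
      using N(4) N(5) N(6) imageI[OF that, of \<alpha>] imageI[OF that, of \<beta>] by metis+
    show "matching_connected k (avoiding f E')"
    proof (rule conn[of E' N])
      show "E' \<subseteq> E" using E'(2) by (auto simp: E1_def E2_def)
      have "N \<subseteq> E2 - S3"
      proof
        fix g assume g: "g \<in> N"
        show "g \<in> E2 - S3"
          using N'(1,2)[OF g] subsetD[OF N(1) g] by (simp add: E1_def E2_def S1_def S2_def S3_def)
      qed
      then show "N \<subseteq> E'" using E'(1) by auto
      show "\<alpha> g \<noteq> \<alpha> f \<and> \<beta> g \<noteq> \<beta> f" if "g \<in> N" for g using N'[OF that] fy(2) by simp
    qed (rule N)+
  qed (auto simp: S3_def)
  then have "matching_connected (Suc k) E1"
    unfolding E2_def
  proof (rule matching_connected_peel[OF fin(1), rotated])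
    fix f E' assume f: "f \<in> S2" and E': "E1 - S2 \<subseteq> E'" "E' \<subseteq> E1"
    show "matching_connected k (avoiding f E')"
    proof (rule conn[of E' "{g \<in> M. \<alpha> g \<noteq> \<alpha> f}"])
      show "E' \<subseteq> E" using E'(2) by (auto simp: E1_def)
      have "g \<in> E1 - S2" if "g \<in> M" for g
      proof -
        have "\<beta> g \<noteq> ?x" using M(4) imageI[OF that, of \<beta>] by metis
        moreover have "g \<notin> S1" using y_only[OF that] f'_good by (auto simp: S1_def)
        ultimately show ?thesis using M(1) that by (auto simp: E1_def S2_def)
      qed
      then show "{g \<in> M. \<alpha> g \<noteq> \<alpha> f} \<subseteq> E'" using E'(1) by auto
      show "is_matching {g \<in> M. \<alpha> g \<noteq> \<alpha> f}" using M(2) by (rule is_matching_subset) auto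
      show "2 * k \<le> card {g \<in> M. \<alpha> g \<noteq> \<alpha> f} + 1"
        using card_remove_fibre[of \<alpha> M "\<alpha> f"] M(2,3) finM[OF M(1)] by (simp add: is_matching_def)
      show "\<alpha> g \<noteq> \<alpha> f \<and> \<beta> g \<noteq> \<beta> f" if "g \<in> {g \<in> M. \<alpha> g \<noteq> \<alpha> f}" for g
      proof -
        have "\<beta> g \<noteq> ?x" using M(4) that by (metis (mono_tags, lifting) imageI mem_Collect_eq)
        then show ?thesis using that f by (simp add: S2_def)
      qed
    qed
  qed (auto simp: S2_def)
  then show "matching_connected (Suc k) E"
    unfolding E1_def
  proof (rule matching_connected_peel[OF E, rotated])
    fix f E' assume f: "f \<in> S1" and E': "E - S1 \<subseteq> E'" "E' \<subseteq> E"
    have fy: "f \<in> E" "\<alpha> f = y" using f by (auto simp: S1_def)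
    obtain N where N: "N \<subseteq> E" "is_matching N" "2 * k \<le> card N" "\<beta> f \<notin> \<beta> ` N" using av[OF fy] by blast
    show "matching_connected k (avoiding f E')"
    proof (rule conn[of E' "{g \<in> N. \<alpha> g \<noteq> \<alpha> f}"])
      show "{g \<in> N. \<alpha> g \<noteq> \<alpha> f} \<subseteq> E'" using E'(1) N(1) fy(2) by (auto simp: S1_def)
      show "is_matching {g \<in> N. \<alpha> g \<noteq> \<alpha> f}" using N(2) by (rule is_matching_subset) auto
      show "2 * k \<le> card {g \<in> N. \<alpha> g \<noteq> \<alpha> f} + 1"
        using card_remove_fibre[of \<alpha> N "\<alpha> f"] N(2,3) finM[OF N(1)] by (simp add: is_matching_def)
      show "\<alpha> g \<noteq> \<alpha> f \<and> \<beta> g \<noteq> \<beta> f" if "g \<in> {g \<in> N. \<alpha> g \<noteq> \<alpha> f}" for g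
      proof -
        have "\<beta> g \<noteq> \<beta> f" using N(4) that by (metis (mono_tags, lifting) imageI mem_Collect_eq)
        then show ?thesis using that fy(2) by simp
      qed
    qed (rule E')
  qed (auto simp: S1_def)
qed

section \<open>Elementary bipartite graphs\<close>

lemma matching_of_hall_deficiency:
  assumes E: "finite E" and X: "finite X"
    and H: "\<And>D. D \<subseteq> X \<Longrightarrow> card D \<le> card (\<alpha> ` {e \<in> E. \<beta> e \<in> D}) + d"
  shows "\<exists>M\<subseteq>E. is_matching M \<and> \<beta> ` M \<subseteq> X \<and> card X \<le> card M + d"
proof -
  let ?S = "\<lambda>x. \<alpha> ` {e \<in> E. \<beta> e = x}"
  have "\<exists>X' f. X' \<subseteq> X \<and> card X \<le> card X' + d \<and> inj_on f X' \<and> (\<forall>x\<in>X'. f x \<in> ?S x)"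
  proof (rule hall_deficiency[OF X])
    show "finite (?S x)" for x using E by simp
    show "card J \<le> card (\<Union>(?S ` J)) + d" if "J \<subseteq> X" for J
    proof -
      have "\<Union>(?S ` J) = \<alpha> ` {e \<in> E. \<beta> e \<in> J}" by blast
      then show ?thesis using H[OF that] by simp
    qed
  qed
  then obtain X' f where X': "X' \<subseteq> X" "card X \<le> card X' + d"
    and f: "inj_on f X'" "\<And>x. x \<in> X' \<Longrightarrow> f x \<in> ?S x" by blast
  have "\<exists>e. e \<in> E \<and> \<beta> e = x \<and> \<alpha> e = f x" if "x \<in> X'" for x
  proof -
    obtain e where "f x = \<alpha> e" "e \<in> {e \<in> E. \<beta> e = x}" using f(2)[OF \<open>x \<in> X'\<close>] by (rule imageE)
    then show ?thesis by auto
  qed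
  then obtain c where c: "\<And>x. x \<in> X' \<Longrightarrow> c x \<in> E \<and> \<beta> (c x) = x \<and> \<alpha> (c x) = f x" by metis
  have "inj_on \<alpha> (c ` X')" "inj_on \<beta> (c ` X')"
    using c inj_onD[OF f(1)] by (auto simp: inj_on_def)
  moreover have "inj_on c X'" using c by (metis inj_onI)
  then have "card (c ` X') = card X'" by (rule card_image)
  moreover have "\<beta> ` c ` X' = X'" using c by (simp add: image_image)
  ultimately show ?thesis
    using c X' by (intro exI[of _ "c ` X'"]) (auto simp: is_matching_def)
qed

lemma card_is_matching:
  assumes "is_matching M" shows "card M = card (\<beta> ` M)"
  using assms by (simp add: is_matching_def card_image)

lemma matching_of_hall:
  assumes E: "finite E" and X: "finite X"
    and H: "\<And>D. D \<subseteq> X \<Longrightarrow> card D \<le> card (\<alpha> ` {e \<in> E. \<beta> e \<in> D})"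
  shows "\<exists>M\<subseteq>E. is_matching M \<and> \<beta> ` M = X"
proof -
  obtain M where M: "M \<subseteq> E" "is_matching M" "\<beta> ` M \<subseteq> X" "card X \<le> card M"
    using matching_of_hall_deficiency[OF E X, where d = 0] H by auto
  then have "\<beta> ` M = X" using X card_is_matching[OF M(2)] by (intro card_seteq) auto
  then show ?thesis using M(1,2) by blast
qed

text \<open>The vertices of \<open>N(X)\<close> and of \<open>B \<setminus> X\<close> cover all edges. A matching that uses an edge with both ends in this
cover has fewer edges than the cover has vertices.\<close>

lemma matching_meets_cover:
  assumes B: "finite B" "X \<subseteq> B" and E: "finite E"
    and M: "M \<subseteq> E" "is_matching M" "\<beta> ` M \<subseteq> B"
  shows "card M \<le> card (\<alpha> ` {e \<in> E. \<beta> e \<in> X}) + card (B - X)"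
    and "g \<in> M \<Longrightarrow> \<beta> g \<notin> X \<Longrightarrow> \<alpha> g \<in> \<alpha> ` {e \<in> E. \<beta> e \<in> X} \<Longrightarrow>
      card M < card (\<alpha> ` {e \<in> E. \<beta> e \<in> X}) + card (B - X)"
proof -
  let ?N = "\<alpha> ` {e \<in> E. \<beta> e \<in> X}"
  let ?M1 = "{g \<in> M. \<beta> g \<in> X}" and ?M2 = "{g \<in> M. \<beta> g \<notin> X}"
  have inj: "inj_on \<alpha> M" "inj_on \<beta> M" using M(2) by (auto simp: is_matching_def)
  have finM: "finite M" using M(1) E by (rule finite_subset)
  have finN: "finite ?N" using E by simp
  have "M = ?M1 \<union> ?M2" by blast
  then have split: "card M = card ?M1 + card ?M2"
    using finM card_Un_disjoint[of ?M1 ?M2] by auto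
  have "card ?M2 = card (\<beta> ` ?M2)" by (rule card_image[symmetric], rule inj_on_subset[OF inj(2)]) blast
  also have "\<dots> \<le> card (B - X)" using M(3) B(1) by (intro card_mono) auto
  finally have M2: "card ?M2 \<le> card (B - X)" .
  have M1: "card ?M1 = card (\<alpha> ` ?M1)" by (rule card_image[symmetric], rule inj_on_subset[OF inj(1)]) blast
  have sub: "\<alpha> ` ?M1 \<subseteq> ?N" using M(1) by blast
  then have "card ?M1 \<le> card ?N" unfolding M1 using finN by (intro card_mono)
  then show "card M \<le> card ?N + card (B - X)" using split M2 by simp
  assume g: "g \<in> M" "\<beta> g \<notin> X" "\<alpha> g \<in> ?N"
  have "\<alpha> g \<notin> \<alpha> ` ?M1"
  proof
    assume "\<alpha> g \<in> \<alpha> ` ?M1"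
    then obtain h where "h \<in> M" "\<beta> h \<in> X" "\<alpha> g = \<alpha> h" by blast
    then show False using inj_onD[OF inj(1), of g h] g by metis
  qed
  then have "\<alpha> ` ?M1 \<subset> ?N" using sub g(3) by blast
  then have "card ?M1 < card ?N" unfolding M1 using finN by (intro psubset_card_mono)
  then show "card M < card ?N + card (B - X)" using split M2 by simp
qed

text \<open>The deficiency \<open>|D| - |N(D)|\<close> is supermodular. If \<open>X\<close> is a smallest set of maximum deficiency and
\<open>x \<in> X\<close>, then every \<open>D\<close> without \<open>x\<close> meets \<open>X\<close> in a smaller set, which has smaller deficiency, and then so
has \<open>D\<close>. Thus the maximum deficiency drops when any vertex of \<open>X\<close> is removed.\<close>

lemma exists_minimal_maximum_deficiency:
  fixes N :: "'b set \<Rightarrow> 'a set"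
  assumes B: "finite B" and fin: "\<And>D. D \<subseteq> B \<Longrightarrow> finite (N D)"
    and un: "\<And>C D. N (C \<union> D) = N C \<union> N D" and D\<^sub>0: "D\<^sub>0 \<subseteq> B" "card (N D\<^sub>0) < card D\<^sub>0"
  obtains X d where "X \<subseteq> B" "card X = card (N X) + Suc d"
    "\<forall>D\<subseteq>B. card D \<le> card (N D) + Suc d"
    "\<forall>x\<in>X. \<forall>D\<subseteq>B - {x}. card D \<le> card (N D) + d"
proof -
  define f where "f D = int (card D) - int (card (N D))" for D
  let ?m = "Max (f ` Pow B)"
  have fin_f: "finite (f ` Pow B)" "f ` Pow B \<noteq> {}" using B by auto
  have le: "f D \<le> ?m" if "D \<subseteq> B" for D using that fin_f by (intro Max_ge) auto
  have "\<exists>X. X \<subseteq> B \<and> f X = ?m" using Max_in[OF fin_f] by auto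
  then obtain X where X: "X \<subseteq> B" "f X = ?m"
    and X_min: "\<And>D. D \<subseteq> B \<Longrightarrow> f D = ?m \<Longrightarrow> card X \<le> card D"
    using ex_has_least_nat[of "\<lambda>X. X \<subseteq> B \<and> f X = ?m" _ card] by metis
  have "0 < ?m" using le[OF D\<^sub>0(1)] D\<^sub>0(2) by (simp add: f_def)
  then obtain d where d: "?m = int (Suc d)" by (metis zero_less_imp_eq_int gr0_implies_Suc)
  have finX: "finite D" if "D \<subseteq> B" for D using that B by (rule finite_subset)
  have surplus: "card D \<le> card (N D) + d" if x: "x \<in> X" and D: "D \<subseteq> B - {x}" for x D
  proof -
    have DB: "D \<subseteq> B" "D \<inter> X \<subseteq> B" "D \<union> X \<subseteq> B" using D X(1) by auto
    have "card (D \<inter> X) < card X" using x D finX[OF X(1)] by (intro psubset_card_mono) auto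
    then have "f (D \<inter> X) \<noteq> ?m" using X_min[OF DB(2)] by auto
    then have "f (D \<inter> X) \<le> int d" using le[OF DB(2)] d by simp
    moreover have "f (D \<union> X) \<le> f X" using le[OF DB(3)] X(2) by simp
    moreover have "f D + f X \<le> f (D \<inter> X) + f (D \<union> X)"
    proof -
      have "N (D \<inter> X) \<subseteq> N D \<inter> N X" 
      proof -
        have "(D \<inter> X) \<union> D = D" "(D \<inter> X) \<union> X = X" by auto
        then have "N D = N (D \<inter> X) \<union> N D" "N X = N (D \<inter> X) \<union> N X"
          using un[of "D \<inter> X" D] un[of "D \<inter> X" X] by simp_all
        then show ?thesis by blast
      qed
      then have "card (N (D \<inter> X)) \<le> card (N D \<inter> N X)" using fin[OF DB(1)] by (intro card_mono) auto
      moreover have "card (N D) + card (N X) = card (N (D \<union> X)) + card (N D \<inter> N X)"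
        unfolding un using card_Un_Int[OF fin[OF DB(1)] fin[OF X(1)]] by simp
      moreover have "card (D \<union> X) + card (D \<inter> X) = card D + card X"
        using card_Un_Int[OF finX[OF DB(1)] finX[OF X(1)]] by simp
      ultimately show ?thesis unfolding f_def by simp
    qed
    ultimately have "f D \<le> int d" by simp
    then show ?thesis by (simp add: f_def)
  qed
  show thesis
  proof (rule that[OF X(1)])
    show "card X = card (N X) + Suc d" using X(2) d by (simp add: f_def)
    have "card D \<le> card (N D) + Suc d" if "D \<subseteq> B" for D using le[OF that] d by (simp add: f_def)
    then show "\<forall>D\<subseteq>B. card D \<le> card (N D) + Suc d" by simp
    show "\<forall>x\<in>X. \<forall>D\<subseteq>B - {x}. card D \<le> card (N D) + d" using surplus by simp
  qed
qed

text \<open>For \<open>|X| \<ge> 2\<close> this says that the graph between \<open>X\<close> and \<open>Y = N(X)\<close> is connected and that each of its edges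
lies in a perfect matching. Edges with \<open>\<beta> e \<notin> X\<close> may be present and are unrestricted.\<close>

definition elementary :: "'e set \<Rightarrow> 'b set \<Rightarrow> 'a set \<Rightarrow> bool" where
  "elementary E X Y \<longleftrightarrow> finite X \<and> finite Y \<and> card X = card Y \<and>
     (\<forall>e\<in>E. \<beta> e \<in> X \<longrightarrow> \<alpha> e \<in> Y) \<and>
     (\<forall>x\<in>X. \<forall>y\<in>Y. \<exists>M\<subseteq>E. is_matching M \<and> \<beta> ` M = X - {x} \<and> \<alpha> ` M = Y - {y})"

lemma elementaryD:
  assumes "elementary E X Y"
  shows "finite X" "finite Y" "card X = card Y"
    and "\<And>e. e \<in> E \<Longrightarrow> \<beta> e \<in> X \<Longrightarrow> \<alpha> e \<in> Y"
    and "\<And>x y. x \<in> X \<Longrightarrow> y \<in> Y \<Longrightarrow> \<exists>M\<subseteq>E. is_matching M \<and> \<beta> ` M = X - {x} \<and> \<alpha> ` M = Y - {y}"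
  using assms by (simp_all add: elementary_def)

lemma elementary_perfect_matching:
  assumes el: "elementary E X Y" and e: "e \<in> E" "\<beta> e \<in> X"
  shows "\<exists>M\<subseteq>E. is_matching M \<and> \<beta> ` M = X \<and> \<alpha> ` M = Y \<and> e \<in> M"
proof -
  have y: "\<alpha> e \<in> Y" using elementaryD(4)[OF el] e .
  obtain M where M: "M \<subseteq> E" "is_matching M" "\<beta> ` M = X - {\<beta> e}" "\<alpha> ` M = Y - {\<alpha> e}"
    using elementaryD(5)[OF el e(2) y] by blast
  have "is_matching (insert e M)" using M by (intro is_matching_insert) auto
  then show ?thesis using M e y by (intro exI[of _ "insert e M"]) auto
qed

lemma elementary_edge_at:
  assumes el: "elementary E X Y" and y: "y \<in> Y" and two: "2 \<le> card X"
  shows "\<exists>e\<in>E. \<beta> e \<in> X \<and> \<alpha> e = y"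
proof -
  have fin: "finite X" "finite Y" "card X = card Y" using elementaryD[OF el] by auto
  obtain x where x: "x \<in> X" using two by (metis card.empty equals0I not_numeral_le_zero)
  have "card (Y - {y}) = card Y - 1" using fin y by simp
  then have "Y - {y} \<noteq> {}" using two fin(3) by (metis card.empty diff_is_0_eq not_less_eq_eq numeral_2_eq_2 One_nat_def)
  then obtain y' where y': "y' \<in> Y" "y \<noteq> y'" by auto
  obtain M where M: "M \<subseteq> E" "\<beta> ` M = X - {x}" "\<alpha> ` M = Y - {y'}"
    using elementaryD(5)[OF el x y'(1)] by blast
  then have "y \<in> \<alpha> ` M" using y y' by auto
  then obtain e where "e \<in> M" "\<alpha> e = y" by auto
  moreover have "\<beta> e \<in> X" using M(2) \<open>e \<in> M\<close> by auto
  ultimately show ?thesis using M(1) by auto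
qed

text \<open>The cut condition says that the digraph \<open>R\<close> on \<open>X\<close> is strongly connected. Fix a root \<open>\<rho>\<close>. A largest
proper subset that is reachable from \<open>\<rho>\<close> inside itself misses only one vertex \<open>v\<close>: otherwise it could be
enlarged. The vertices of \<open>X - v\<close> that cannot reach \<open>\<rho>\<close> without \<open>v\<close> form a set \<open>T\<close>; the arc that leaves
\<open>T \<union> {v}\<close> must start at \<open>v\<close>, and its end \<open>b\<close> reaches \<open>\<rho>\<close>, hence everything, inside \<open>X - v\<close>.
Reachability is expressed by cuts because Hall's condition consumes it in this form.\<close>

lemma cut_condition_removable_vertex:
  assumes X: "finite X" "2 \<le> card X"
    and cut: "\<And>D. D \<subset> X \<Longrightarrow> D \<noteq> {} \<Longrightarrow> \<exists>c\<in>D. \<exists>d\<in>X - D. R c d"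
  shows "\<exists>v\<in>X. \<exists>b\<in>X - {v}. R v b \<and>
    (\<forall>D. D \<subset> X - {v} \<longrightarrow> b \<in> D \<longrightarrow> (\<exists>c\<in>D. \<exists>d\<in>X - {v} - D. R c d))"
proof -
  \<comment> \<open>A set is rooted if all its members can be reached from \<open>\<rho>\<close> inside it.\<close>
  obtain \<rho> where \<rho>: "\<rho> \<in> X" using X(2) by (metis card.empty equals0I not_numeral_le_zero)
  define rooted where "rooted D \<longleftrightarrow> \<rho> \<in> D \<and> D \<subset> X \<and> (\<forall>S. S \<subset> D \<longrightarrow> \<rho> \<in> S \<longrightarrow> (\<exists>c\<in>S. \<exists>d\<in>D - S. R c d))" for D
  have "X \<noteq> {\<rho>}" using X(2) by auto
  then have "rooted {\<rho>}" using \<rho> by (auto simp: rooted_def)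
  moreover have "finite {D. rooted D}"
    using X(1) by (rule finite_subset[rotated, OF finite_Pow_iff[THEN iffD2]]) (auto simp: rooted_def)
  ultimately obtain D where D: "rooted D" and Dmax: "\<And>D'. rooted D' \<Longrightarrow> D \<subseteq> D' \<Longrightarrow> D' = D"
    using finite_has_maximal2[of "{D. rooted D}" "{\<rho>}"] by auto
  have D': "\<rho> \<in> D" "D \<subset> X" using D by (simp_all add: rooted_def)
  obtain c v where v: "c \<in> D" "v \<in> X - D" "R c v" using cut[OF D'(2)] D'(1) by blast
  have "\<not> rooted (insert v D)" using Dmax[of "insert v D"] v(2) by blast
  moreover have "\<exists>c\<in>S. \<exists>d\<in>insert v D - S. R c d" if S: "S \<subset> insert v D" "\<rho> \<in> S" for S
  proof (cases "D \<subseteq> S")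
    case True
    then have "v \<notin> S" using S(1) by blast
    then show ?thesis using v True by blast
  next
    case False
    then have "S \<inter> D \<subset> D" "\<rho> \<in> S \<inter> D" using S(2) D'(1) by auto
    then obtain c d where "c \<in> S \<inter> D" "d \<in> D - S \<inter> D" "R c d"
      using D unfolding rooted_def by blast
    then show ?thesis by blast
  qed
  ultimately have "\<not> insert v D \<subset> X" using D'(1) unfolding rooted_def by blast
  then have Xv: "X - {v} = D" using D'(2) v(2) by auto
  \<comment> \<open>The vertices that are shut off from \<open>\<rho>\<close> by a set without outgoing arcs.\<close>
  define T where "T = {a \<in> D. \<exists>D'\<subseteq>D. a \<in> D' \<and> \<rho> \<notin> D' \<and> (\<forall>c\<in>D'. \<forall>d\<in>D - D'. \<not> R c d)}"
  have T_closed: "\<not> R c d" if c: "c \<in> T" and d: "d \<in> D - T" for c d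
  proof
    assume "R c d"
    obtain D' where W: "D' \<subseteq> D" "c \<in> D'" "\<rho> \<notin> D'" "\<forall>c\<in>D'. \<forall>d\<in>D - D'. \<not> R c d"
      using c unfolding T_def by blast
    then have "d \<in> D'" using \<open>R c d\<close> d by blast
    then have "d \<in> T" using W d unfolding T_def by blast
    then show False using d by simp
  qed
  have "\<rho> \<notin> T" "T \<subseteq> D" by (auto simp: T_def)
  then have "insert v T \<subset> X" using D' v(2) by auto
  then obtain c b where cb: "c \<in> insert v T" "b \<in> X - insert v T" "R c b" using cut[of "insert v T"] by blast
  then have b: "b \<in> D - T" using Xv by blast
  have vb: "R v b" using cb T_closed b by blast
  have reach: "\<exists>c\<in>S. \<exists>d\<in>D - S. R c d" if S: "S \<subset> D" "b \<in> S" for S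
  proof (cases "\<rho> \<in> S")
    case True
    then show ?thesis using D S(1) unfolding rooted_def by blast
  next
    case False
    then show ?thesis using b S unfolding T_def by blast
  qed
  show ?thesis
  proof (rule bexI[of _ v], rule bexI[of _ b], intro conjI allI impI)
    show "\<exists>c\<in>S. \<exists>d\<in>X - {v} - S. R c d" if "S \<subset> X - {v}" "b \<in> S" for S
      using reach[of S] that unfolding Xv by simp
    show "b \<in> X - {v}" using b unfolding Xv by simp
    show "v \<in> X" using v(2) by simp
  qed (rule vb)
qed

text \<open>There is a vertex \<open>v \<in> X\<close> with two neighbours \<open>p\<close>, \<open>q\<close> such that removing the path \<open>p v q\<close> together with any
further vertex of \<open>X\<close> leaves a perfectly matchable graph. To find it, fix a perfect matching \<open>\<phi>\<close>. An edge
from \<open>c\<close> to \<open>\<phi> d\<close> is an arc from \<open>c\<close> to \<open>d\<close>, and alternating paths become directed paths. This digraph is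
strongly connected, so the preceding lemma provides \<open>v\<close> and \<open>b\<close>. With \<open>p = \<phi> v\<close> and \<open>q = \<phi> b\<close> the
vertex \<open>b\<close> is unmatched after the removal, and as \<open>b\<close> reaches every \<open>x\<close> the defect can be moved from \<open>b\<close>
to \<open>x\<close>.\<close>

lemma elementary_removable_path:
  assumes E: "finite E" and el: "elementary E X Y" and two: "2 \<le> card X"
  shows "\<exists>e\<in>E. \<exists>f\<in>E. \<beta> e \<in> X \<and> \<beta> f = \<beta> e \<and> \<alpha> f \<noteq> \<alpha> e \<and>
    (\<forall>x\<in>X - {\<beta> e}. \<exists>M\<subseteq>E. is_matching M \<and> \<beta> ` M = X - {\<beta> e, x} \<and> \<alpha> e \<notin> \<alpha> ` M \<and> \<alpha> f \<notin> \<alpha> ` M)"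
proof -
  have fin: "finite X" "finite Y" "card X = card Y" using elementaryD[OF el] by auto
  have "Y \<noteq> {}" using two fin by auto
  then obtain y\<^sub>0 where y\<^sub>0: "y\<^sub>0 \<in> Y" by blast
  then obtain e\<^sub>0 where e\<^sub>0: "e\<^sub>0 \<in> E" "\<beta> e\<^sub>0 \<in> X" using elementary_edge_at[OF el y\<^sub>0 two] by blast
  obtain P where P: "P \<subseteq> E" "is_matching P" "\<beta> ` P = X" "\<alpha> ` P = Y"
    using elementary_perfect_matching[OF el e\<^sub>0] by blast
  define p where "p x = the_inv_into P \<beta> x" for x
  have p: "p x \<in> P" "\<beta> (p x) = x" if "x \<in> X" for x
    using the_inv_into_into[of \<beta> P x P] f_the_inv_into_f[of \<beta> P x] that P(2,3)
    by (auto simp: p_def is_matching_def)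
  define \<phi> where "\<phi> x = \<alpha> (p x)" for x
  have \<phi>_inj: "inj_on \<phi> X"
  proof (rule inj_onI)
    fix x x' assume "x \<in> X" "x' \<in> X" "\<phi> x = \<phi> x'"
    then have "p x = p x'" using p P(2) by (auto simp: \<phi>_def is_matching_def dest: inj_onD)
    then show "x = x'" using p \<open>x \<in> X\<close> \<open>x' \<in> X\<close> by metis
  qed
  have "\<phi> ` X \<subseteq> Y" using p P(4) by (auto simp: \<phi>_def)
  then have \<phi>_onto: "\<phi> ` X = Y" using fin card_image[OF \<phi>_inj] by (intro card_subset_eq) auto
  define R where "R c d \<longleftrightarrow> (\<exists>e\<in>E. \<beta> e = c \<and> \<alpha> e = \<phi> d)" for c d
  have "\<exists>c\<in>D. \<exists>d\<in>X - D. R c d" if D: "D \<subset> X" "D \<noteq> {}" for D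
  proof -
    obtain x' where x': "x' \<in> X - D" using D by blast
    obtain x'' where x'': "x'' \<in> D" using D by blast
    then have "\<phi> x'' \<in> Y" using \<phi>_onto D by blast
    then obtain M where M: "M \<subseteq> E" "is_matching M" "\<beta> ` M = X - {x'}" "\<alpha> ` M = Y - {\<phi> x''}"
      using elementaryD(5)[OF el, of x' "\<phi> x''"] x' by blast
    let ?M = "{e \<in> M. \<beta> e \<in> D}"
    have finD: "finite D" using D(1) fin(1) by (auto intro: finite_subset)
    have "\<beta> ` ?M = D" using M(3) D x' by auto
    moreover have "is_matching ?M" using M(2) by (rule is_matching_subset) auto
    ultimately have cD: "card D = card (\<alpha> ` ?M)"
      using card_image[of \<beta> ?M] card_image[of \<alpha> ?M] by (simp add: is_matching_def)
    have "\<not> \<alpha> ` ?M \<subseteq> \<phi> ` D"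
    proof
      assume "\<alpha> ` ?M \<subseteq> \<phi> ` D"
      then have "\<alpha> ` ?M \<subseteq> \<phi> ` D - {\<phi> x''}" using M(4) by auto
      then have "card (\<alpha> ` ?M) \<le> card (\<phi> ` D - {\<phi> x''})" using finD by (intro card_mono) auto
      also have "\<dots> < card (\<phi> ` D)" using finD x'' by (intro card_Diff1_less) auto
      also have "\<dots> \<le> card D" using finD by (rule card_image_le)
      finally show False using cD by simp
    qed
    then obtain e where e: "e \<in> M" "\<beta> e \<in> D" "\<alpha> e \<notin> \<phi> ` D" by blast
    then have "\<alpha> e \<in> \<phi> ` X" using M(4) \<phi>_onto by auto
    then obtain d where d: "d \<in> X" "\<alpha> e = \<phi> d" by blast
    then have "d \<in> X - D" using e(3) by auto
    then show ?thesis using e d M(1) unfolding R_def by blast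
  qed
  from cut_condition_removable_vertex[OF fin(1) two this] obtain v b where
    v: "v \<in> X" and b: "b \<in> X - {v}" and vb: "R v b"
    and reach: "\<And>D. D \<subset> X - {v} \<Longrightarrow> b \<in> D \<Longrightarrow> \<exists>c\<in>D. \<exists>d\<in>X - {v} - D. R c d"
    by metis
  obtain f where f: "f \<in> E" "\<beta> f = v" "\<alpha> f = \<phi> b" using vb by (auto simp: R_def)
  have ne: "\<phi> b \<noteq> \<phi> v" using b v inj_onD[OF \<phi>_inj, of b v] by blast
  have "\<exists>M\<subseteq>E. is_matching M \<and> \<beta> ` M = X - {v, x} \<and> \<phi> v \<notin> \<alpha> ` M \<and> \<phi> b \<notin> \<alpha> ` M"
    if x: "x \<in> X - {v}" for x
  proof -
    let ?E = "{e \<in> E. \<alpha> e \<noteq> \<phi> v \<and> \<alpha> e \<noteq> \<phi> b}"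
    have "\<exists>M\<subseteq>?E. is_matching M \<and> \<beta> ` M = X - {v, x}"
    proof (rule matching_of_hall)
      fix D assume D: "D \<subseteq> X - {v, x}"
      have finD: "finite D" using D fin(1) by (auto intro: finite_subset)
      let ?N = "\<alpha> ` {e \<in> ?E. \<beta> e \<in> D}"
      have finN: "finite ?N" using E by simp
      have step: "\<phi> d \<in> ?N" if c: "c \<in> D" and cd: "R c d" and d: "d \<in> X" "d \<noteq> v" "d \<noteq> b" for c d
      proof -
        obtain g where g: "g \<in> E" "\<beta> g = c" "\<alpha> g = \<phi> d" using cd by (auto simp: R_def)
        have "\<phi> d \<noteq> \<phi> v" "\<phi> d \<noteq> \<phi> b"
          using inj_onD[OF \<phi>_inj, of d v] inj_onD[OF \<phi>_inj, of d b] d v b by blast+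
        then have "g \<in> {e \<in> ?E. \<beta> e \<in> D}" using g c by simp
        then have "\<alpha> g \<in> ?N" by (rule imageI)
        then show ?thesis using g(3) by simp
      qed
      have R_self: "R c c" if "c \<in> X" for c
        using p[OF that] P(1) by (auto simp: R_def \<phi>_def)
      have inj: "inj_on \<phi> S" if "S \<subseteq> X" for S using \<phi>_inj that by (rule inj_on_subset)
      show "card D \<le> card ?N"
      proof (cases "b \<in> D")
        case False
        have "\<phi> ` D \<subseteq> ?N"
          using step[OF _ R_self] D False by blast
        then have "card (\<phi> ` D) \<le> card ?N" using finN by (rule card_mono[rotated])
        moreover have "D \<subseteq> X" using D by blast
        ultimately show ?thesis using card_image[OF inj[of D]] by simp
      next
        case True
        have "D \<subset> X - {v}" using D x by blast
        then obtain c d where cd: "c \<in> D" "d \<in> X - {v} - D" "R c d" using reach True by blast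
        have "\<phi> ` (insert d (D - {b})) \<subseteq> ?N"
          using step[OF _ R_self] step[OF cd(1,3)] cd(2) D True by blast
        then have "card (\<phi> ` (insert d (D - {b}))) \<le> card ?N" using finN by (rule card_mono[rotated])
        moreover have "card (\<phi> ` (insert d (D - {b}))) = card (insert d (D - {b}))"
          using D cd(2) by (intro card_image inj) blast
        moreover have "card (insert d (D - {b})) = card D"
          using cd(2) card_Suc_Diff1[OF finD True] finD by simp
        ultimately show ?thesis by simp
      qed
    qed (use E fin in auto)
    then obtain M where "M \<subseteq> ?E" "is_matching M" "\<beta> ` M = X - {v, x}" by blast
    then show ?thesis by (intro exI[of _ M]) auto
  qed
  then have "\<forall>x\<in>X - {\<beta> (p v)}. \<exists>M\<subseteq>E. is_matching M \<and> \<beta> ` M = X - {\<beta> (p v), x} \<and> \<alpha> (p v) \<notin> \<alpha> ` M \<and> \<alpha> f \<notin> \<alpha> ` M"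
    using p[OF v] f(3) by (simp add: \<phi>_def)
  moreover have "\<beta> f = \<beta> (p v)" "\<alpha> f \<noteq> \<alpha> (p v)" "\<beta> (p v) \<in> X" "p v \<in> E"
    using p[OF v] f ne v P(1) by (auto simp: \<phi>_def)
  ultimately show ?thesis using f(1) by blast
qed

text \<open>An elementary graph with \<open>2k \<ge> 4\<close> vertices on each side exceeds the general bound (for \<open>k = 1\<close> this fails,
as the \<open>C\<^sub>4\<close> shows). Let \<open>p v q\<close> be a removable path and \<open>e = pv\<close>, \<open>f = vq\<close>. To isolate \<open>e\<close>, delete
first the edges at \<open>v\<close> to vertices other than \<open>p\<close> and \<open>q\<close>, then the edges at \<open>p\<close> other than \<open>e\<close>, and
last the edges between \<open>v\<close> and \<open>q\<close>. The first two kinds leave matchings of size \<open>2k - 1\<close> off their ends.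
For the last kind the rest is the graph without \<open>p\<close>, \<open>v\<close>, \<open>q\<close>, which has only matchings of size
\<open>2k - 2\<close>; but there every vertex of \<open>X\<close> is dispensable.\<close>

lemma matching_connected_elementary:
  assumes E: "finite E" "\<And>e. e \<in> E \<Longrightarrow> \<beta> e \<in> X" and el: "elementary E X Y"
    and card: "card X = 2 * k" "2 \<le> k"
  shows "matching_connected (Suc k) E"
proof -
  have fin: "finite X" "finite Y" using elementaryD[OF el] by auto
  obtain e f where e: "e \<in> E" and f: "f \<in> E" "\<beta> f = \<beta> e" "\<alpha> f \<noteq> \<alpha> e"
    and ev: "\<beta> e \<in> X" and path: "\<And>x. x \<in> X - {\<beta> e} \<Longrightarrow> \<exists>M\<subseteq>E. is_matching M \<and>
      \<beta> ` M = X - {\<beta> e, x} \<and> \<alpha> e \<notin> \<alpha> ` M \<and> \<alpha> f \<notin> \<alpha> ` M"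
    using elementary_removable_path[OF E(1) el] card by fastforce
  let ?v = "\<beta> e" and ?p = "\<alpha> e" and ?q = "\<alpha> f"
  have path': "\<exists>M\<subseteq>E. is_matching M \<and> card M = 2 * k - 2 \<and> (\<forall>g\<in>M. \<beta> g \<noteq> ?v \<and> \<beta> g \<noteq> x \<and> \<alpha> g \<noteq> ?p \<and> \<alpha> g \<noteq> ?q)"
    if x: "x \<in> X - {?v}" for x
  proof -
    obtain M where M: "M \<subseteq> E" "is_matching M" "\<beta> ` M = X - {?v, x}" "?p \<notin> \<alpha> ` M" "?q \<notin> \<alpha> ` M"
      using path[OF x] by blast
    have "card {?v, x} = 2" using x by auto
    then have "card M = 2 * k - 2"
      using card_is_matching[OF M(2)] M(3) x ev fin(1) card(1) by (simp add: card_Diff_subset)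
    moreover have "\<beta> g \<noteq> ?v \<and> \<beta> g \<noteq> x \<and> \<alpha> g \<noteq> ?p \<and> \<alpha> g \<noteq> ?q" if "g \<in> M" for g
      using imageI[OF that, of \<beta>] imageI[OF that, of \<alpha>] M(3-5) by (metis DiffD2 insertCI)
    ultimately show ?thesis using M(1,2) by blast
  qed
  have away: "\<exists>M\<subseteq>E. is_matching M \<and> 2 * k \<le> card M + 1 \<and> (\<forall>g\<in>M. \<beta> g \<noteq> ?v \<and> \<alpha> g \<noteq> u)"
    if u: "u \<in> Y" for u
  proof -
    obtain M where M: "M \<subseteq> E" "is_matching M" "\<beta> ` M = X - {?v}" "\<alpha> ` M = Y - {u}"
      using elementaryD(5)[OF el ev u] by blast
    have "card M = 2 * k - 1" using card_is_matching[OF M(2)] M(3) ev fin(1) card(1) by simp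
    then have "2 * k \<le> card M + 1" by simp
    moreover have "\<beta> g \<noteq> ?v \<and> \<alpha> g \<noteq> u" if "g \<in> M" for g
      using imageI[OF that, of \<beta>] imageI[OF that, of \<alpha>] M(3,4) by (metis DiffD2 singletonI)
    ultimately show ?thesis using M(1,2) by blast
  qed
  define S1 where "S1 = {g \<in> E. \<beta> g = ?v \<and> \<alpha> g \<noteq> ?p \<and> \<alpha> g \<noteq> ?q}"
  define E1 where "E1 = E - S1"
  define S2 where "S2 = {g \<in> E1. \<alpha> g = ?p \<and> g \<noteq> e}"
  define E2 where "E2 = E1 - S2"
  define S3 where "S3 = {g \<in> E2. \<beta> g = ?v \<and> g \<noteq> e}"
  have finE: "finite E1" "finite E2" using E by (auto simp: E1_def E2_def)
  have "matching_connected (Suc k) (E2 - S3)"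
  proof (rule matching_connected_isolated)
    show "e \<in> E2 - S3" using e by (simp add: E1_def E2_def S1_def S2_def S3_def)
    show "\<alpha> g \<noteq> \<alpha> e \<and> \<beta> g \<noteq> \<beta> e" if "g \<in> E2 - S3" "g \<noteq> e" for g
      using that by (auto simp: E2_def S2_def S3_def)
  qed (use finE in simp)
  then have "matching_connected (Suc k) E2"
  proof (rule matching_connected_peel[OF finE(2), rotated])
    fix g E' assume g: "g \<in> S3" and E': "E2 - S3 \<subseteq> E'" "E' \<subseteq> E2"
    have g': "g \<in> E" "\<beta> g = ?v" "\<alpha> g = ?q" using g by (auto simp: S3_def E2_def S2_def E1_def S1_def)
    let ?E = "avoiding g E'"
    have E'_E: "E' \<subseteq> E" using E'(2) by (auto simp: E1_def E2_def)
    have in_E: "M \<subseteq> ?E" if "M \<subseteq> E" "\<forall>h\<in>M. \<beta> h \<noteq> ?v \<and> \<beta> h \<noteq> x \<and> \<alpha> h \<noteq> ?p \<and> \<alpha> h \<noteq> ?q" for M x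
    proof
      fix h assume h: "h \<in> M"
      then have "h \<in> E2 - S3" using that by (auto simp: E1_def E2_def S1_def S2_def S3_def)
      then show "h \<in> ?E" using E'(1) that(2) h g' by (auto simp: avoiding_def)
    qed
    obtain k' where k': "k = Suc k'" using card(2) by (cases k) auto
    have "card (X - {?v}) \<noteq> 0" using ev fin(1) card by simp
    then obtain x where x: "x \<in> X - {?v}" by (metis card.empty equals0I)
    obtain M where M: "M \<subseteq> E" "card M = 2 * k - 2"
      "\<forall>h\<in>M. \<beta> h \<noteq> ?v \<and> \<beta> h \<noteq> x \<and> \<alpha> h \<noteq> ?p \<and> \<alpha> h \<noteq> ?q" using path'[OF x] by blast
    have "M \<noteq> {}" using M(2) card(2) by auto
    then obtain h where h: "h \<in> M" by blast
    show "matching_connected k ?E"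
      unfolding k'
    proof (rule matching_connected_avoidable_neighbours[of _ h])
      show "finite ?E" using E(1) E'_E avoiding_subset by (metis finite_subset)
      show "h \<in> ?E" using in_E[OF M(1,3)] h by blast
      fix h' assume h': "h' \<in> ?E"
      then have "\<beta> h' \<in> X - {?v}" using E(2) E'_E g'(2) by (auto simp: avoiding_def)
      then obtain M' where M': "M' \<subseteq> E" "is_matching M'" "card M' = 2 * k - 2"
        "\<forall>g\<in>M'. \<beta> g \<noteq> ?v \<and> \<beta> g \<noteq> \<beta> h' \<and> \<alpha> g \<noteq> ?p \<and> \<alpha> g \<noteq> ?q" using path' by blast
      have "M' \<subseteq> ?E" using in_E[OF M'(1,4)] .
      moreover have "2 * k' \<le> card M'" using M'(3) k' by simp
      moreover have "\<beta> h' \<notin> \<beta> ` M'" using M'(4) by (metis imageE)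
      ultimately show "\<exists>M\<subseteq>?E. is_matching M \<and> 2 * k' \<le> card M \<and> \<beta> h' \<notin> \<beta> ` M"
        using M'(2) by blast
    qed simp
  qed (auto simp: S3_def)
  then have "matching_connected (Suc k) E1"
    unfolding E2_def
  proof (rule matching_connected_peel[OF finE(1), rotated])
    fix g E' assume g: "g \<in> S2" and E': "E1 - S2 \<subseteq> E'" "E' \<subseteq> E1"
    have g': "g \<in> E" "\<alpha> g = ?p" "g \<noteq> e" using g by (auto simp: S2_def E1_def)
    have finE': "finite E'" using E'(2) finE(1) by (rule finite_subset)
    show "matching_connected k (avoiding g E')"
    proof (cases "\<beta> g = ?v")
      case True
      have "?p \<in> Y" using elementaryD(4)[OF el e ev] .
      then obtain M where M: "M \<subseteq> E" "is_matching M" "2 * k \<le> card M + 1" "\<forall>g\<in>M. \<beta> g \<noteq> ?v \<and> \<alpha> g \<noteq> ?p"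
        using away by blast
      have "M \<subseteq> E1 - S2" using M(1,4) by (auto simp: E1_def S1_def S2_def)
      then have "M \<subseteq> E'" using E'(1) by blast
      then show ?thesis
        using M(2-4) True g'(2) by (intro matching_connected_avoiding[OF finE']) auto
    next
      case False
      then have "\<beta> g \<in> X - {?v}" using E(2)[OF g'(1)] by simp
      then obtain M where M: "M \<subseteq> E" "is_matching M" "card M = 2 * k - 2"
        "\<forall>h\<in>M. \<beta> h \<noteq> ?v \<and> \<beta> h \<noteq> \<beta> g \<and> \<alpha> h \<noteq> ?p \<and> \<alpha> h \<noteq> ?q" using path' by blast
      have f_out: "?q \<notin> \<alpha> ` M" "\<beta> f \<notin> \<beta> ` M" using M(4) f(2) by (metis imageE)+
      have "finite M" using M(1) E(1) by (rule finite_subset)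
      moreover have "f \<notin> M" using f_out by blast
      ultimately have "2 * k \<le> card (insert f M) + 1" using M(3) by simp
      moreover have "insert f M \<subseteq> E1 - S2" using M(1,4) f by (auto simp: E1_def S1_def S2_def)
      then have "insert f M \<subseteq> E'" using E'(1) by blast
      moreover have "is_matching (insert f M)" using M(2) f_out by (rule is_matching_insert)
      ultimately show ?thesis
        using M(4) False f g'(2) by (intro matching_connected_avoiding[OF finE', of "insert f M"]) auto
    qed
  qed (auto simp: S2_def)
  then show ?thesis
    unfolding E1_def
  proof (rule matching_connected_peel[OF E(1), rotated])
    fix g E' assume g: "g \<in> S1" and E': "E - S1 \<subseteq> E'" "E' \<subseteq> E"
    have g': "g \<in> E" "\<beta> g = ?v" using g by (auto simp: S1_def)
    have "\<alpha> g \<in> Y" using elementaryD(4)[OF el g'(1)] g'(2) ev by simp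
    then obtain M where M: "M \<subseteq> E" "is_matching M" "2 * k \<le> card M + 1" "\<forall>h\<in>M. \<beta> h \<noteq> ?v \<and> \<alpha> h \<noteq> \<alpha> g"
      using away by blast
    have "M \<subseteq> E'" using M(1,4) E'(1) by (auto simp: S1_def)
    moreover have "finite E'" using E'(2) E(1) by (rule finite_subset)
    ultimately show "matching_connected k (avoiding g E')"
      using M(2-4) g'(2) by (intro matching_connected_avoiding) auto
  qed (auto simp: S1_def)
qed

lemma elementary_restrict:
  assumes el: "elementary E X Y" and E': "E' \<subseteq> E" "\<And>e. e \<in> E \<Longrightarrow> \<beta> e \<in> X \<Longrightarrow> e \<in> E'"
  shows "elementary E' X Y"
proof -
  have "\<exists>M\<subseteq>E'. is_matching M \<and> \<beta> ` M = X - {x} \<and> \<alpha> ` M = Y - {y}" if xy: "x \<in> X" "y \<in> Y" for x y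
  proof -
    obtain M where M: "M \<subseteq> E" "is_matching M" "\<beta> ` M = X - {x}" "\<alpha> ` M = Y - {y}"
      using elementaryD(5)[OF el xy] by blast
    have "\<beta> e \<in> X" if "e \<in> M" for e using imageI[OF that, of \<beta>] M(3) by simp
    then have "M \<subseteq> E'" using M(1) E'(2) by blast
    then show ?thesis using M by blast
  qed
  moreover have "\<forall>e\<in>E'. \<beta> e \<in> X \<longrightarrow> \<alpha> e \<in> Y" using elementaryD(4)[OF el] E'(1) by blast
  ultimately show ?thesis using elementaryD(1-3)[OF el] by (simp add: elementary_def)
qed

text \<open>Delete all edges that do not meet \<open>X\<close>, except the matching \<open>N\<close>. If the deleted edge ends in \<open>N(X)\<close>, at a
vertex \<open>u\<close>, then the elementary graph loses \<open>u\<close> but keeps \<open>y = \<alpha> e\<^sub>0\<close>, all of whose neighbours have become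
dispensable. If it does not, the elementary graph is untouched, \<open>N\<close> loses at most two edges, and the
induction hypothesis applies. What remains is the disjoint union of the elementary graph and \<open>N\<close>. An edge
of \<open>N\<close> is isolated, and if \<open>N\<close> is empty the elementary graph alone is large enough.\<close>

lemma matching_connected_private_vertex:
  assumes "finite E" and "elementary E X Y" and "card X \<noteq> 2"
    and "e\<^sub>0 \<in> E" "\<alpha> e\<^sub>0 \<in> Y" and "\<And>e. e \<in> E \<Longrightarrow> \<alpha> e = \<alpha> e\<^sub>0 \<Longrightarrow> \<beta> e \<in> X"
    and "N \<subseteq> E" "is_matching N" "\<And>e. e \<in> N \<Longrightarrow> \<beta> e \<notin> X \<and> \<alpha> e \<notin> Y"
    and "2 * k \<le> card X + card N"
  shows "matching_connected (Suc k) E"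
  using assms
proof (induction k arbitrary: E N)
  case 0
  then show ?case
    by (intro matching_connected_of_matching[of E "{e\<^sub>0}"]) (auto simp: is_matching_def)
next
  case (Suc k E N)
  note E = Suc.prems(1) and el = Suc.prems(2) and priv = Suc.prems(6) and N = Suc.prems(7,8,9)
  note fin = elementaryD(1-3)[OF el]
  let ?S = "{f \<in> E. \<beta> f \<notin> X} - N"
  have e\<^sub>0X: "\<beta> e\<^sub>0 \<in> X" using priv[OF Suc.prems(4)] by simp
  have finN: "finite N" using N(1) E by (rule finite_subset)
  have "matching_connected (Suc (Suc k)) (E - ?S)"
  proof (cases "N = {}")
    case False
    then obtain n where n: "n \<in> N" by blast
    show ?thesis
    proof (rule matching_connected_isolated)
      show "n \<in> E - ?S" using n N(1) by blast
      show "\<alpha> f \<noteq> \<alpha> n \<and> \<beta> f \<noteq> \<beta> n" if f: "f \<in> E - ?S" "f \<noteq> n" for f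
      proof (cases "f \<in> N")
        case True
        then show ?thesis using N(2) n f(2) by (auto simp: is_matching_def dest: inj_onD)
      next
        case False
        then have "\<beta> f \<in> X" "\<alpha> f \<in> Y" using f(1) elementaryD(4)[OF el] by auto
        then show ?thesis using N(3)[OF n] by metis
      qed
    qed (use E in simp)
  next
    case True
    have eq: "E - ?S = {f \<in> E. \<beta> f \<in> X}" using True by auto
    have el': "elementary (E - ?S) X Y" by (rule elementary_restrict[OF el]) (auto simp: eq)
    have finE': "finite (E - ?S)" using E by simp
    have big: "2 * Suc k \<le> card X" using Suc.prems(10) True by simp
    show ?thesis
    proof (cases "card X = 2 * Suc k")
      case True
      then show ?thesis
        using Suc.prems(3) by (intro matching_connected_elementary[OF finE' _ el']) (auto simp: eq)
    next
      case False
      obtain M where M: "M \<subseteq> E - ?S" "is_matching M" "\<beta> ` M = X"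
        using elementary_perfect_matching[OF el', of e\<^sub>0] Suc.prems(4) e\<^sub>0X by auto
      then have "card M = card X" using card_is_matching[OF M(2)] by simp
      then show ?thesis
        using False big by (intro matching_connected_of_matching[OF finE' M(1,2)]) simp
    qed
  qed
  then show ?case
  proof (rule matching_connected_peel[OF E, rotated])
    fix f E' assume f: "f \<in> ?S" and E': "E - ?S \<subseteq> E'" "E' \<subseteq> E"
    let ?E = "avoiding f E'"
    have fX: "\<beta> f \<notin> X" using f by simp
    have e\<^sub>0': "e\<^sub>0 \<in> E'" using E'(1) Suc.prems(4) e\<^sub>0X by blast
    have NE': "N \<subseteq> E'" using E'(1) N(1) by blast
    have finA: "finite ?E" using E E'(2) avoiding_subset by (metis finite_subset)
    have f\<^sub>0: "\<alpha> f \<noteq> \<alpha> e\<^sub>0" using priv[of f] f by auto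
    then have e\<^sub>0'': "e\<^sub>0 \<in> ?E" using e\<^sub>0' e\<^sub>0X fX by (auto simp: avoiding_def)
    show "matching_connected (Suc k) ?E"
    proof (cases "\<alpha> f \<in> Y")
      case True
      show ?thesis
      proof (rule matching_connected_avoidable_neighbours[OF finA e\<^sub>0'' refl])
        fix g assume g: "g \<in> ?E" "\<alpha> g = \<alpha> e\<^sub>0"
        then have gX: "\<beta> g \<in> X" using priv[of g] E'(2) by (auto simp: avoiding_def)
        obtain M where M: "M \<subseteq> E" "is_matching M" "\<beta> ` M = X - {\<beta> g}" "\<alpha> ` M = Y - {\<alpha> f}"
          using elementaryD(5)[OF el gX True] by blast
        have Mb: "\<beta> h \<in> X" "\<alpha> h \<noteq> \<alpha> f" if "h \<in> M" for h
          using imageI[OF that, of \<beta>] imageI[OF that, of \<alpha>] M(3,4) by auto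
        let ?N = "{n \<in> N. \<beta> n \<noteq> \<beta> f}"
        have "is_matching (M \<union> ?N)"
        proof (rule is_matching_Un[OF M(2)])
          show "is_matching ?N" using N(2) by (rule is_matching_subset) auto
          have "\<alpha> ` M \<subseteq> Y" "\<beta> ` M \<subseteq> X" unfolding M(3,4) by (rule Diff_subset)+
          moreover have "\<alpha> ` ?N \<subseteq> - Y" "\<beta> ` ?N \<subseteq> - X" using N(3) by (simp_all add: image_subset_iff)
          ultimately show "\<alpha> ` M \<inter> \<alpha> ` ?N = {}" "\<beta> ` M \<inter> \<beta> ` ?N = {}" by (meson ComplD disjoint_iff subsetD)+
        qed
        moreover have "2 * k \<le> card (M \<union> ?N)"
        proof -
          have "card M + 1 = card X"
            using card_is_matching[OF M(2)] M(3) card_Suc_Diff1[OF fin(1) gX] by simp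
          moreover have "card N \<le> card ?N + 1"
            using card_remove_fibre[OF _ finN, of \<beta> "\<beta> f"] N(2) by (simp add: is_matching_def)
          moreover have "card (M \<union> ?N) = card M + card ?N"
            using finN finite_subset[OF M(1) E] Mb(1) N(3) by (intro card_Un_disjoint) auto
          ultimately show ?thesis using Suc.prems(10) by simp
        qed
        moreover have "\<beta> g \<notin> \<beta> ` (M \<union> ?N)"
        proof -
          have "\<beta> g \<notin> \<beta> ` M" unfolding M(3) by simp
          moreover have "\<beta> g \<notin> \<beta> ` ?N" using N(3) gX by force
          ultimately show ?thesis by (simp add: image_Un)
        qed
        moreover have "M \<union> ?N \<subseteq> ?E"
        proof
          fix h assume "h \<in> M \<union> ?N"
          then consider "h \<in> M" | "h \<in> N" "\<beta> h \<noteq> \<beta> f" by blast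
          then show "h \<in> ?E"
          proof cases
            case 1
            then have "h \<in> E'" using M(1) Mb(1)[OF 1] E'(1) by blast
            then show ?thesis using Mb[OF 1] fX by (auto simp: avoiding_def)
          next
            case 2
            then show ?thesis using NE' N(3)[OF 2(1)] True by (auto simp: avoiding_def)
          qed
        qed
        ultimately show "\<exists>M\<subseteq>?E. is_matching M \<and> 2 * k \<le> card M \<and> \<beta> g \<notin> \<beta> ` M" by blast
      qed
    next
      case False
      show ?thesis
      proof (rule Suc.IH[OF finA, of "avoiding f N"])
        show "elementary ?E X Y"
        proof (rule elementary_restrict[OF el])
          show "?E \<subseteq> E" using E'(2) by (auto simp: avoiding_def)
          show "e \<in> ?E" if e: "e \<in> E" "\<beta> e \<in> X" for e
          proof -
            have "\<alpha> e \<in> Y" using elementaryD(4)[OF el e] .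
            then show ?thesis using e E'(1) fX False by (auto simp: avoiding_def)
          qed
        qed
        show "\<beta> e \<in> X" if "e \<in> ?E" "\<alpha> e = \<alpha> e\<^sub>0" for e
          using priv[of e] that E'(2) by (auto simp: avoiding_def)
        show "avoiding f N \<subseteq> ?E" using NE' by (auto simp: avoiding_def)
        show "is_matching (avoiding f N)" using N(2) avoiding_subset by (rule is_matching_subset)
        show "\<beta> e \<notin> X \<and> \<alpha> e \<notin> Y" if "e \<in> avoiding f N" for e
          using that N(3)[of e] by (simp add: avoiding_def)
        show "2 * k \<le> card X + card (avoiding f N)"
          using card_avoiding[OF N(2) finN, of f] Suc.prems(10) by simp
      qed (use Suc.prems(3,5) e\<^sub>0'' in auto)
    qed
  qed blast
qed

end

section \<open>Bipartite multigraphs as sets of edges with two endpoints\<close>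

definition endpoint :: "('v, 'e) multigraph \<Rightarrow> 'v set \<Rightarrow> 'e \<Rightarrow> 'v" where
  "endpoint G C e = the_elem (ends G e \<inter> C)"

lemma bipartite_sym:
  assumes "bipartite G A B" shows "bipartite G B A"
proof -
  have "\<exists>b\<in>B. \<exists>a\<in>A. ends G e = {b, a}" if "e \<in> edges G" for e
  proof -
    obtain a b where "a \<in> A" "b \<in> B" "ends G e = {a, b}"
      using assms \<open>e \<in> edges G\<close> unfolding bipartite_def by blast
    then have "b \<in> B \<and> a \<in> A \<and> ends G e = {b, a}" by auto
    then show ?thesis by blast
  qed
  moreover have "verts G = B \<union> A" "B \<inter> A = {}" using assms unfolding bipartite_def by blast+
  moreover have "finite (verts G)" "finite (edges G)" using assms unfolding bipartite_def by blast+
  ultimately show ?thesis unfolding bipartite_def by blast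
qed

lemma bipartite_delete_edges:
  assumes "bipartite G A B" shows "bipartite (delete_edges G F) A B"
proof -
  have "verts (delete_edges G F) = verts G" "edges (delete_edges G F) = edges G - F"
    "ends (delete_edges G F) = ends G" by (simp_all add: delete_edges_def)
  then show ?thesis using assms unfolding bipartite_def by (metis DiffD1 finite_Diff)
qed

lemma endpoint_delete_edges: "endpoint (delete_edges G F) = endpoint G"
  by (simp add: endpoint_def delete_edges_def fun_eq_iff)

lemma bipartite_finite:
  assumes "bipartite G A B"
  shows "finite (edges G)" "finite A" "finite B" "A \<inter> B = {}" "verts G = A \<union> B"
proof -
  have "finite (A \<union> B)" using assms unfolding bipartite_def by metis
  then show "finite (edges G)" "finite A" "finite B" "A \<inter> B = {}" "verts G = A \<union> B"
    using assms by (auto simp: bipartite_def)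
qed

lemma endpoints:
  assumes "bipartite G A B" "e \<in> edges G"
  shows "endpoint G A e \<in> A" "endpoint G B e \<in> B" "ends G e = {endpoint G A e, endpoint G B e}"
proof -
  obtain a b where ab: "a \<in> A" "b \<in> B" "ends G e = {a, b}" and dis: "A \<inter> B = {}"
    using assms unfolding bipartite_def by metis
  have "ends G e \<inter> A = {a}" "ends G e \<inter> B = {b}" using ab dis by auto
  then have "endpoint G A e = a" "endpoint G B e = b" by (simp_all add: endpoint_def)
  then show "endpoint G A e \<in> A" "endpoint G B e \<in> B" "ends G e = {endpoint G A e, endpoint G B e}"
    using ab by simp_all
qed

lemma ends_eq_iff:
  assumes "bipartite G A B" "e \<in> edges G" "b \<in> B"
  shows "ends G e = {b, a} \<longleftrightarrow> endpoint G A e = a \<and> endpoint G B e = b"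
proof -
  have "endpoint G A e \<noteq> b"
    using endpoints[OF assms(1,2)] bipartite_finite(4)[OF assms(1)] assms(3) by blast
  then show ?thesis using endpoints(3)[OF assms(1,2)] by (auto simp: doubleton_eq_iff)
qed

lemma ends_disjoint_iff:
  assumes G: "bipartite G A B" and e: "e \<in> edges G" and f: "f \<in> edges G"
  shows "ends G e \<inter> ends G f = {} \<longleftrightarrow> endpoint G A e \<noteq> endpoint G A f \<and> endpoint G B e \<noteq> endpoint G B f"
proof -
  have "endpoint G A e \<noteq> endpoint G B f" "endpoint G B e \<noteq> endpoint G A f"
    using endpoints[OF G e] endpoints[OF G f] bipartite_finite(4)[OF G] by (metis disjoint_iff)+
  then show ?thesis unfolding endpoints(3)[OF G e] endpoints(3)[OF G f] by auto
qed

lemma matching_iff: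
  assumes G: "bipartite G A B"
  shows "matching G M \<longleftrightarrow> M \<subseteq> edges G \<and> is_matching (endpoint G A) (endpoint G B) M"
proof -
  have eq: "(\<forall>e\<in>M. \<forall>f\<in>M. e \<noteq> f \<longrightarrow> ends G e \<inter> ends G f = {}) \<longleftrightarrow> is_matching (endpoint G A) (endpoint G B) M"
    if M: "M \<subseteq> edges G"
  proof -
    have "ends G e \<inter> ends G f = {} \<longleftrightarrow> endpoint G A e \<noteq> endpoint G A f \<and> endpoint G B e \<noteq> endpoint G B f"
      if "e \<in> M" "f \<in> M" for e f
      using ends_disjoint_iff[OF G] M that by blast
    then show ?thesis unfolding is_matching_def inj_on_def by blast
  qed
  show ?thesis unfolding matching_def by (rule conj_cong[OF refl eq])
qed

lemma independence_complex_line_graph: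
  assumes G: "bipartite G A B"
  shows "independence_complex (line_graph G) = matching_complex (endpoint G A) (endpoint G B) (edges G)"
proof -
  have "S \<in> independence_complex (line_graph G) \<longleftrightarrow> matching G S" for S
  proof (cases "S \<subseteq> edges G")
    case True
    then have "finite S" using bipartite_finite(1)[OF G] by (rule finite_subset)
    moreover have "u \<in> edges G" if "u \<in> S" for u using True that by blast
    ultimately show ?thesis
      using True by (simp add: independence_complex_def line_graph_def matching_def)
  qed (auto simp: independence_complex_def line_graph_def matching_def)
  then show ?thesis using matching_iff[OF G] by (auto simp: matching_complex_def)
qed

text \<open>The shift by two in \<^const>\<open>matching_connected\<close> turns \<open>Suc k\<close> into \<open>(k-1)\<close>-connectedness.\<close>

lemma graph_conn_gt:
  assumes G: "bipartite G A B"
    and c: "matching_connected (endpoint G A) (endpoint G B) (Suc k) (edges G)"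
  shows "ereal (real_of_int (int k - 2)) < graph_conn (line_graph G)"
proof -
  let ?R = "realization (matching_complex (endpoint G A) (endpoint G B) (edges G))"
  have "k_connected (int k - 1) (top_of_set ?R)"
    using c by (subst k_connected_iff_fills) (auto simp: matching_connected_def)
  then have "ereal (real_of_int (int k - 1)) \<le> graph_conn (line_graph G)"
    unfolding graph_conn_def conn_def independence_complex_line_graph[OF G] geometric_realization_eq
    by (intro Sup_upper CollectI exI[of _ "int k - 1"]) auto
  moreover have "ereal (real_of_int (int k - 2)) < ereal (real_of_int (int k - 1))" by simp
  ultimately show ?thesis by (rule less_le_trans[rotated])
qed

lemma neighbors_eq:
  assumes G: "bipartite G A B" and X: "X \<subseteq> B"
  shows "neighbors G X = endpoint G A ` {e \<in> edges G. endpoint G B e \<in> X}"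
proof (intro equalityI subsetI)
  fix y assume "y \<in> neighbors G X"
  then obtain x e where "x \<in> X" "e \<in> edges G" "ends G e = {x, y}" by (auto simp: neighbors_def)
  then have "endpoint G A e = y \<and> endpoint G B e = x" using ends_eq_iff[OF G, of e x y] X by blast
  then show "y \<in> endpoint G A ` {e \<in> edges G. endpoint G B e \<in> X}"
    using \<open>x \<in> X\<close> \<open>e \<in> edges G\<close> by blast
next
  fix y assume "y \<in> endpoint G A ` {e \<in> edges G. endpoint G B e \<in> X}"
  then obtain e where e: "e \<in> edges G" "endpoint G B e \<in> X" "y = endpoint G A e" by blast
  then have "ends G e = {endpoint G B e, y}" "y \<in> verts G"
    using endpoints[OF G e(1)] bipartite_finite(5)[OF G] by auto
  then show "y \<in> neighbors G X" using e unfolding neighbors_def by blast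
qed

lemma matching_number:
  assumes "finite (edges G)"
  shows "\<exists>M. matching G M \<and> card M = matching_number G"
    and "matching G M \<Longrightarrow> card M \<le> matching_number G"
proof -
  have fin: "finite (card ` {M. matching G M})"
  proof (rule finite_imageI, rule finite_subset)
    show "{M. matching G M} \<subseteq> Pow (edges G)" by (auto simp: matching_def)
  qed (use assms in simp)
  have "matching G {}" by (simp add: matching_def)
  then have "card ` {M. matching G M} \<noteq> {}" by blast
  then show "\<exists>M. matching G M \<and> card M = matching_number G"
    using Max_in[OF fin] unfolding matching_number_def by (metis (mono_tags, lifting) imageE mem_Collect_eq)
  show "card M \<le> matching_number G" if "matching G M"
    unfolding matching_number_def using that by (intro Max_ge[OF fin]) blast
qed

lemma edges_delete_to_outside:
  assumes G: "bipartite G A B"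
  shows "edges (delete_edges G {e \<in> edges G. \<exists>z\<in>B - X. ends G e = {y, z}}) =
    {e \<in> edges G. endpoint G A e = y \<longrightarrow> endpoint G B e \<in> X}"
proof -
  have "(\<exists>z\<in>B - X. ends G e = {y, z}) \<longleftrightarrow> endpoint G A e = y \<and> endpoint G B e \<notin> X" if e: "e \<in> edges G" for e
  proof -
    have "ends G e = {y, z} \<longleftrightarrow> endpoint G A e = y \<and> endpoint G B e = z" if "z \<in> B - X" for z
      using ends_eq_iff[OF G e, of z y] that by (simp add: insert_commute)
    then show ?thesis using endpoints(2)[OF G e] by (metis DiffD2 DiffI)
  qed
  then show ?thesis by (auto simp: delete_edges_def)
qed

section \<open>Good sets and minimal equineighbored sets\<close>

lemma image_fibre: "S \<subseteq> f ` M \<Longrightarrow> f ` {g \<in> M. f g \<in> S} = S"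
  by auto

lemma image_cofibre: "f ` {g \<in> M. f g \<notin> S} = f ` M - S"
  by auto

text \<open>A cover of the size of a maximum matching has exactly one end of each edge of any maximum matching.
Therefore maximum matchings survive the deletion of the edges from \<open>y\<close> to \<open>B \<setminus> X\<close>, and all remaining
neighbours of \<open>y\<close> are dispensable.\<close>

lemma good_if_tightly_avoidable:
  assumes G: "bipartite G A B" and X: "X \<subseteq> B" "card (neighbors G X) \<le> card X"
    and \<nu>: "matching_number G = 2 * k" "2 * k = card (neighbors G X) + card (B - X)"
    and conn: "graph_conn (line_graph G) = ereal (real_of_int (int k - 2))"
    and avoid: "\<And>x. x \<in> X \<Longrightarrow> \<exists>M. maximum_matching G M \<and> x \<notin> endpoint G B ` M"
  shows "good G B X"
proof -
  let ?\<alpha> = "endpoint G A" and ?\<beta> = "endpoint G B"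
  let ?E = "edges G" and ?N = "neighbors G X"
  note fin = bipartite_finite[OF G]
  have N: "?N = ?\<alpha> ` {e \<in> ?E. ?\<beta> e \<in> X}" using neighbors_eq[OF G X(1)] .
  have max: "M \<subseteq> ?E" "is_matching ?\<alpha> ?\<beta> M" "card M = 2 * k" "?\<beta> ` M \<subseteq> B" "finite M"
    if "maximum_matching G M" for M
  proof -
    show M: "M \<subseteq> ?E" "is_matching ?\<alpha> ?\<beta> M" "card M = 2 * k"
      using that \<nu>(1) by (auto simp: maximum_matching_def matching_iff[OF G])
    show "?\<beta> ` M \<subseteq> B" using M(1) endpoints(2)[OF G] by blast
    show "finite M" using M(1) fin(1) by (rule finite_subset)
  qed
  have le: "card M \<le> 2 * k" if "M \<subseteq> ?E" "is_matching ?\<alpha> ?\<beta> M" for M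
    using matching_number(2)[OF fin(1), of M] matching_iff[OF G, of M] that \<nu>(1) by simp
  have "decent G B X"
    unfolding decent_def
  proof (intro conjI ballI impI)
    fix x y e assume x: "x \<in> X" and "y \<in> neighbors G {x}" and e: "e \<in> ?E" "ends G e = {x, y}"
    have ab: "?\<alpha> e = y" "?\<beta> e = x" using ends_eq_iff[OF G e(1), of x y] e(2) x X(1) by blast+
    obtain M where M: "maximum_matching G M" "x \<notin> ?\<beta> ` M" using avoid[OF x] by blast
    note M' = max[OF M(1)]
    have "y \<in> ?\<alpha> ` M"
    proof (rule ccontr)
      assume "y \<notin> ?\<alpha> ` M"
      then have "is_matching ?\<alpha> ?\<beta> (insert e M)" using M'(2) M(2) ab by (intro is_matching_insert) auto
      moreover have "e \<notin> M" using M(2) ab by blast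
      ultimately show False using le[of "insert e M"] M' e(1) by simp
    qed
    then obtain g where g: "g \<in> M" "?\<alpha> g = y" by blast
    let ?M = "insert e (M - {g})"
    have "is_matching ?\<alpha> ?\<beta> ?M"
    proof (rule is_matching_insert)
      show "is_matching ?\<alpha> ?\<beta> (M - {g})" using M'(2) by (rule is_matching_subset) blast
      show "?\<alpha> e \<notin> ?\<alpha> ` (M - {g})"
      proof
        assume "?\<alpha> e \<in> ?\<alpha> ` (M - {g})"
        then obtain h where "h \<in> M - {g}" "?\<alpha> e = ?\<alpha> h" by blast
        then have h: "h \<in> M" "h \<noteq> g" "?\<alpha> h = ?\<alpha> g" using ab(1) g(2) by simp_all
        then show False using inj_onD[of ?\<alpha> M h g] M'(2) g(1) by (simp add: is_matching_def)
      qed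
      show "?\<beta> e \<notin> ?\<beta> ` (M - {g})" using M(2) ab by blast
    qed
    moreover have "?M \<subseteq> ?E" using M'(1) e(1) by blast
    moreover have "card ?M = 2 * k"
    proof -
      have "e \<notin> M - {g}" using M(2) ab by blast
      then show ?thesis using card_Suc_Diff1[OF M'(5) g(1)] M'(3,5) by simp
    qed
    ultimately have "maximum_matching G ?M"
      using \<nu>(1) by (simp add: maximum_matching_def matching_iff[OF G])
    then show "\<exists>M. maximum_matching G M \<and> e \<in> M" by blast
  qed (use X \<nu> in simp_all)
  moreover have "graph_conn (line_graph (delete_edges G {e \<in> ?E. \<exists>z\<in>B - X. ends G e = {y, z}}))
      > graph_conn (line_graph G)" if y: "y \<in> ?N" for y
  proof -
    let ?F = "{e \<in> ?E. \<exists>z\<in>B - X. ends G e = {y, z}}"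
    let ?G = "delete_edges G ?F"
    let ?E' = "{e \<in> ?E. ?\<alpha> e = y \<longrightarrow> ?\<beta> e \<in> X}"
    have E': "edges ?G = ?E'" using edges_delete_to_outside[OF G] .
    obtain e where e: "e \<in> ?E" "?\<beta> e \<in> X" "y = ?\<alpha> e" using y unfolding N by blast
    have "matching_connected ?\<alpha> ?\<beta> (Suc k) ?E'"
    proof (rule matching_connected_avoidable_neighbours[where e = e and y = y])
      fix f assume f: "f \<in> ?E'" "?\<alpha> f = y"
      then obtain M where M: "maximum_matching G M" "?\<beta> f \<notin> ?\<beta> ` M" using avoid[of "?\<beta> f"] by blast
      note M' = max[OF M(1)]
      have "g \<in> ?E'" if "g \<in> M" for g
        using matching_meets_cover(2)[OF fin(3) X(1) fin(1) M'(1,2,4) that] M'(1,3) \<nu>(2) y that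
        unfolding N[symmetric] by auto
      then have "M \<subseteq> ?E'" by blast
      then show "\<exists>M\<subseteq>?E'. is_matching ?\<alpha> ?\<beta> M \<and> 2 * k \<le> card M \<and> ?\<beta> f \<notin> ?\<beta> ` M"
        using M(2) M'(2,3) by (intro exI[of _ M]) simp
    qed (use fin(1) e in simp_all)
    then have "matching_connected (endpoint ?G A) (endpoint ?G B) (Suc k) (edges ?G)"
      unfolding E' endpoint_delete_edges .
    from graph_conn_gt[OF bipartite_delete_edges[OF G] this] show ?thesis unfolding conn .
  qed
  ultimately show ?thesis unfolding good_def by blast
qed

text \<open>Otherwise the smallest set of maximum deficiency is nonempty and good.\<close>

lemma class_covered_if_no_good_set:
  assumes G: "bipartite G A B" and \<nu>: "matching_number G = 2 * k"
    and conn: "graph_conn (line_graph G) = ereal (real_of_int (int k - 2))"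
    and no_good: "\<not> (\<exists>X. X \<noteq> {} \<and> good G B X)"
  shows "\<exists>M. matching G M \<and> endpoint G B ` M = B"
proof (rule ccontr)
  assume uncovered: "\<not> ?thesis"
  let ?\<alpha> = "endpoint G A" and ?\<beta> = "endpoint G B"
  let ?E = "edges G"
  let ?N = "\<lambda>D. ?\<alpha> ` {e \<in> ?E. ?\<beta> e \<in> D}"
  note fin = bipartite_finite[OF G]
  have "\<exists>D\<subseteq>B. card (?N D) < card D"
  proof (rule ccontr)
    assume "\<not> ?thesis"
    then have "\<exists>M\<subseteq>?E. is_matching ?\<alpha> ?\<beta> M \<and> ?\<beta> ` M = B"
      by (intro matching_of_hall[OF fin(1,3)]) (metis not_le)
    then show False using uncovered matching_iff[OF G] by blast
  qed
  then obtain D\<^sub>0 where D\<^sub>0: "D\<^sub>0 \<subseteq> B" "card (?N D\<^sub>0) < card D\<^sub>0" by blast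
  have finN: "finite (?N D)" for D using fin(1) by simp
  have unN: "?N (C \<union> D) = ?N C \<union> ?N D" for C D by blast
  obtain X d where X: "X \<subseteq> B" "card X = card (?N X) + Suc d"
    and defs: "\<forall>D\<subseteq>B. card D \<le> card (?N D) + Suc d"
      "\<forall>x\<in>X. \<forall>D\<subseteq>B - {x}. card D \<le> card (?N D) + d"
    by (rule exists_minimal_maximum_deficiency[where N = ?N, OF fin(3) finN unN D\<^sub>0])
  have def: "card D \<le> card (?N D) + Suc d" if "D \<subseteq> B" for D using defs(1) that by simp
  have def': "card D \<le> card (?N D) + d" if "x \<in> X" "D \<subseteq> B - {x}" for x D using defs(2) that by simp
  have N: "neighbors G X = ?N X" using neighbors_eq[OF G X(1)] .
  have finX: "finite X" using X(1) fin(3) by (rule finite_subset)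
  have cardB: "card B = card X + card (B - X)"
    using card_Un_disjoint[of X "B - X"] finX fin(3) X(1) by (simp add: Un_absorb1)
  have le: "card M \<le> 2 * k" if "M \<subseteq> ?E" "is_matching ?\<alpha> ?\<beta> M" for M
    using matching_number(2)[OF fin(1), of M] matching_iff[OF G, of M] that \<nu> by simp
  have "2 * k \<le> card (?N X) + card (B - X)"
  proof -
    obtain M where "matching G M" "card M = 2 * k" using matching_number(1)[OF fin(1)] \<nu> by metis
    then have M: "M \<subseteq> ?E" "is_matching ?\<alpha> ?\<beta> M" "card M = 2 * k" using matching_iff[OF G] by auto
    then have "?\<beta> ` M \<subseteq> B" using endpoints(2)[OF G] by blast
    then show ?thesis using matching_meets_cover(1)[OF fin(3) X(1) fin(1) M(1,2)] M(3) by simp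
  qed
  moreover have "card (?N X) + card (B - X) \<le> 2 * k"
  proof -
    obtain M where "M \<subseteq> ?E" "is_matching ?\<alpha> ?\<beta> M" "card B \<le> card M + Suc d"
      using matching_of_hall_deficiency[where \<alpha> = ?\<alpha> and \<beta> = ?\<beta>, OF fin(1,3) def] by blast
    then show ?thesis using le[of M] cardB X(2) by simp
  qed
  ultimately have \<nu>': "2 * k = card (?N X) + card (B - X)" by simp
  have "good G B X"
  proof (rule good_if_tightly_avoidable[OF G X(1) _ \<nu> _ conn])
    fix x assume x: "x \<in> X"
    obtain M where M: "M \<subseteq> ?E" "is_matching ?\<alpha> ?\<beta> M" "?\<beta> ` M \<subseteq> B - {x}" "card (B - {x}) \<le> card M + d"
      using matching_of_hall_deficiency[where \<alpha> = ?\<alpha> and \<beta> = ?\<beta>, OF fin(1) finite_Diff[OF fin(3)] def'[OF x]]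
      by blast
    have "Suc (card (B - {x})) = card B" using x X(1) fin(3) by (intro card_Suc_Diff1) auto
    then have "2 * k \<le> card M" using M(4) cardB X(2) \<nu>' by simp
    then have "maximum_matching G M"
      using le[OF M(1,2)] M(1,2) \<nu> by (simp add: maximum_matching_def matching_iff[OF G])
    then show "\<exists>M. maximum_matching G M \<and> x \<notin> ?\<beta> ` M" using M(3) by blast
  qed (use N X(2) \<nu>' in simp_all)
  moreover have "X \<noteq> {}" using X(2) by auto
  ultimately show False using no_good by blast
qed

text \<open>By minimality and the matching that covers \<open>B\<close>, every nonempty proper subset \<open>D\<close> of \<open>X\<close> has more than \<open>|D|\<close>
neighbours. So Hall's condition survives the loss of one neighbour.\<close>

lemma minimal_equineighbored_elementary:
  assumes G: "bipartite G A B" and X: "minimal_equineighbored G B X"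
    and M\<^sub>0: "matching G M\<^sub>0" "endpoint G B ` M\<^sub>0 = B"
  shows "elementary (endpoint G A) (endpoint G B) (edges G) X (neighbors G X)"
    and "D \<subset> X \<Longrightarrow> D \<noteq> {} \<Longrightarrow> card D < card (neighbors G D)"
proof -
  let ?\<alpha> = "endpoint G A" and ?\<beta> = "endpoint G B"
  let ?E = "edges G" and ?Y = "neighbors G X"
  note fin = bipartite_finite[OF G]
  have X': "X \<subseteq> B" "X \<noteq> {}" "card ?Y = card X"
    using X by (auto simp: minimal_equineighbored_def equineighbored_def)
  have finX: "finite X" using X'(1) fin(3) by (rule finite_subset)
  have N: "neighbors G D = ?\<alpha> ` {e \<in> ?E. ?\<beta> e \<in> D}" if "D \<subseteq> X" for D
    using neighbors_eq[OF G] X'(1) that by blast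
  have finY: "finite (neighbors G D)" if "D \<subseteq> X" for D using N[OF that] fin(1) by simp
  have M: "M\<^sub>0 \<subseteq> ?E" "is_matching ?\<alpha> ?\<beta> M\<^sub>0" using M\<^sub>0(1) matching_iff[OF G] by auto
  have surplus: "card D < card (neighbors G D)" if D: "D \<subset> X" "D \<noteq> {}" for D
  proof -
    let ?M = "{g \<in> M\<^sub>0. ?\<beta> g \<in> D}"
    have "?\<beta> ` ?M = D" using M\<^sub>0(2) D(1) X'(1) by (intro image_fibre) auto
    moreover have "is_matching ?\<alpha> ?\<beta> ?M" using M(2) by (rule is_matching_subset) blast
    ultimately have "card D = card (?\<alpha> ` ?M)"
      using card_image[of ?\<alpha> ?M] card_image[of ?\<beta> ?M] by (simp add: is_matching_def)
    also have "\<dots> \<le> card (neighbors G D)"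
      using M(1) D(1) N[of D] finY[of D] by (intro card_mono) auto
    finally have "card D \<le> card (neighbors G D)" .
    moreover have "card (neighbors G D) \<noteq> card D"
      using X D by (auto simp: minimal_equineighbored_def equineighbored_def)
    ultimately show ?thesis by simp
  qed
  show "card D < card (neighbors G D)" if "D \<subset> X" "D \<noteq> {}" using surplus[OF that] .
  have "\<exists>M\<subseteq>?E. is_matching ?\<alpha> ?\<beta> M \<and> ?\<beta> ` M = X - {x} \<and> ?\<alpha> ` M = ?Y - {y}" if x: "x \<in> X" and y: "y \<in> ?Y" for x y
  proof -
    let ?E' = "{e \<in> ?E. ?\<alpha> e \<noteq> y}"
    have "\<exists>M\<subseteq>?E'. is_matching ?\<alpha> ?\<beta> M \<and> ?\<beta> ` M = X - {x}"
    proof (rule matching_of_hall)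
      fix D assume D: "D \<subseteq> X - {x}"
      have eq: "?\<alpha> ` {e \<in> ?E'. ?\<beta> e \<in> D} = neighbors G D - {y}"
        using N[of D] D by auto
      show "card D \<le> card (?\<alpha> ` {e \<in> ?E'. ?\<beta> e \<in> D})"
      proof (cases "D = {}")
        case False
        have "D \<subset> X" using D x by blast
        then have "card D < card (neighbors G D)" using False by (rule surplus)
        then show ?thesis unfolding eq by (simp add: card_Diff_singleton_if) arith
      qed simp
    qed (use fin(1) finX in simp_all)
    then obtain M where M: "M \<subseteq> ?E'" "is_matching ?\<alpha> ?\<beta> M" "?\<beta> ` M = X - {x}" by blast
    have "?\<alpha> ` M \<subseteq> ?Y - {y}"
    proof
      fix z assume "z \<in> ?\<alpha> ` M"
      then obtain g where g: "g \<in> M" "z = ?\<alpha> g" by blast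
      have "?\<beta> g \<in> X" using imageI[OF g(1), of ?\<beta>] M(3) by simp
      then show "z \<in> ?Y - {y}" using g M(1) N[of X] by auto
    qed
    moreover have "card (?\<alpha> ` M) = card (?Y - {y})"
    proof -
      have "card (?\<alpha> ` M) = card M" using M(2) by (intro card_image) (simp add: is_matching_def)
      also have "\<dots> = card X - 1" using card_is_matching[OF M(2)] M(3) x finX by simp
      also have "\<dots> = card (?Y - {y})" using X'(3) y finY[of X] by simp
      finally show ?thesis .
    qed
    ultimately have "?\<alpha> ` M = ?Y - {y}" using finY[of X] by (intro card_subset_eq) auto
    moreover have "M \<subseteq> ?E" using M(1) by blast
    ultimately show ?thesis using M(2,3) by blast
  qed
  moreover have "\<forall>e\<in>?E. ?\<beta> e \<in> X \<longrightarrow> ?\<alpha> e \<in> ?Y" using N[of X] by blast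
  ultimately show "elementary ?\<alpha> ?\<beta> ?E X ?Y"
    using finX finY[of X] X'(3) by (simp add: elementary_def)
qed

text \<open>A perfect matching of the elementary graph through a given edge is completed by the edges of \<open>M\<^sub>0\<close> outside
\<open>X\<close>. These avoid \<open>N(X)\<close>, because \<open>M\<^sub>0\<close> has as many edges as the cover \<open>N(X) \<union> (B \<setminus> X)\<close> has vertices.\<close>

lemma minimal_equineighbored_decent:
  assumes G: "bipartite G A B" and X: "minimal_equineighbored G B X"
    and M\<^sub>0: "matching G M\<^sub>0" "endpoint G B ` M\<^sub>0 = B"
  shows "decent G B X" and "e \<in> M\<^sub>0 \<Longrightarrow> endpoint G B e \<notin> X \<Longrightarrow> endpoint G A e \<notin> neighbors G X"
proof -
  let ?\<alpha> = "endpoint G A" and ?\<beta> = "endpoint G B"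
  let ?E = "edges G" and ?Y = "neighbors G X"
  note fin = bipartite_finite[OF G]
  have X': "X \<subseteq> B" "card ?Y = card X"
    using X by (auto simp: minimal_equineighbored_def equineighbored_def)
  have finX: "finite X" using X'(1) fin(3) by (rule finite_subset)
  have N: "?Y = ?\<alpha> ` {e \<in> ?E. ?\<beta> e \<in> X}" using neighbors_eq[OF G X'(1)] .
  have M: "M\<^sub>0 \<subseteq> ?E" "is_matching ?\<alpha> ?\<beta> M\<^sub>0" using M\<^sub>0(1) matching_iff[OF G] by auto
  have cardB: "card B = card ?Y + card (B - X)"
    using card_Un_disjoint[of X "B - X"] finX fin(3) X' by (simp add: Un_absorb1)
  have cardM: "card M\<^sub>0 = card B" using card_is_matching[OF M(2)] M\<^sub>0(2) by simp
  have \<nu>: "matching_number G = card B"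
  proof (rule antisym)
    obtain M where "matching G M" "card M = matching_number G" using matching_number(1)[OF fin(1)] by blast
    then have "M \<subseteq> ?E" "card (?\<beta> ` M) = matching_number G"
      using matching_iff[OF G, of M] card_is_matching[of ?\<alpha> ?\<beta> M] by auto
    moreover have "?\<beta> ` M \<subseteq> B" using endpoints(2)[OF G] \<open>M \<subseteq> ?E\<close> by blast
    ultimately show "matching_number G \<le> card B" using card_mono[OF fin(3)] by metis
    show "card B \<le> matching_number G" using matching_number(2)[OF fin(1) M\<^sub>0(1)] cardM by simp
  qed
  have outside: "?\<alpha> g \<notin> ?Y" if "g \<in> M\<^sub>0" "?\<beta> g \<notin> X" for g
    using matching_meets_cover(2)[OF fin(3) X'(1) fin(1) M _ that] M\<^sub>0(2) cardM cardB
    unfolding N[symmetric] by auto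
  show "?\<alpha> e \<notin> ?Y" if "e \<in> M\<^sub>0" "?\<beta> e \<notin> X" using outside[OF that] .
  show "decent G B X"
    unfolding decent_def
  proof (intro conjI ballI impI)
    fix x y e assume x: "x \<in> X" and "y \<in> neighbors G {x}" and e: "e \<in> ?E" "ends G e = {x, y}"
    have "?\<beta> e \<in> X" using ends_eq_iff[OF G e(1), of x y] e(2) x X'(1) by blast
    then obtain P where P: "P \<subseteq> ?E" "is_matching ?\<alpha> ?\<beta> P" "?\<beta> ` P = X" "?\<alpha> ` P = ?Y" "e \<in> P"
      using elementary_perfect_matching[OF minimal_equineighbored_elementary(1)[OF G X M\<^sub>0] e(1)] by blast
    let ?M = "P \<union> {g \<in> M\<^sub>0. ?\<beta> g \<notin> X}"
    have m: "is_matching ?\<alpha> ?\<beta> ?M"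
    proof (rule is_matching_Un[OF P(2)])
      show "is_matching ?\<alpha> ?\<beta> {g \<in> M\<^sub>0. ?\<beta> g \<notin> X}" using M(2) by (rule is_matching_subset) blast
      show "?\<alpha> ` P \<inter> ?\<alpha> ` {g \<in> M\<^sub>0. ?\<beta> g \<notin> X} = {}" unfolding P(4) using outside by blast
      show "?\<beta> ` P \<inter> ?\<beta> ` {g \<in> M\<^sub>0. ?\<beta> g \<notin> X} = {}" unfolding P(3) by blast
    qed
    have "?\<beta> ` {g \<in> M\<^sub>0. ?\<beta> g \<notin> X} = B - X"
      using image_cofibre[of ?\<beta> M\<^sub>0 X] M\<^sub>0(2) by simp
    then have "?\<beta> ` ?M = B" using P(3) X'(1) by (simp add: image_Un Un_absorb1)
    then have "card ?M = card B" using card_is_matching[OF m] by simp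
    moreover have "?M \<subseteq> ?E" using P(1) M(1) by blast
    ultimately have "maximum_matching G ?M"
      using m \<nu> by (simp add: maximum_matching_def matching_iff[OF G])
    then show "\<exists>M. maximum_matching G M \<and> e \<in> M" using P(5) by blast
  qed (use X' \<nu> cardB in simp_all)
qed

text \<open>As \<open>X\<close> is decent, it fails to be good because of some \<open>y\<close>, which becomes private to \<open>X\<close> in the graph of the
definition.\<close>

lemma card_minimal_equineighbored:
  assumes G: "bipartite G A B" and X: "minimal_equineighbored G B X"
    and M\<^sub>0: "matching G M\<^sub>0" "endpoint G B ` M\<^sub>0 = B" and card: "card B = 2 * k"
    and conn: "graph_conn (line_graph G) = ereal (real_of_int (int k - 2))"
    and bad: "\<not> good G B X"
  shows "card X = 2"
proof (rule ccontr)
  assume ne2: "card X \<noteq> 2"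
  let ?\<alpha> = "endpoint G A" and ?\<beta> = "endpoint G B"
  let ?E = "edges G" and ?Y = "neighbors G X"
  note fin = bipartite_finite[OF G]
  have X': "X \<subseteq> B" using X by (auto simp: minimal_equineighbored_def)
  have finX: "finite X" using X' fin(3) by (rule finite_subset)
  have N: "?Y = ?\<alpha> ` {e \<in> ?E. ?\<beta> e \<in> X}" using neighbors_eq[OF G X'] .
  have M: "M\<^sub>0 \<subseteq> ?E" "is_matching ?\<alpha> ?\<beta> M\<^sub>0" using M\<^sub>0(1) matching_iff[OF G] by auto
  obtain y where y: "y \<in> ?Y" and le: "\<not> graph_conn (line_graph G) <
      graph_conn (line_graph (delete_edges G {e \<in> ?E. \<exists>z\<in>B - X. ends G e = {y, z}}))"
    using bad minimal_equineighbored_decent(1)[OF G X M\<^sub>0] unfolding good_def by blast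
  let ?G = "delete_edges G {e \<in> ?E. \<exists>z\<in>B - X. ends G e = {y, z}}"
  let ?E' = "{e \<in> ?E. ?\<alpha> e = y \<longrightarrow> ?\<beta> e \<in> X}"
  let ?N = "{g \<in> M\<^sub>0. ?\<beta> g \<notin> X}"
  obtain e where e: "e \<in> ?E" "?\<beta> e \<in> X" "y = ?\<alpha> e" using y unfolding N by blast
  have outside: "?\<alpha> g \<notin> ?Y" if "g \<in> ?N" for g
    using minimal_equineighbored_decent(2)[OF G X M\<^sub>0] that by blast
  have "matching_connected ?\<alpha> ?\<beta> (Suc k) ?E'"
  proof (rule matching_connected_private_vertex[where X = X and Y = ?Y and N = ?N and e\<^sub>0 = e])
    show "elementary ?\<alpha> ?\<beta> ?E' X ?Y"
      by (rule elementary_restrict[OF minimal_equineighbored_elementary(1)[OF G X M\<^sub>0]]) auto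
    have "g \<in> ?E'" if "g \<in> ?N" for g using outside[OF that] that M(1) y by auto
    then show "?N \<subseteq> ?E'" by blast
    show m: "is_matching ?\<alpha> ?\<beta> ?N" using M(2) by (rule is_matching_subset) blast
    have "?\<beta> ` ?N = B - X"
      using image_cofibre[of ?\<beta> M\<^sub>0 X] M\<^sub>0(2) by simp
    then have "card ?N = card (B - X)" using card_is_matching[OF m] by simp
    moreover have "card B = card X + card (B - X)"
      using card_Un_disjoint[of X "B - X"] finX fin(3) X' by (simp add: Un_absorb1)
    ultimately show "2 * k \<le> card X + card ?N" using card by simp
    show "?\<beta> g \<notin> X \<and> ?\<alpha> g \<notin> ?Y" if "g \<in> ?N" for g using outside[OF that] that by blast
  qed (use fin(1) ne2 e y in simp_all)
  then have "matching_connected (endpoint ?G A) (endpoint ?G B) (Suc k) (edges ?G)"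
    unfolding edges_delete_to_outside[OF G] endpoint_delete_edges .
  from graph_conn_gt[OF bipartite_delete_edges[OF G] this] show False using le unfolding conn by blast
qed

text \<open>Each of the two vertices of \<open>X\<close> has more than one neighbour, hence is adjacent to both vertices of \<open>N(X)\<close>.\<close>

lemma minimal_equineighbored_C4:
  assumes G: "bipartite G A B" and X: "minimal_equineighbored G B X" and card: "card X = 2"
    and M\<^sub>0: "matching G M\<^sub>0" "endpoint G B ` M\<^sub>0 = B"
  shows "is_C4_with_parallel_edges (induced_subgraph G (X \<union> neighbors G X))"
proof -
  let ?\<alpha> = "endpoint G A" and ?\<beta> = "endpoint G B"
  let ?E = "edges G" and ?Y = "neighbors G X"
  let ?H = "induced_subgraph G (X \<union> ?Y)"
  note fin = bipartite_finite[OF G]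
  have X': "X \<subseteq> B" "card ?Y = 2" using X card by (auto simp: minimal_equineighbored_def equineighbored_def)
  have N: "neighbors G D = ?\<alpha> ` {e \<in> ?E. ?\<beta> e \<in> D}" if "D \<subseteq> X" for D
    using neighbors_eq[OF G] X'(1) that by blast
  have Y: "?Y \<subseteq> A" unfolding N[OF subset_refl] using endpoints(1)[OF G] by auto
  obtain x\<^sub>1 x\<^sub>2 where x: "X = {x\<^sub>1, x\<^sub>2}" "x\<^sub>1 \<noteq> x\<^sub>2" using card by (auto simp: card_2_iff)
  obtain y\<^sub>1 y\<^sub>2 where y: "?Y = {y\<^sub>1, y\<^sub>2}" "y\<^sub>1 \<noteq> y\<^sub>2" using X'(2) by (auto simp: card_2_iff)
  have full: "neighbors G {x} = ?Y" if "x \<in> X" for x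
  proof (rule card_seteq)
    show "finite ?Y" using y(1) by simp
    show "neighbors G {x} \<subseteq> ?Y" using that by (auto simp: neighbors_def)
    have "{x} \<subset> X" using that x by auto
    then have "card {x} < card (neighbors G {x})"
      using minimal_equineighbored_elementary(2)[OF G X M\<^sub>0] by blast
    then show "card ?Y \<le> card (neighbors G {x})" using X'(2) by simp
  qed
  have edge: "\<exists>e\<in>edges ?H. ends ?H e = {x, y}" if "x \<in> X" "y \<in> ?Y" for x y
  proof -
    have "y \<in> neighbors G {x}" using full[OF that(1)] that(2) by simp
    then obtain e where "e \<in> ?E" "ends G e = {x, y}" by (auto simp: neighbors_def)
    then show ?thesis using that by (intro bexI[of _ e]) (simp_all add: induced_subgraph_def)
  qed
  have only: "\<exists>x\<in>X. \<exists>y\<in>?Y. ends ?H e = {x, y}" if e: "e \<in> edges ?H" for e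
  proof -
    have e': "e \<in> ?E" "ends G e \<subseteq> X \<union> ?Y" using e by (simp_all add: induced_subgraph_def)
    note ab = endpoints[OF G e'(1)]
    have "?\<beta> e \<in> X" using ab e'(2) Y fin(4) by auto
    moreover from this have "?\<alpha> e \<in> ?Y" using N[OF subset_refl] e'(1) by auto
    ultimately show ?thesis using ab(3) by (auto simp: induced_subgraph_def insert_commute)
  qed
  have disj: "x \<noteq> y" if "x \<in> X" "y \<in> ?Y" for x y using that X'(1) Y fin(4) by blast
  have "verts ?H = {x\<^sub>1, y\<^sub>1, x\<^sub>2, y\<^sub>2}"
    using x(1) y(1) X'(1) Y fin(5) by (auto simp: induced_subgraph_def)
  moreover have "distinct [x\<^sub>1, y\<^sub>1, x\<^sub>2, y\<^sub>2]"
    using x y disj[of x\<^sub>1 y\<^sub>1] disj[of x\<^sub>1 y\<^sub>2] disj[of x\<^sub>2 y\<^sub>1] disj[of x\<^sub>2 y\<^sub>2] by auto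
  moreover have "ends ?H ` edges ?H = {{x\<^sub>1, y\<^sub>1}, {y\<^sub>1, x\<^sub>2}, {x\<^sub>2, y\<^sub>2}, {y\<^sub>2, x\<^sub>1}}" (is "?L = ?R")
  proof
    show "?L \<subseteq> ?R"
    proof
      fix u assume "u \<in> ?L"
      then obtain x' y' where "x' \<in> X" "y' \<in> ?Y" "u = {x', y'}" using only by blast
      moreover from this have "x' = x\<^sub>1 \<or> x' = x\<^sub>2" "y' = y\<^sub>1 \<or> y' = y\<^sub>2" using x(1) y(1) by blast+
      ultimately show "u \<in> ?R" by (auto simp: insert_commute)
    qed
    have in_L: "{x', y'} \<in> ?L" if "x' \<in> X" "y' \<in> ?Y" for x' y'
      using edge[OF that] by (metis imageI)
    have "x\<^sub>1 \<in> X" "x\<^sub>2 \<in> X" "y\<^sub>1 \<in> ?Y" "y\<^sub>2 \<in> ?Y" using x(1) y(1) by blast+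
    then show "?R \<subseteq> ?L"
      using in_L[of x\<^sub>1 y\<^sub>1] in_L[of x\<^sub>2 y\<^sub>1] in_L[of x\<^sub>2 y\<^sub>2] in_L[of x\<^sub>1 y\<^sub>2] by (simp add: insert_commute)
  qed
  ultimately show ?thesis unfolding is_C4_with_parallel_edges_def by blast
qed

theorem lemma4p7:
  fixes G :: "('v, 'e) multigraph" and A B :: "'v set" and k :: int
  assumes "bipartite G A B"
    and "int (matching_number G) = 2 * k"
    and "graph_conn (line_graph G) = ereal (real_of_int (k - 2))"
    and "\<not> (\<exists>X. X \<noteq> {} \<and> good G A X)"
    and "\<not> (\<exists>X. X \<noteq> {} \<and> good G B X)"
  shows "(\<exists>M. perfect_matching G M) \<and>
         (\<forall>X. minimal_equineighbored G A X \<or> minimal_equineighbored G B X \<longrightarrow>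
            card X = 2 \<and> is_C4_with_parallel_edges (induced_subgraph G (X \<union> neighbors G X)))"
proof -
  note G = assms(1) and G' = bipartite_sym[OF assms(1)]
  note fin = bipartite_finite[OF G]
  have "0 \<le> k" using assms(2) by linarith
  then obtain n where n: "k = int n" by (metis nonneg_int_cases)
  have \<nu>: "matching_number G = 2 * n" using assms(2) n by linarith
  have conn: "graph_conn (line_graph G) = ereal (real_of_int (int n - 2))" using assms(3) n by simp
  obtain MA where MA: "matching G MA" "endpoint G A ` MA = A"
    using class_covered_if_no_good_set[OF G' \<nu> conn assms(4)] by blast
  obtain MB where MB: "matching G MB" "endpoint G B ` MB = B"
    using class_covered_if_no_good_set[OF G \<nu> conn assms(5)] by blast
  have MA': "MA \<subseteq> edges G" "is_matching (endpoint G A) (endpoint G B) MA"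
    using MA(1) matching_iff[OF G] by auto
  have MB': "MB \<subseteq> edges G" "is_matching (endpoint G A) (endpoint G B) MB"
    using MB(1) matching_iff[OF G] by auto
  have inj: "inj_on (endpoint G A) MA" "inj_on (endpoint G B) MA" "inj_on (endpoint G A) MB" "inj_on (endpoint G B) MB"
    using MA'(2) MB'(2) by (auto simp: is_matching_def)
  have cMA: "card MA = card A" using card_image[OF inj(1)] MA(2) by simp
  have cMB: "card MB = card B" using card_image[OF inj(4)] MB(2) by simp
  have "endpoint G B ` MA \<subseteq> B" using MA'(1) endpoints(2)[OF G] by blast
  then have AB: "card A \<le> card B" using card_mono[OF fin(3)] card_image[OF inj(2)] cMA by metis
  have MB_A: "endpoint G A ` MB \<subseteq> A" using MB'(1) endpoints(1)[OF G] by blast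
  then have "card B \<le> card A" using card_mono[OF fin(2)] card_image[OF inj(3)] cMB by metis
  then have "card A \<le> card (endpoint G A ` MB)" using AB card_image[OF inj(3)] cMB by simp
  then have cover: "endpoint G A ` MB = A" using MB_A fin(2) by (intro card_seteq)
  have same: "card A = card B" using AB \<open>card B \<le> card A\<close> by simp
  have cB: "card B = 2 * n"
  proof (rule antisym)
    show "card B \<le> 2 * n" using matching_number(2)[OF fin(1) MB(1)] cMB \<nu> by simp
    obtain M where M: "matching G M" "card M = 2 * n" using matching_number(1)[OF fin(1)] \<nu> by metis
    then have "card (endpoint G B ` M) = 2 * n" "M \<subseteq> edges G"
      using matching_iff[OF G, of M] card_is_matching[of "endpoint G A" "endpoint G B" M] by auto
    moreover from this have "endpoint G B ` M \<subseteq> B" using endpoints(2)[OF G] by blast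
    ultimately show "2 * n \<le> card B" using card_mono[OF fin(3)] by metis
  qed
  have "(\<Union>e\<in>MB. ends G e) = verts G"
  proof -
    have "ends G e = {endpoint G A e, endpoint G B e}" if "e \<in> MB" for e
      using endpoints(3)[OF G] MB'(1) that by blast
    then have "(\<Union>e\<in>MB. ends G e) = endpoint G A ` MB \<union> endpoint G B ` MB" by auto
    then show ?thesis using cover MB(2) fin(5) by simp
  qed
  then have "perfect_matching G MB" using MB(1) by (simp add: perfect_matching_def)
  moreover have "card X = 2 \<and> is_C4_with_parallel_edges (induced_subgraph G (X \<union> neighbors G X))"
    if X: "minimal_equineighbored G A X \<or> minimal_equineighbored G B X" for X
    using X
  proof
    assume X: "minimal_equineighbored G A X"
    then have "X \<noteq> {}" by (simp add: minimal_equineighbored_def equineighbored_def)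
    then have "\<not> good G A X" using assms(4) by blast
    then have "card X = 2"
      using card_minimal_equineighbored[OF G' X MA _ conn] same cB by simp
    then show ?thesis using minimal_equineighbored_C4[OF G' X _ MA] by blast
  next
    assume X: "minimal_equineighbored G B X"
    then have "X \<noteq> {}" by (simp add: minimal_equineighbored_def equineighbored_def)
    then have "\<not> good G B X" using assms(5) by blast
    then have "card X = 2"
      using card_minimal_equineighbored[OF G X MB cB conn] by simp
    then show ?thesis using minimal_equineighbored_C4[OF G X _ MB] by blast
  qed
  ultimately show ?thesis by blast
qed

end
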